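(* Let $M$ be a $\sigma$-finite factor not isomorphic to $\mathbb{C}$ with strictly homogeneous state space. Then for any normal faithful state $\varphi$ on $M$, the centralizer $M_\varphi$ is a factor of type $\mathrm{II}_1$.
   Context: A $\sigma$-finite von Neumann algebra $M$ has strictly homogeneous state space if for any two normal faithful states $\varphi,\psi$ on $M$ there is a unitary $u\in M$ such that $u\varphi u^*=\psi$, where $(u\varphi u^* )(x)=\varphi(u^*xu)$. The centralizer of $\varphi$ is $M_\varphi=\{x\in M:\varphi(xy)=\varphi(yx)\text{ for all }y\in M\}$, equivalently the fixed point algebra of the modular automorphism group $\sigma^\varphi$. *)

theory Defs
  imports "HOL-Analysis.Analysis"
begin

section \<open>Complex Hilbert spaces\<close>

text \<open>
  The complex inner product is linear in its first argument, and its real part is the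
  inner product of \<^class>\<open>real_inner\<close>, which also fixes the norm.
\<close>

class complex_hilbert_space = real_inner + complete_space +
  fixes scaleC :: "complex \<Rightarrow> 'a \<Rightarrow> 'a"  (infixr "*\<^sub>C" 75)
    and cinner :: "'a \<Rightarrow> 'a \<Rightarrow> complex"
  assumes scaleC_add_right: "c *\<^sub>C (x + y) = c *\<^sub>C x + c *\<^sub>C y"
    and scaleC_add_left: "(c + d) *\<^sub>C x = c *\<^sub>C x + d *\<^sub>C x"
    and scaleC_scaleC: "c *\<^sub>C d *\<^sub>C x = (c * d) *\<^sub>C x"
    and scaleC_of_real: "complex_of_real r *\<^sub>C x = r *\<^sub>R x"
    and cinner_add_left: "cinner (x + y) z = cinner x z + cinner y z"
    and cinner_scaleC_left: "cinner (c *\<^sub>C x) y = c * cinner x y"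
    and cinner_commute: "cinner x y = cnj (cinner y x)"
    and Re_cinner: "Re (cinner x y) = inner x y"

instantiation complex :: complex_hilbert_space
begin

definition scaleC_complex :: "complex \<Rightarrow> complex \<Rightarrow> complex"
  where "scaleC_complex c x = c * x"

definition cinner_complex :: "complex \<Rightarrow> complex \<Rightarrow> complex"
  where "cinner_complex x y = x * cnj y"

instance
  by standard
    (simp_all add: scaleC_complex_def cinner_complex_def algebra_simps inner_complex_def
      scaleR_conv_of_real)

end

lemma cinner_self: "cinner x x = complex_of_real ((norm x)\<^sup>2)"
proof (rule complex_eqI)
  show "Re (cinner x x) = Re (complex_of_real ((norm x)\<^sup>2))"
    by (simp add: Re_cinner dot_square_norm)
  have "Im (cinner x x) = Im (cnj (cinner x x))"
    using cinner_commute[of x x] by simp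
  then show "Im (cinner x x) = Im (complex_of_real ((norm x)\<^sup>2))"
    by simp
qed

lemma cinner_add_right: "cinner x (y + z) = cinner x y + cinner x z"
  by (metis cinner_add_left cinner_commute complex_cnj_add)

lemma cinner_scaleC_right: "cinner x (c *\<^sub>C y) = cnj c * cinner x y"
  by (metis cinner_scaleC_left cinner_commute complex_cnj_mult)

lemma norm_scaleC: "norm (c *\<^sub>C x) = cmod c * norm x"
proof -
  have "complex_of_real ((norm (c *\<^sub>C x))\<^sup>2) = c * cnj c * complex_of_real ((norm x)\<^sup>2)"
    by (simp only: cinner_self[symmetric] cinner_scaleC_left cinner_scaleC_right ac_simps)
  also have "\<dots> = complex_of_real ((cmod c * norm x)\<^sup>2)"
    by (simp only: complex_norm_square[symmetric] power_mult_distrib of_real_mult)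
  finally have "(norm (c *\<^sub>C x))\<^sup>2 = (cmod c * norm x)\<^sup>2"
    by (simp only: of_real_eq_iff)
  then show ?thesis
    by (simp add: power2_eq_iff_nonneg)
qed

lemma bounded_linear_scaleC: "bounded_linear (\<lambda>x::'a::complex_hilbert_space. c *\<^sub>C x)"
proof (rule bounded_linear_intro)
  fix x y :: 'a and r :: real
  show "c *\<^sub>C (x + y) = c *\<^sub>C x + c *\<^sub>C y" by (rule scaleC_add_right)
  show "c *\<^sub>C (r *\<^sub>R x) = r *\<^sub>R (c *\<^sub>C x)"
    by (metis scaleC_of_real scaleC_scaleC mult.commute)
  show "norm (c *\<^sub>C x) \<le> norm x * cmod c"
    by (simp add: norm_scaleC)
qed

section \<open>Bounded operators\<close>

text \<open>
  Operators are elements of \<open>'a \<Rightarrow>\<^sub>L 'a\<close>, a type of real-linear maps;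
  \<open>bounded_ops\<close> singles out the complex-linear ones. The product is \<open>(o\<^sub>L)\<close>, the unit is
  \<^const>\<open>id_blinfun\<close>, and the complex multiple \<open>c A\<close> is \<open>scalar_op c o\<^sub>L A\<close>.
\<close>

definition bounded_ops :: "('a::complex_hilbert_space \<Rightarrow>\<^sub>L 'a) set"
  where "bounded_ops = {A. \<forall>c x. blinfun_apply A (c *\<^sub>C x) = c *\<^sub>C blinfun_apply A x}"

definition scalar_op :: "complex \<Rightarrow> ('a::complex_hilbert_space \<Rightarrow>\<^sub>L 'a)"
  where "scalar_op c = Blinfun (\<lambda>x. c *\<^sub>C x)"

lemma scalar_op_apply [simp]: "blinfun_apply (scalar_op c) x = c *\<^sub>C x"
  by (simp add: scalar_op_def bounded_linear_Blinfun_apply bounded_linear_scaleC)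

definition cadjoint :: "('a::complex_hilbert_space \<Rightarrow>\<^sub>L 'a) \<Rightarrow> ('a \<Rightarrow>\<^sub>L 'a)"
  where "cadjoint A =
    (THE B. \<forall>x y. cinner (blinfun_apply A x) y = cinner x (blinfun_apply B y))"

text \<open>The Riesz representation theorem shows that the description above is proper.\<close>

lemma riesz_real:
  fixes f :: "'a::{real_inner, complete_space} \<Rightarrow> real"
  assumes f: "bounded_linear f"
  shows "\<exists>z. \<forall>x. f x = inner x z"
proof -
  interpret f: bounded_linear f by (rule f)
  define J where "J x = (norm x)\<^sup>2 - 2 * f x" for x
  obtain K where K: "\<And>x. norm (f x) \<le> norm x * K" using f.bounded by blast
  have lower: "- K\<^sup>2 \<le> J x" for x
  proof -
    have "f x \<le> norm x * K" using K[of x] by simp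
    moreover have "0 \<le> (norm x - K)\<^sup>2" by simp
    ultimately show ?thesis by (simp add: J_def power2_diff)
  qed
  define m where "m = Inf (range J)"
  have bdd: "bdd_below (range J)" using lower by (intro bdd_belowI) auto
  have m_le: "m \<le> J x" for x unfolding m_def using bdd by (intro cInf_lower) auto
  have "\<exists>x. J x < m + inverse (real (Suc n))" for n
  proof -
    have "Inf (range J) < m + inverse (real (Suc n))" by (simp add: m_def)
    then show ?thesis using cInf_lessD[of "range J"] by auto
  qed
  then obtain X where X: "\<And>n. J (X n) < m + inverse (real (Suc n))" by metis
  have par: "(norm (x - y))\<^sup>2 = 2 * J x + 2 * J y - 4 * J ((1/2) *\<^sub>R (x + y))" for x y
    unfolding J_def power2_norm_eq_inner
    by (simp add: f.scaleR f.add inner_simps inner_commute field_simps)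
  have dist: "(norm (X i - X j))\<^sup>2 < 4 * inverse (real (Suc n))" if "n \<le> i" "n \<le> j" for i j n
  proof -
    have "inverse (real (Suc i)) \<le> inverse (real (Suc n))"
      "inverse (real (Suc j)) \<le> inverse (real (Suc n))"
      using that by (auto intro!: le_imp_inverse_le)
    then show ?thesis
      using X[of i] X[of j] m_le[of "(1/2) *\<^sub>R (X i + X j)"] par[of "X i" "X j"] by linarith
  qed
  have "Cauchy X"
  proof (rule CauchyI)
    fix e :: real assume "0 < e"
    then obtain n where n: "inverse (real (Suc n)) < e\<^sup>2 / 4"
      using reals_Archimedean[of "e\<^sup>2 / 4"] by auto
    have "norm (X i - X j) < e" if "n \<le> i" "n \<le> j" for i j
    proof (rule power2_less_imp_less)
      show "(norm (X i - X j))\<^sup>2 < e\<^sup>2" using dist[OF that] n by linarith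
    qed (use \<open>0 < e\<close> in simp)
    then show "\<exists>M. \<forall>m\<ge>M. \<forall>n\<ge>M. norm (X m - X n) < e" by blast
  qed
  then obtain z where z: "X \<longlonglongrightarrow> z" using Cauchy_convergent convergent_def by blast
  have lim: "(\<lambda>n. J (X n)) \<longlonglongrightarrow> J z"
    unfolding J_def by (intro tendsto_intros z f.tendsto)
  have "(\<lambda>n. m + inverse (real (Suc n))) \<longlonglongrightarrow> m"
    using tendsto_add[OF tendsto_const LIMSEQ_inverse_real_of_nat, of m] by simp
  then have "J z \<le> m"
    using X by (intro LIMSEQ_le[OF lim]) (auto intro: less_imp_le)
  then have min: "J z \<le> J (z + t *\<^sub>R x)" for t x using m_le order_trans by blast
  have "f x = inner x z" for x
  proof (cases "x = 0")
    case True then show ?thesis by (simp add: f.zero)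
  next
    case False
    define a where "a = f x - inner x z"
    define t where "t = a / inner x x"
    have pos: "inner x x > 0" using False by simp
    have "0 \<le> t\<^sup>2 * inner x x - 2 * t * a"
      using min[of t x] unfolding J_def power2_norm_eq_inner
      by (simp add: a_def f.add f.scaleR inner_simps inner_commute power2_eq_square algebra_simps)
    also have "\<dots> = - (a\<^sup>2 / inner x x)"
      using pos by (simp add: t_def power2_eq_square field_simps)
    finally have "a = 0" using pos by (simp add: divide_le_0_iff)
    then show ?thesis by (simp add: a_def)
  qed
  then show ?thesis by blast
qed

lemma cadjoint_unique:
  assumes "\<And>x y. cinner (blinfun_apply A x) y = cinner x (blinfun_apply B y)"
    and "\<And>x y. cinner (blinfun_apply A x) y = cinner x (blinfun_apply C y)"
  shows "B = C"
proof (rule blinfun_eqI)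
  fix y
  have "inner x (blinfun_apply B y) = inner x (blinfun_apply C y)" for x
    using assms by (metis Re_cinner)
  then show "blinfun_apply B y = blinfun_apply C y"
    using vector_eq_ldot by metis
qed

lemma cinner_cadjoint:
  fixes A :: "'a::complex_hilbert_space \<Rightarrow>\<^sub>L 'a"
  assumes "A \<in> bounded_ops"
  shows "cinner (blinfun_apply A x) y = cinner x (blinfun_apply (cadjoint A) y)"
proof -
  have "bounded_linear (\<lambda>x. inner (blinfun_apply A x) y)" for y
    by (intro bounded_linear_inner_left_comp blinfun.bounded_linear_right)
  then have "\<forall>y. \<exists>z. \<forall>x. inner (blinfun_apply A x) y = inner x z"
    using riesz_real by blast
  then obtain b where b: "\<And>x y. inner (blinfun_apply A x) y = inner x (b y)" by metis
  have "bounded_linear b"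
  proof (rule bounded_linear_intro)
    fix x y r
    show "b (x + y) = b x + b y"
      by (rule vector_eq_ldot[THEN iffD1]) (simp add: b[symmetric] inner_right_distrib)
    show "b (r *\<^sub>R x) = r *\<^sub>R b x"
      by (rule vector_eq_ldot[THEN iffD1]) (simp add: b[symmetric])
    have "norm (b x) * norm (b x) = inner (blinfun_apply A (b x)) x"
      by (simp add: b dot_square_norm power2_eq_square)
    also have "\<dots> \<le> norm (blinfun_apply A (b x)) * norm x" by (rule norm_cauchy_schwarz)
    also have "\<dots> \<le> norm A * norm (b x) * norm x"
      by (intro mult_right_mono norm_blinfun) simp
    finally have *: "norm (b x) * norm (b x) \<le> norm (b x) * (norm x * norm A)"
      by (simp add: ac_simps)
    show "norm (b x) \<le> norm x * norm A"
    proof (cases "norm (b x) = 0")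
      case False
      then show ?thesis using * by simp
    qed simp
  qed
  then have B: "blinfun_apply (Blinfun b) y = b y" for y
    by (simp add: bounded_linear_Blinfun_apply)
  have re: "Re (cinner (blinfun_apply A x) y) = Re (cinner x (b y))" for x y
    by (simp add: Re_cinner b)
  have "cinner (blinfun_apply A x) y = cinner x (b y)" for x y
  proof (rule complex_eqI)
    show "Im (cinner (blinfun_apply A x) y) = Im (cinner x (b y))"
      using re[of "\<i> *\<^sub>C x" y] assms by (simp add: bounded_ops_def cinner_scaleC_left)
  qed (rule re)
  then have ex: "\<forall>x y. cinner (blinfun_apply A x) y = cinner x (blinfun_apply (Blinfun b) y)"
    by (simp add: B)
  have "\<forall>x y. cinner (blinfun_apply A x) y = cinner x (blinfun_apply (cadjoint A) y)"
    unfolding cadjoint_def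
    by (rule theI[where P = "\<lambda>B. \<forall>x y. cinner (blinfun_apply A x) y = cinner x (blinfun_apply B y)",
          OF ex])
      (use ex cadjoint_unique in metis)
  then show ?thesis by blast
qed

section \<open>Von Neumann algebras and factors\<close>

definition commutant :: "('a::complex_hilbert_space \<Rightarrow>\<^sub>L 'a) set \<Rightarrow> ('a \<Rightarrow>\<^sub>L 'a) set"
  where "commutant S = {B \<in> bounded_ops. \<forall>A\<in>S. A o\<^sub>L B = B o\<^sub>L A}"

definition von_neumann_algebra :: "('a::complex_hilbert_space \<Rightarrow>\<^sub>L 'a) set \<Rightarrow> bool"
  where "von_neumann_algebra M \<longleftrightarrow>
    M \<subseteq> bounded_ops \<and> (\<forall>x\<in>M. cadjoint x \<in> M) \<and> commutant (commutant M) = M"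

definition vn_center :: "('a::complex_hilbert_space \<Rightarrow>\<^sub>L 'a) set \<Rightarrow> ('a \<Rightarrow>\<^sub>L 'a) set"
  where "vn_center M = M \<inter> commutant M"

text \<open>The zero algebra (on the zero space) is not counted as a factor.\<close>

definition factor :: "('a::complex_hilbert_space \<Rightarrow>\<^sub>L 'a) set \<Rightarrow> bool"
  where "factor M \<longleftrightarrow>
    von_neumann_algebra M \<and> vn_center M = range scalar_op \<and> (id_blinfun :: 'a \<Rightarrow>\<^sub>L 'a) \<noteq> 0"

definition isomorphic_to_complex :: "('a::complex_hilbert_space \<Rightarrow>\<^sub>L 'a) set \<Rightarrow> bool"
  where "isomorphic_to_complex M \<longleftrightarrow>
    (\<exists>f :: ('a \<Rightarrow>\<^sub>L 'a) \<Rightarrow> complex. bij_betw f M UNIV \<and>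
      (\<forall>x\<in>M. \<forall>y\<in>M. f (x + y) = f x + f y) \<and>
      (\<forall>c. \<forall>x\<in>M. f (scalar_op c o\<^sub>L x) = c * f x) \<and>
      (\<forall>x\<in>M. \<forall>y\<in>M. f (x o\<^sub>L y) = f x * f y) \<and>
      (\<forall>x\<in>M. f (cadjoint x) = cnj (f x)))"

section \<open>Projections and type\<close>

definition projections :: "('a::complex_hilbert_space \<Rightarrow>\<^sub>L 'a) set \<Rightarrow> ('a \<Rightarrow>\<^sub>L 'a) set"
  where "projections M = {p \<in> M. p o\<^sub>L p = p \<and> cadjoint p = p}"

definition sigma_finite_vn :: "('a::complex_hilbert_space \<Rightarrow>\<^sub>L 'a) set \<Rightarrow> bool"
  where "sigma_finite_vn M \<longleftrightarrow>
    (\<forall>P \<subseteq> projections M. 0 \<notin> P \<and> (\<forall>p\<in>P. \<forall>q\<in>P. p \<noteq> q \<longrightarrow> p o\<^sub>L q = 0) \<longrightarrow> countable P)"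

definition proj_le :: "('a::complex_hilbert_space \<Rightarrow>\<^sub>L 'a) \<Rightarrow> ('a \<Rightarrow>\<^sub>L 'a) \<Rightarrow> bool"
  where "proj_le p q \<longleftrightarrow> q o\<^sub>L p = p"

definition proj_equiv ::
  "('a::complex_hilbert_space \<Rightarrow>\<^sub>L 'a) set \<Rightarrow> ('a \<Rightarrow>\<^sub>L 'a) \<Rightarrow> ('a \<Rightarrow>\<^sub>L 'a) \<Rightarrow> bool"
  where "proj_equiv M p q \<longleftrightarrow> (\<exists>v\<in>M. cadjoint v o\<^sub>L v = p \<and> v o\<^sub>L cadjoint v = q)"

definition finite_projection ::
  "('a::complex_hilbert_space \<Rightarrow>\<^sub>L 'a) set \<Rightarrow> ('a \<Rightarrow>\<^sub>L 'a) \<Rightarrow> bool"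
  where "finite_projection M e \<longleftrightarrow>
    e \<in> projections M \<and> (\<forall>p\<in>projections M. proj_le p e \<and> proj_equiv M e p \<longrightarrow> p = e)"

definition abelian_projection ::
  "('a::complex_hilbert_space \<Rightarrow>\<^sub>L 'a) set \<Rightarrow> ('a \<Rightarrow>\<^sub>L 'a) \<Rightarrow> bool"
  where "abelian_projection M e \<longleftrightarrow>
    e \<in> projections M \<and>
    (\<forall>x\<in>M. \<forall>y\<in>M. (e o\<^sub>L x o\<^sub>L e) o\<^sub>L (e o\<^sub>L y o\<^sub>L e) = (e o\<^sub>L y o\<^sub>L e) o\<^sub>L (e o\<^sub>L x o\<^sub>L e))"

definition type_II :: "('a::complex_hilbert_space \<Rightarrow>\<^sub>L 'a) set \<Rightarrow> bool"
  where "type_II M \<longleftrightarrow>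
    von_neumann_algebra M \<and>
    (\<forall>e. abelian_projection M e \<longrightarrow> e = 0) \<and>
    (\<forall>z \<in> projections M \<inter> vn_center M. z \<noteq> 0 \<longrightarrow>
      (\<exists>e. finite_projection M e \<and> e \<noteq> 0 \<and> proj_le e z))"

definition type_II1 :: "('a::complex_hilbert_space \<Rightarrow>\<^sub>L 'a) set \<Rightarrow> bool"
  where "type_II1 M \<longleftrightarrow> type_II M \<and> finite_projection M id_blinfun"

section \<open>Normal faithful states\<close>

text \<open>
  The ultraweak (\<open>\<sigma>\<close>-weak) topology is the initial topology for the functionals
  \<open>A \<mapsto> \<Sum>n. \<langle>A \<xi>\<^sub>n, \<eta>\<^sub>n\<rangle>\<close> with square-summable \<open>\<xi>\<close> and \<open>\<eta>\<close>. A functional is normal if it is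
  continuous for this topology.
\<close>

definition ultraweak_topology :: "('a::complex_hilbert_space \<Rightarrow>\<^sub>L 'a) topology"
  where "ultraweak_topology = topology_generated_by
    {{A. (\<Sum>n. cinner (blinfun_apply A (\<xi> n)) (\<eta> n)) \<in> U} | \<xi> \<eta> U.
      summable (\<lambda>n. (norm (\<xi> n))\<^sup>2) \<and> summable (\<lambda>n. (norm (\<eta> n))\<^sup>2) \<and> open U}"

text \<open>
  A functional on \<open>M\<close> is a total function of which only the values on \<open>M\<close> matter.
\<close>

definition vn_state ::
  "('a::complex_hilbert_space \<Rightarrow>\<^sub>L 'a) set \<Rightarrow> (('a \<Rightarrow>\<^sub>L 'a) \<Rightarrow> complex) \<Rightarrow> bool"
  where "vn_state M \<phi> \<longleftrightarrow>
    (\<forall>x\<in>M. \<forall>y\<in>M. \<phi> (x + y) = \<phi> x + \<phi> y) \<and>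
    (\<forall>c. \<forall>x\<in>M. \<phi> (scalar_op c o\<^sub>L x) = c * \<phi> x) \<and>
    (\<forall>x\<in>M. \<phi> (cadjoint x o\<^sub>L x) \<in> \<real>\<^sub>\<ge>\<^sub>0) \<and>
    \<phi> id_blinfun = 1"

definition normal_faithful_state ::
  "('a::complex_hilbert_space \<Rightarrow>\<^sub>L 'a) set \<Rightarrow> (('a \<Rightarrow>\<^sub>L 'a) \<Rightarrow> complex) \<Rightarrow> bool"
  where "normal_faithful_state M \<phi> \<longleftrightarrow>
    vn_state M \<phi> \<and>
    continuous_map (subtopology ultraweak_topology M) euclidean \<phi> \<and>
    (\<forall>x\<in>M. \<phi> (cadjoint x o\<^sub>L x) = 0 \<longrightarrow> x = 0)"

definition unitaries :: "('a::complex_hilbert_space \<Rightarrow>\<^sub>L 'a) set \<Rightarrow> ('a \<Rightarrow>\<^sub>L 'a) set"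
  where "unitaries M = {u \<in> M. cadjoint u o\<^sub>L u = id_blinfun \<and> u o\<^sub>L cadjoint u = id_blinfun}"

definition strictly_homogeneous_state_space ::
  "('a::complex_hilbert_space \<Rightarrow>\<^sub>L 'a) set \<Rightarrow> bool"
  where "strictly_homogeneous_state_space M \<longleftrightarrow>
    (\<forall>\<phi> \<psi>. normal_faithful_state M \<phi> \<and> normal_faithful_state M \<psi> \<longrightarrow>
      (\<exists>u\<in>unitaries M. \<forall>x\<in>M. \<phi> (cadjoint u o\<^sub>L x o\<^sub>L u) = \<psi> x))"

definition centralizer ::
  "('a::complex_hilbert_space \<Rightarrow>\<^sub>L 'a) set \<Rightarrow> (('a \<Rightarrow>\<^sub>L 'a) \<Rightarrow> complex) \<Rightarrow> ('a \<Rightarrow>\<^sub>L 'a) set"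
  where "centralizer M \<phi> = {x \<in> M. \<forall>y\<in>M. \<phi> (x o\<^sub>L y) = \<phi> (y o\<^sub>L x)}"

end

theory Submission
  imports Defs
begin

text \<open>
  Write \<open>N\<close> for the centralizer of \<open>\<phi>\<close>. On \<open>N\<close> the state \<open>\<phi>\<close> is a faithful normal trace, so \<open>1\<close> is a finite
  projection of \<open>N\<close>; it remains to see that \<open>N\<close> is a von Neumann algebra, that its center is trivial,
  and that it has no abelian projections. The last two points rest on two facts about projections.

  First, \<open>N\<close> has many projections (\<open>subprojection_of_trace\<close>). If \<open>s \<noteq> 0, 1\<close> is a projection of \<open>M\<close> and
  \<open>0 < t < 1\<close>, the state \<open>t \<phi>(s x s)/\<phi>(s) + (1 - t) \<phi>((1-s) x (1-s))/\<phi>(1-s)\<close> has \<open>s\<close> in its centralizer with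
  weight \<open>t\<close>. It is conjugate to \<open>\<phi>\<close> by homogeneity, so a unitary conjugate of \<open>s\<close> lies in \<open>N\<close> and has
  trace \<open>t\<close>.

  Second, projections \<open>p\<close>, \<open>q\<close> of \<open>N\<close> of the same trace are equivalent in \<open>N\<close> (\<open>equal_trace_equivalent\<close>).
  Once it is known that every nonzero projection of \<open>M\<close> is equivalent to \<open>1\<close>, the corners \<open>p M p\<close> and
  \<open>q M q\<close> are copies of \<open>M\<close>, the restrictions of \<open>\<phi>\<close> become normal faithful states on \<open>M\<close>, and a unitary
  conjugating them gives a partial isometry from \<open>p\<close> to \<open>q\<close> that preserves \<open>\<phi>\<close> and hence lies in \<open>N\<close>.

  A nontrivial central projection \<open>z\<close> of \<open>N\<close> would now dominate a projection equivalent to one below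
  \<open>1 - z\<close>, and an abelian projection would split into two equivalent halves; both are absurd.

  It remains to prove that \<open>M\<close> is of type III (\<open>equivalent_to_one\<close>), and this is where homogeneity meets
  comparison theory. Given a projection \<open>e \<noteq> 0, 1\<close>, the first fact provides conjugates \<open>f\<^sub>n\<close> of \<open>e\<close> in
  \<open>N\<close> whose traces tend to \<open>1\<close> fast. Suprema in \<open>N\<close> are subadditive for the trace, so the projections
  \<open>g\<^sub>k = inf\<^sub>n\<^sub>\<ge>\<^sub>k f\<^sub>n\<close> increase to \<open>1\<close>, and each is equivalent to a subprojection of \<open>e\<close>. If \<open>e\<close> is
  finite, cancellation glues these equivalences to an isometry from \<open>1\<close> into \<open>e\<close> (\<open>one_le_limit\<close>). If \<open>e\<close>
  is infinite, such an isometry exists by an exhaustion argument (\<open>one_le_infinite\<close>). The argument of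
  Schroeder and Bernstein turns it into an isometry onto \<open>e\<close>.

  The comparison theory is built on polar decompositions, obtained as strong limits of polynomials.
  That \<open>N\<close> equals its double commutant follows from the ultraweak form of the density theorem, proved by
  amplification to square-summable sequences.
\<close>

notation blinfun_compose (infixl "\<cdot>" 70)
notation cadjoint ("_\<star>" [1000] 1000)

section \<open>The algebra of bounded operators\<close>

lemma comp_assoc: "(A \<cdot> B) \<cdot> C = A \<cdot> (B \<cdot> C)"
  by (rule blinfun_eqI) simp

lemma comp_id [simp]: "A \<cdot> id_blinfun = A" "id_blinfun \<cdot> A = A"
  by (auto intro: blinfun_eqI)

lemmas comp_distribs =
  bounded_bilinear.add_left[OF bounded_bilinear_blinfun_compose]
  bounded_bilinear.add_right[OF bounded_bilinear_blinfun_compose]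
  bounded_bilinear.diff_left[OF bounded_bilinear_blinfun_compose]
  bounded_bilinear.diff_right[OF bounded_bilinear_blinfun_compose]
  bounded_bilinear.minus_left[OF bounded_bilinear_blinfun_compose]
  bounded_bilinear.minus_right[OF bounded_bilinear_blinfun_compose]
  bounded_bilinear.scaleR_left[OF bounded_bilinear_blinfun_compose]
  bounded_bilinear.scaleR_right[OF bounded_bilinear_blinfun_compose]

lemmas op_simps = comp_distribs comp_assoc

lemma comp_zero [simp]: "A \<cdot> 0 = 0" "0 \<cdot> A = 0"
  by (auto intro: blinfun_eqI)

lemma comp_reduce: "A \<cdot> B = C \<Longrightarrow> A \<cdot> (B \<cdot> D) = C \<cdot> D"
  by (simp flip: comp_assoc)

lemma scaleC_one [simp]: "1 *\<^sub>C x = (x::'a::complex_hilbert_space)"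
  using scaleC_of_real[of 1 x] by simp

lemma scaleC_zero [simp]: "0 *\<^sub>C x = (0::'a::complex_hilbert_space)"
  using scaleC_of_real[of 0 x] by simp

lemma scalar_op_compose: "scalar_op c \<cdot> scalar_op d = scalar_op (c * d)"
  by (rule blinfun_eqI) (simp add: scaleC_scaleC)

lemma scalar_op_one [simp]: "scalar_op 1 = id_blinfun"
  by (rule blinfun_eqI) simp

lemma scalar_op_zero [simp]: "scalar_op 0 = 0"
  by (rule blinfun_eqI) simp

lemma scalar_op_of_real: "scalar_op (complex_of_real r) \<cdot> A = r *\<^sub>R A"
  by (rule blinfun_eqI) (simp add: scaleC_of_real blinfun.scaleR_left)

lemma scalar_op_add: "scalar_op (c + d) = scalar_op c + scalar_op d"
  by (rule blinfun_eqI) (simp add: scaleC_add_left blinfun.add_left)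

lemma bounded_opsD: "A \<in> bounded_ops \<Longrightarrow> A (c *\<^sub>C x) = c *\<^sub>C A x"
  by (simp add: bounded_ops_def)

lemma bounded_ops_zero: "0 \<in> bounded_ops"
  using bounded_linear.linear[OF bounded_linear_scaleC, THEN linear_0] by (auto simp: bounded_ops_def)

lemma bounded_ops_id: "id_blinfun \<in> bounded_ops"
  by (simp add: bounded_ops_def)

lemma bounded_ops_scalar: "scalar_op c \<in> bounded_ops"
  by (simp add: bounded_ops_def scaleC_scaleC mult.commute)

lemma bounded_ops_add: "A \<in> bounded_ops \<Longrightarrow> B \<in> bounded_ops \<Longrightarrow> A + B \<in> bounded_ops"
  by (simp add: bounded_ops_def blinfun.add_left scaleC_add_right)

lemma bounded_ops_compose: "A \<in> bounded_ops \<Longrightarrow> B \<in> bounded_ops \<Longrightarrow> A \<cdot> B \<in> bounded_ops"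
  by (simp add: bounded_ops_def)

lemma scalar_op_commute: "A \<in> bounded_ops \<Longrightarrow> A \<cdot> scalar_op c = scalar_op c \<cdot> A"
  by (rule blinfun_eqI) (simp add: bounded_opsD)

lemma inner_cadjoint: "A \<in> bounded_ops \<Longrightarrow> inner (A x) y = inner x (A\<star> y)"
  using cinner_cadjoint[of A x y] by (metis Re_cinner)

lemma inner_cadjoint': "A \<in> bounded_ops \<Longrightarrow> inner (A\<star> x) y = inner x (A y)"
  using inner_cadjoint[of A y x] by (simp add: inner_commute)

lemma cadjoint_eqI:
  assumes "A \<in> bounded_ops" "\<And>x y. inner (A x) y = inner x (blinfun_apply B y)"
  shows "A\<star> = B"
proof (rule blinfun_eqI)
  fix y
  have "inner x (A\<star> y) = inner x (B y)" for x
    using assms inner_cadjoint by metis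
  then show "A\<star> y = B y" using vector_eq_ldot by metis
qed

lemma bounded_ops_cadjoint: "A \<in> bounded_ops \<Longrightarrow> A\<star> \<in> bounded_ops"
proof -
  assume A: "A \<in> bounded_ops"
  have "cinner y (A\<star> (c *\<^sub>C x)) = cinner y (c *\<^sub>C A\<star> x)" for c x y
    by (simp add: cinner_cadjoint[OF A, symmetric] cinner_scaleC_right)
  then have "inner y (A\<star> (c *\<^sub>C x)) = inner y (c *\<^sub>C A\<star> x)" for c x y
    by (metis Re_cinner)
  then show ?thesis unfolding bounded_ops_def using vector_eq_ldot by blast
qed

lemma cadjoint_cadjoint: "A \<in> bounded_ops \<Longrightarrow> A\<star>\<star> = A"
  by (intro cadjoint_eqI bounded_ops_cadjoint) (auto simp: inner_cadjoint')

lemma cadjoint_compose: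
  "A \<in> bounded_ops \<Longrightarrow> B \<in> bounded_ops \<Longrightarrow> (A \<cdot> B)\<star> = B\<star> \<cdot> A\<star>"
  by (intro cadjoint_eqI bounded_ops_compose) (auto simp: inner_cadjoint)

lemma cadjoint_add:
  "A \<in> bounded_ops \<Longrightarrow> B \<in> bounded_ops \<Longrightarrow> (A + B)\<star> = A\<star> + B\<star>"
  by (intro cadjoint_eqI bounded_ops_add)
    (auto simp: inner_cadjoint blinfun.add_left inner_add_left inner_add_right)

lemma cadjoint_id [simp]: "id_blinfun\<star> = id_blinfun"
  by (intro cadjoint_eqI bounded_ops_id) auto

lemma cadjoint_zero [simp]: "0\<star> = 0"
  by (intro cadjoint_eqI bounded_ops_zero) auto

lemma cadjoint_scalar_op: "(scalar_op c)\<star> = scalar_op (cnj c)"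
proof (rule cadjoint_eqI[OF bounded_ops_scalar])
  fix x y :: 'a
  have "cinner (c *\<^sub>C x) y = cinner x (cnj c *\<^sub>C y)"
    by (simp add: cinner_scaleC_left cinner_scaleC_right)
  then show "inner (scalar_op c x) y = inner x (scalar_op (cnj c) y)"
    by (metis Re_cinner scalar_op_apply)
qed

lemma cadjoint_scaleR: "A \<in> bounded_ops \<Longrightarrow> (r *\<^sub>R A)\<star> = r *\<^sub>R A\<star>"
  unfolding scalar_op_of_real[symmetric]
  using scalar_op_commute[OF bounded_ops_cadjoint, of A "complex_of_real r"]
  by (simp only: cadjoint_compose bounded_ops_scalar cadjoint_scalar_op complex_cnj_complex_of_real)

lemma bounded_ops_scaleR: "A \<in> bounded_ops \<Longrightarrow> r *\<^sub>R A \<in> bounded_ops"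
  by (metis scalar_op_of_real bounded_ops_compose bounded_ops_scalar)

lemma cadjoint_diff:
  "A \<in> bounded_ops \<Longrightarrow> B \<in> bounded_ops \<Longrightarrow> (A - B)\<star> = A\<star> - B\<star>"
  using cadjoint_add[of A "(-1) *\<^sub>R B"] bounded_ops_scaleR[of B "-1"] cadjoint_scaleR[of B "-1"]
  by simp

lemma norm_sq_apply: "A \<in> bounded_ops \<Longrightarrow> (norm (A x))\<^sup>2 = inner ((A\<star> \<cdot> A) x) x"
  by (simp add: inner_cadjoint' power2_norm_eq_inner)

lemma cadjoint_compose_self_eq_zero: "A \<in> bounded_ops \<Longrightarrow> A\<star> \<cdot> A = 0 \<Longrightarrow> A = 0"
  by (rule blinfun_eqI) (metis norm_sq_apply blinfun.zero_left inner_zero_left power_eq_0_iff norm_eq_zero)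

text \<open>Polarization over the reals suffices, since the form of a self-adjoint operator is symmetric.\<close>

lemma selfadjoint_eqI:
  assumes A: "A \<in> bounded_ops" "A\<star> = A" and B: "B \<in> bounded_ops" "B\<star> = B"
    and eq: "\<And>x. inner (A x) x = inner (B x) x"
  shows "A = B"
proof (rule blinfun_eqI)
  fix x
  have "inner (A x) y = inner (B x) y" for y
  proof -
    have "inner (A y) x = inner (A x) y" "inner (B y) x = inner (B x) y"
      using inner_cadjoint[OF A(1)] inner_cadjoint[OF B(1)] A(2) B(2) by (metis inner_commute)+
    then show ?thesis
      using eq[of "x + y"] eq[of x] eq[of y] by (simp add: blinfun.add_right inner_add_left inner_add_right)
  qed
  then show "A x = B x" using vector_eq_rdot by metis
qed

text \<open>Positivity of the form at \<open>x - A x\<close>.\<close>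

lemma contraction_sq_le_form:
  assumes A: "A \<in> bounded_ops" "A\<star> = A"
    and pos: "\<And>x. 0 \<le> inner (A x) x" and contr: "\<And>x. norm (A x) \<le> norm x"
  shows "(norm (A x))\<^sup>2 \<le> inner (A x) x"
proof -
  have sym: "inner (A u) v = inner u (A v)" for u v using inner_cadjoint[OF A(1)] A(2) by metis
  have "inner (A (A x)) (A x) \<le> norm (A (A x)) * norm (A x)" by (rule norm_cauchy_schwarz)
  also have "\<dots> \<le> norm (A x) * norm (A x)" by (intro mult_right_mono contr) simp
  finally have "inner (A (A x)) (A x) \<le> (norm (A x))\<^sup>2" by (simp add: power2_eq_square)
  moreover have "0 \<le> inner (A x) x - 2 * (norm (A x))\<^sup>2 + inner (A (A x)) (A x)"
    using pos[of "x - A x"] sym[of "A x" x]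
    by (simp add: blinfun.diff_right inner_diff_left inner_diff_right power2_norm_eq_inner)
  ultimately show ?thesis by linarith
qed

section \<open>Strongly closed algebras\<close>

lemma Cauchy_dominated:
  fixes X :: "nat \<Rightarrow> 'a::real_normed_vector" and a :: "nat \<Rightarrow> 'b::real_normed_vector"
  assumes a: "Cauchy a" and dom: "\<And>m n. m \<le> n \<Longrightarrow> norm (X n - X m) \<le> C * norm (a n - a m)"
  shows "Cauchy X"
proof (rule CauchyI)
  fix e :: real assume "0 < e"
  then obtain N where N: "\<And>m n. m \<ge> N \<Longrightarrow> n \<ge> N \<Longrightarrow> norm (a m - a n) < e / (\<bar>C\<bar> + 1)"
    using CauchyD[OF a, of "e / (\<bar>C\<bar> + 1)"] by (auto simp: add_nonneg_pos)
  have *: "norm (X n - X m) < e" if "N \<le> m" "m \<le> n" for m n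
  proof -
    have "norm (X n - X m) \<le> C * norm (a n - a m)" by (rule dom[OF that(2)])
    also have "\<dots> \<le> (\<bar>C\<bar> + 1) * norm (a n - a m)" by (intro mult_right_mono) auto
    also have "\<dots> < e" using N[of n m] that by (simp add: pos_less_divide_eq add_nonneg_pos mult.commute)
    finally show ?thesis .
  qed
  have "norm (X m - X n) < e" if "N \<le> m" "N \<le> n" for m n
    using *[of m n] *[of n m] that by (cases "m \<le> n") (auto simp: norm_minus_commute)
  then show "\<exists>M. \<forall>m\<ge>M. \<forall>n\<ge>M. norm (X m - X n) < e" by blast
qed

lemma strong_tendsto_apply:
  fixes X :: "nat \<Rightarrow> 'a::real_normed_vector \<Rightarrow>\<^sub>L 'a"
  assumes bd: "\<And>n x. norm (X n x) \<le> C * norm x"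
    and X: "\<And>x. (\<lambda>n. X n x) \<longlonglongrightarrow> Y x" and z: "z \<longlonglongrightarrow> w"
  shows "(\<lambda>n. X n (z n)) \<longlonglongrightarrow> Y w"
proof -
  have "(\<lambda>n. C * norm (z n - w)) \<longlonglongrightarrow> C * 0"
    by (rule tendsto_mult_left) (simp add: LIM_zero z tendsto_norm_zero)
  then have "(\<lambda>n. X n (z n - w)) \<longlonglongrightarrow> 0"
    using Lim_null_comparison[where g = "\<lambda>n. C * norm (z n - w)" and f = "\<lambda>n. X n (z n - w)"] bd
    by simp
  then have "(\<lambda>n. X n (z n - w) + X n w) \<longlonglongrightarrow> 0 + Y w" by (intro tendsto_add X)
  then show ?thesis by (simp add: blinfun.diff_right)
qed

text \<open>
  Von Neumann algebras, their centers and centralizers of states are closed under bounded strong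
  limits of sequences. This closure property already yields polar decompositions and suprema of
  sequences of projections inside the algebra.
\<close>

locale strong_algebra =
  fixes W :: "('a::complex_hilbert_space \<Rightarrow>\<^sub>L 'a) set"
  assumes ops: "A \<in> W \<Longrightarrow> A \<in> bounded_ops"
    and scalar_mem: "scalar_op c \<in> W"
    and add_mem: "A \<in> W \<Longrightarrow> B \<in> W \<Longrightarrow> A + B \<in> W"
    and comp_mem: "A \<in> W \<Longrightarrow> B \<in> W \<Longrightarrow> A \<cdot> B \<in> W"
    and adj_mem: "A \<in> W \<Longrightarrow> A\<star> \<in> W"
    and lim_mem: "(\<And>n. X n \<in> W) \<Longrightarrow> (\<And>n x. norm (blinfun_apply (X n) x) \<le> C * norm x) \<Longrightarrow>
      (\<And>x. (\<lambda>n. blinfun_apply (X n) x) \<longlonglongrightarrow> blinfun_apply Y x) \<Longrightarrow> Y \<in> W"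
begin

lemma id_mem: "id_blinfun \<in> W" using scalar_mem[of 1] by simp

lemma zero_mem: "0 \<in> W" using scalar_mem[of 0] by simp

lemma scaleR_mem: "A \<in> W \<Longrightarrow> r *\<^sub>R A \<in> W"
  by (metis scalar_op_of_real comp_mem scalar_mem)

lemma diff_mem: "A \<in> W \<Longrightarrow> B \<in> W \<Longrightarrow> A - B \<in> W"
proof -
  assume "A \<in> W" "B \<in> W"
  then have "A + (- 1) *\<^sub>R B \<in> W" by (intro add_mem scaleR_mem)
  then show "A - B \<in> W" by simp
qed

lemmas mem_intros = add_mem comp_mem adj_mem id_mem zero_mem scaleR_mem diff_mem scalar_mem

lemmas adj_simps =
  cadjoint_compose[OF ops ops] cadjoint_add[OF ops ops] cadjoint_diff[OF ops ops]
  cadjoint_cadjoint[OF ops] cadjoint_scaleR[OF ops]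

lemma strong_limit:
  assumes X: "\<And>n. X n \<in> W" and bd: "\<And>n x. norm (blinfun_apply (X n) x) \<le> C * norm x"
    and conv: "\<And>x. Cauchy (\<lambda>n. blinfun_apply (X n) x)"
  obtains Y where "Y \<in> W" "\<And>x. (\<lambda>n. blinfun_apply (X n) x) \<longlonglongrightarrow> blinfun_apply Y x"
    "\<And>x. norm (blinfun_apply Y x) \<le> C * norm x"
proof -
  have "\<exists>y. (\<lambda>n. X n x) \<longlonglongrightarrow> y" for x using conv Cauchy_convergent convergent_def by blast
  then obtain f where f: "\<And>x. (\<lambda>n. X n x) \<longlonglongrightarrow> f x" by metis
  have bdf: "norm (f x) \<le> C * norm x" for x
    by (rule LIMSEQ_le_const2[OF tendsto_norm[OF f]]) (auto intro: bd)
  have "bounded_linear f"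
  proof (rule bounded_linear_intro)
    fix x y :: 'a and r :: real
    show "f (x + y) = f x + f y"
      by (rule LIMSEQ_unique[OF f]) (simp add: blinfun.add_right tendsto_add f)
    show "f (r *\<^sub>R x) = r *\<^sub>R f x"
      by (rule LIMSEQ_unique[OF f]) (simp add: blinfun.scaleR_right tendsto_scaleR f)
    show "norm (f x) \<le> norm x * C" using bdf[of x] by (simp add: mult.commute)
  qed
  then have Y: "blinfun_apply (Blinfun f) x = f x" for x by (simp add: bounded_linear_Blinfun_apply)
  show thesis
    by (rule that[of "Blinfun f"]) (auto simp: Y f bdf intro!: lim_mem[where X = X and C = C] X bd)
qed

lemma limit_selfadjoint:
  assumes X: "\<And>n. X n \<in> W" "\<And>n. (X n)\<star> = X n" and Y: "Y \<in> W"
    and lim: "\<And>x. (\<lambda>n. blinfun_apply (X n) x) \<longlonglongrightarrow> blinfun_apply Y x"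
  shows "Y\<star> = Y"
proof (rule cadjoint_eqI[OF ops[OF Y]])
  fix x y
  have "inner (X n x) y = inner x (X n y)" for n using inner_cadjoint[OF ops[OF X(1)]] X(2) by metis
  then have "(\<lambda>n. inner (X n x) y) \<longlonglongrightarrow> inner x (Y y)"
    using tendsto_inner[OF tendsto_const lim, of x y] by simp
  moreover have "(\<lambda>n. inner (X n x) y) \<longlonglongrightarrow> inner (Y x) y" by (intro tendsto_inner lim tendsto_const)
  ultimately show "inner (Y x) y = inner x (Y y)" using LIMSEQ_unique by blast
qed

end

lemma strong_algebra_Int:
  assumes "strong_algebra V" "strong_algebra W"
  shows "strong_algebra (V \<inter> W)"
proof -
  interpret V: strong_algebra V by fact
  interpret W: strong_algebra W by fact
  show ?thesis
  proof
    fix X Y and C :: real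
    assume "\<And>n::nat. X n \<in> V \<inter> W" "\<And>n x. norm (blinfun_apply (X n) x) \<le> C * norm x"
      "\<And>x. (\<lambda>n. blinfun_apply (X n) x) \<longlonglongrightarrow> blinfun_apply Y x"
    then show "Y \<in> V \<inter> W" using V.lim_mem[of X C Y] W.lim_mem[of X C Y] by blast
  qed (simp_all add: V.ops V.mem_intros W.mem_intros)
qed

lemma strong_algebra_commutant:
  assumes S: "S \<subseteq> bounded_ops" and adj: "\<And>A. A \<in> S \<Longrightarrow> A\<star> \<in> S"
  shows "strong_algebra (commutant S)"
proof
  fix A B :: "'a \<Rightarrow>\<^sub>L 'a" and c
  show "A \<in> commutant S \<Longrightarrow> A \<in> bounded_ops" by (simp add: commutant_def)
  show "scalar_op c \<in> commutant S"
    using S by (auto simp: commutant_def bounded_ops_scalar scalar_op_commute)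
  assume A: "A \<in> commutant S"
  show "A\<star> \<in> commutant S"
    unfolding commutant_def
  proof (intro CollectI conjI ballI)
    show "A\<star> \<in> bounded_ops" using A by (simp add: commutant_def bounded_ops_cadjoint)
    fix C assume C: "C \<in> S"
    have "(C\<star> \<cdot> A)\<star> = (A \<cdot> C\<star>)\<star>" using A adj[OF C] by (simp add: commutant_def)
    then show "C \<cdot> A\<star> = A\<star> \<cdot> C"
      using A C S by (auto simp: commutant_def cadjoint_compose cadjoint_cadjoint bounded_ops_cadjoint subset_iff)
  qed
  assume B: "B \<in> commutant S"
  show "A + B \<in> commutant S"
    using A B by (auto simp: commutant_def op_simps bounded_ops_add)
  show "A \<cdot> B \<in> commutant S"
    using A B by (simp add: commutant_def bounded_ops_compose) (metis comp_assoc)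
next
  fix X :: "nat \<Rightarrow> 'a \<Rightarrow>\<^sub>L 'a" and C and Y :: "'a \<Rightarrow>\<^sub>L 'a"
  assume X: "\<And>n. X n \<in> commutant S" and lim: "\<And>x. (\<lambda>n. X n x) \<longlonglongrightarrow> Y x"
  have XS: "A (X n x) = X n (A x)" if "A \<in> S" for A n x
  proof -
    have "A \<cdot> X n = X n \<cdot> A" using X[of n] that by (simp add: commutant_def)
    then show ?thesis by (metis blinfun_apply_blinfun_compose)
  qed
  have Xc: "X n (c *\<^sub>C x) = c *\<^sub>C X n x" for n c x
    using X[of n] by (simp add: commutant_def bounded_opsD)
  have "Y (c *\<^sub>C x) = c *\<^sub>C Y x" for c x
    by (rule LIMSEQ_unique[OF lim])
      (simp add: Xc bounded_linear.tendsto[OF bounded_linear_scaleC lim])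
  moreover have "A (Y x) = Y (A x)" if "A \<in> S" for A x
  proof (rule LIMSEQ_unique)
    show "(\<lambda>n. A (X n x)) \<longlonglongrightarrow> A (Y x)"
      by (intro bounded_linear.tendsto[OF blinfun.bounded_linear_right lim])
    show "(\<lambda>n. A (X n x)) \<longlonglongrightarrow> Y (A x)" using lim[of "A x"] by (simp add: XS[OF that])
  qed
  ultimately show "Y \<in> commutant S"
    by (auto simp: commutant_def bounded_ops_def intro!: blinfun_eqI)
qed

lemma commutant_cadjoint:
  assumes "S \<subseteq> bounded_ops" "\<And>A. A \<in> S \<Longrightarrow> A\<star> \<in> S"
  shows "A \<in> commutant S \<Longrightarrow> A\<star> \<in> commutant S"
  using strong_algebra.adj_mem[OF strong_algebra_commutant[OF assms]] .

lemma commutant_bounded_ops: "commutant S \<subseteq> bounded_ops"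
  by (auto simp: commutant_def)

lemma strong_algebra_von_neumann:
  assumes "von_neumann_algebra M"
  shows "strong_algebra M"
proof -
  have "strong_algebra (commutant (commutant M))"
    using assms
    by (intro strong_algebra_commutant commutant_bounded_ops commutant_cadjoint)
      (auto simp: von_neumann_algebra_def)
  then show ?thesis using assms by (simp add: von_neumann_algebra_def)
qed

lemma strong_algebra_center:
  assumes "strong_algebra W"
  shows "strong_algebra (vn_center W)"
proof -
  interpret strong_algebra W by fact
  show ?thesis unfolding vn_center_def
    by (intro strong_algebra_Int strong_algebra_commutant assms) (auto intro: ops adj_mem)
qed

section \<open>Square roots and polar decomposition\<close>

context strong_algebra
begin

text \<open>
  The recursion \<open>Y\<^sub>n\<^sub>+\<^sub>1 = (a + Y\<^sub>n\<^sup>2) / 2\<close> with \<open>Y\<^sub>0 = 0\<close> tends to the operator \<open>b\<close> with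
  \<open>(1 - b)\<^sup>2 = 1 - a\<close>. It converges because the scalar sequence for \<open>a = 1\<close>, which increases to \<open>1\<close>,
  majorizes its increments.
\<close>

primrec sqrt_iter :: "('a \<Rightarrow>\<^sub>L 'a) \<Rightarrow> nat \<Rightarrow> ('a \<Rightarrow>\<^sub>L 'a)" where
  "sqrt_iter a 0 = 0"
| "sqrt_iter a (Suc n) = (1/2) *\<^sub>R (a + sqrt_iter a n \<cdot> sqrt_iter a n)"

primrec sqrt_majorant :: "nat \<Rightarrow> real" where
  "sqrt_majorant 0 = 0"
| "sqrt_majorant (Suc n) = (1 + (sqrt_majorant n)\<^sup>2) / 2"

lemma sqrt_majorant_bounds: "0 \<le> sqrt_majorant n \<and> sqrt_majorant n \<le> 1"
  by (induction n) (auto simp: power_le_one)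

lemma sqrt_majorant_mono: "sqrt_majorant n \<le> sqrt_majorant (Suc n)"
proof -
  have "0 \<le> (sqrt_majorant n - 1)\<^sup>2" by simp
  then show ?thesis by (simp add: power2_diff)
qed

lemma sqrt_iter_commute: "z \<cdot> a = a \<cdot> z \<Longrightarrow> z \<cdot> sqrt_iter a n = sqrt_iter a n \<cdot> z"
proof (induction n)
  case (Suc n)
  then have "z \<cdot> (sqrt_iter a n \<cdot> sqrt_iter a n) = sqrt_iter a n \<cdot> sqrt_iter a n \<cdot> z"
    by (metis comp_assoc)
  with Suc.prems show ?case by (simp add: comp_distribs)
qed simp

lemma sqrt_iter_norm: "norm a \<le> 1 \<Longrightarrow> norm (sqrt_iter a n) \<le> sqrt_majorant n"
proof (induction n)
  case (Suc n)
  have "norm (sqrt_iter a n \<cdot> sqrt_iter a n) \<le> (sqrt_majorant n)\<^sup>2"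
    using norm_blinfun_compose[of "sqrt_iter a n" "sqrt_iter a n"]
      mult_mono[OF Suc.IH[OF Suc.prems] Suc.IH[OF Suc.prems]] sqrt_majorant_bounds[of n]
    by (simp add: power2_eq_square)
  then show ?case
    using norm_triangle_ineq[of a "sqrt_iter a n \<cdot> sqrt_iter a n"] Suc.prems by simp
qed simp

lemma sqrt_iter_increment:
  assumes a: "norm a \<le> 1"
  shows "norm (sqrt_iter a (Suc n) - sqrt_iter a n) \<le> sqrt_majorant (Suc n) - sqrt_majorant n"
proof (induction n)
  case (Suc n)
  let ?Y = "sqrt_iter a n" and ?Z = "sqrt_iter a (Suc n)"
  let ?s = "sqrt_majorant n" and ?t = "sqrt_majorant (Suc n)"
  have "?Y \<cdot> a = a \<cdot> ?Y" using sqrt_iter_commute[of a a n] by simp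
  then have comm: "?Y \<cdot> ?Z = ?Z \<cdot> ?Y" by (rule sqrt_iter_commute)
  have "?Z \<cdot> ?Z - ?Y \<cdot> ?Y = (?Z - ?Y) \<cdot> (?Z + ?Y)"
    using comm by (simp add: comp_distribs del: sqrt_iter.simps)
  then have eq: "sqrt_iter a (Suc (Suc n)) - ?Z = (1/2) *\<^sub>R ((?Z - ?Y) \<cdot> (?Z + ?Y))"
    unfolding sqrt_iter.simps(2)[of a "Suc n"]
    by (subst (2) sqrt_iter.simps(2)) (simp add: scaleR_right_diff_distrib[symmetric] del: sqrt_iter.simps)
  have "norm (?Z + ?Y) \<le> ?t + ?s"
    using norm_triangle_ineq[of ?Z ?Y] sqrt_iter_norm[OF a, of n] sqrt_iter_norm[OF a, of "Suc n"]
    by linarith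
  then have "norm ((?Z - ?Y) \<cdot> (?Z + ?Y)) \<le> (?t - ?s) * (?t + ?s)"
    by (intro order_trans[OF norm_blinfun_compose] mult_mono Suc) 
      (use sqrt_majorant_mono[of n] in auto)
  moreover have "(?t - ?s) * (?t + ?s) = ?t\<^sup>2 - ?s\<^sup>2" by (simp add: power2_eq_square algebra_simps)
  moreover have "sqrt_majorant (Suc (Suc n)) - ?t = (?t\<^sup>2 - ?s\<^sup>2) / 2"
    by (simp add: field_simps)
  ultimately show ?case unfolding eq by (simp del: sqrt_iter.simps sqrt_majorant.simps)
qed (use a in simp)

lemma sqrt_iter_diff:
  assumes a: "norm a \<le> 1" and "m \<le> n"
  shows "norm (sqrt_iter a n - sqrt_iter a m) \<le> sqrt_majorant n - sqrt_majorant m"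
  using \<open>m \<le> n\<close>
proof (induction n rule: dec_induct)
  case (step n)
  show ?case
    using step.IH sqrt_iter_increment[OF a, of n]
      norm_triangle_ineq[of "sqrt_iter a (Suc n) - sqrt_iter a n" "sqrt_iter a n - sqrt_iter a m"]
    by (simp del: sqrt_iter.simps sqrt_majorant.simps)
qed simp

lemma sqrt_iter_mem: "a \<in> W \<Longrightarrow> sqrt_iter a n \<in> W"
  by (induction n) (auto intro!: mem_intros)

lemma sqrt_iter_adj: "a \<in> W \<Longrightarrow> a\<star> = a \<Longrightarrow> (sqrt_iter a n)\<star> = sqrt_iter a n"
  by (induction n) (simp_all add: adj_simps sqrt_iter_mem mem_intros)

lemma sqrt_exists:
  assumes aW: "a \<in> W" and sa: "a\<star> = a" and a: "norm a \<le> 1" and pos: "\<And>x. 0 \<le> inner (a x) x"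
  obtains b where "b \<in> W" "b\<star> = b" "\<And>x. norm (blinfun_apply b x) \<le> norm x"
    "\<And>x. 0 \<le> inner (blinfun_apply b x) x"
    "(id_blinfun - b) \<cdot> (id_blinfun - b) = id_blinfun - a" "\<And>z. z \<cdot> a = a \<cdot> z \<Longrightarrow> z \<cdot> b = b \<cdot> z"
proof -
  let ?Y = "sqrt_iter a"
  have bd: "norm (?Y n x) \<le> 1 * norm x" for n x
    using norm_blinfun[of "?Y n" x] sqrt_iter_norm[OF a, of n] sqrt_majorant_bounds[of n]
    by (meson dual_order.trans mult_right_mono norm_ge_zero)
  have "incseq sqrt_majorant" using sqrt_majorant_mono by (intro incseq_SucI)
  then have "Cauchy sqrt_majorant"
    using sqrt_majorant_bounds by (intro convergent_Cauchy) (metis incseq_convergent convergent_def)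
  have "Cauchy (\<lambda>n. ?Y n x)" for x
  proof (rule Cauchy_dominated[OF \<open>Cauchy sqrt_majorant\<close>, where C = "norm x"])
    fix m n :: nat assume "m \<le> n"
    have "norm (?Y n x - ?Y m x) \<le> norm (?Y n - ?Y m) * norm x"
      using norm_blinfun[of "?Y n - ?Y m" x] by (simp add: blinfun.diff_left)
    also have "\<dots> \<le> norm (sqrt_majorant n - sqrt_majorant m) * norm x"
      using sqrt_iter_diff[OF a \<open>m \<le> n\<close>] by (intro mult_right_mono) auto
    finally show "norm (?Y n x - ?Y m x) \<le> norm x * norm (sqrt_majorant n - sqrt_majorant m)"
      by (simp only: mult.commute)
  qed
  from strong_limit[of ?Y 1, OF sqrt_iter_mem[OF aW] bd this] obtain b where
    b: "b \<in> W" "\<And>x. (\<lambda>n. ?Y n x) \<longlonglongrightarrow> b x" "\<And>x. norm (b x) \<le> 1 * norm x"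
    by blast
  have b2: "b + b = a + b \<cdot> b"
  proof (rule blinfun_eqI)
    fix x
    have "(\<lambda>n. ?Y n (?Y n x)) \<longlonglongrightarrow> b (b x)"
      by (rule strong_tendsto_apply[OF bd b(2) b(2)])
    then have "(\<lambda>n. (1/2) *\<^sub>R (a x + ?Y n (?Y n x))) \<longlonglongrightarrow> (1/2) *\<^sub>R (a x + b (b x))"
      by (intro tendsto_scaleR tendsto_add tendsto_const)
    moreover have "(\<lambda>n. ?Y (Suc n) x) \<longlonglongrightarrow> b x"
      using b(2) by (rule LIMSEQ_Suc)
    ultimately have "(1/2) *\<^sub>R (a x + b (b x)) = b x"
      by (intro LIMSEQ_unique) (simp_all add: blinfun.scaleR_left blinfun.add_left)
    then have "2 *\<^sub>R ((1/2) *\<^sub>R (a x + b (b x))) = 2 *\<^sub>R b x" by simp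
    then show "(b + b) x = (a + b \<cdot> b) x" by (simp add: blinfun.add_left scaleR_2)
  qed
  have bsa: "b\<star> = b"
    by (rule limit_selfadjoint[OF sqrt_iter_mem[OF aW] sqrt_iter_adj[OF aW sa] b(1,2)])
  have bpos: "0 \<le> inner (b x) x" for x
  proof -
    have "inner ((b + b) x) x = inner (a x) x + (norm (b x))\<^sup>2"
      using inner_cadjoint[OF ops[OF b(1)], of "b x" x] bsa
      by (simp add: b2 blinfun.add_left inner_add_left power2_norm_eq_inner)
    then show ?thesis using pos[of x] by (simp add: blinfun.add_left inner_add_left) (smt (verit) zero_le_power2)
  qed
  have bcomm: "z \<cdot> b = b \<cdot> z" if z: "z \<cdot> a = a \<cdot> z" for z
  proof (rule blinfun_eqI)
    fix x
    have "z (?Y n x) = ?Y n (z x)" for n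
      using sqrt_iter_commute[OF z] by (metis blinfun_apply_blinfun_compose)
    moreover have "(\<lambda>n. z (?Y n x)) \<longlonglongrightarrow> z (b x)"
      by (intro bounded_linear.tendsto[OF blinfun.bounded_linear_right b(2)])
    ultimately show "(z \<cdot> b) x = (b \<cdot> z) x"
      using LIMSEQ_unique[OF _ b(2)[of "z x"]] by simp
  qed
  have "(id_blinfun - b) \<cdot> (id_blinfun - b) = id_blinfun - (b + b) + b \<cdot> b"
    by (simp add: comp_distribs)
  also have "\<dots> = id_blinfun - a" unfolding b2 by simp
  finally show thesis using b(3) by (intro that[of b] b(1) bsa bpos bcomm) auto
qed

text \<open>
  For a contraction \<open>x\<close> the operator \<open>1 - b\<close> below is \<open>|x|\<close>.
\<close>

lemma abs_exists:
  assumes xW: "x \<in> W" and x: "\<And>\<xi>. norm (blinfun_apply x \<xi>) \<le> norm \<xi>"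
  obtains b where "b \<in> W" "b\<star> = b" "\<And>\<xi>. norm (blinfun_apply b \<xi>) \<le> norm \<xi>"
    "\<And>\<xi>. 0 \<le> inner (blinfun_apply b \<xi>) \<xi>"
    "(id_blinfun - b) \<cdot> (id_blinfun - b) = x\<star> \<cdot> x"
    "\<And>\<xi>. norm (blinfun_apply x \<xi>) = norm (\<xi> - blinfun_apply b \<xi>)"
    "\<And>z. z \<cdot> (x\<star> \<cdot> x) = (x\<star> \<cdot> x) \<cdot> z \<Longrightarrow> z \<cdot> b = b \<cdot> z"
proof -
  let ?c = "x\<star> \<cdot> x" and ?a = "id_blinfun - x\<star> \<cdot> x"
  have cW: "?c \<in> W" and aW: "?a \<in> W" by (intro mem_intros xW)+
  have csa: "?c\<star> = ?c" using xW by (simp add: adj_simps mem_intros)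
  then have asa: "?a\<star> = ?a" using xW by (simp add: adj_simps mem_intros)
  have form: "inner (?c \<xi>) \<xi> = (norm (x \<xi>))\<^sup>2" for \<xi>
    by (simp add: norm_sq_apply[OF ops[OF xW]])
  have c1: "norm (?c \<xi>) \<le> norm \<xi>" for \<xi>
  proof (rule power2_le_imp_le)
    have "norm (x\<star> \<eta>) \<le> norm \<eta>" for \<eta>
    proof -
      have "norm (x\<star> \<eta>) * norm (x\<star> \<eta>) = inner (x (x\<star> \<eta>)) \<eta>"
        by (simp add: inner_cadjoint[OF ops[OF xW]] dot_square_norm power2_eq_square)
      also have "\<dots> \<le> norm (x (x\<star> \<eta>)) * norm \<eta>" by (rule norm_cauchy_schwarz)
      also have "\<dots> \<le> norm (x\<star> \<eta>) * norm \<eta>" by (intro mult_right_mono x) simp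
      finally show ?thesis by (cases "norm (x\<star> \<eta>) = 0") auto
    qed
    then have "norm (?c \<xi>) \<le> norm \<xi>" using x[of \<xi>] by (simp, meson order_trans)
    then show "(norm (?c \<xi>))\<^sup>2 \<le> (norm \<xi>)\<^sup>2" by (simp add: power_mono)
  qed simp
  have c2: "(norm (?c \<xi>))\<^sup>2 \<le> inner (?c \<xi>) \<xi>" for \<xi>
    by (rule contraction_sq_le_form[OF ops[OF cW] csa _ c1]) (simp add: form del: blinfun_apply_blinfun_compose)
  have "norm (?a \<xi>) \<le> 1 * norm \<xi>" for \<xi>
  proof -
    have "(norm (?a \<xi>))\<^sup>2 = (norm \<xi>)\<^sup>2 - 2 * inner (?c \<xi>) \<xi> + (norm (?c \<xi>))\<^sup>2"
      unfolding blinfun.diff_left power2_norm_eq_inner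
      by (simp add: inner_diff_left inner_diff_right inner_commute)
    also have "\<dots> \<le> (norm \<xi>)\<^sup>2"
      using c2[of \<xi>] form[of \<xi>] zero_le_power2[of "norm (x \<xi>)"] by linarith
    finally show ?thesis by simp
  qed
  then have "norm ?a \<le> 1" by (intro norm_blinfun_bound) auto
  moreover have "0 \<le> inner (?a \<xi>) \<xi>" for \<xi>
    using form[of \<xi>] x[of \<xi>] power_mono[of "norm (x \<xi>)" "norm \<xi>" 2]
    by (simp add: blinfun.diff_left inner_diff_left power2_norm_eq_inner)
  ultimately obtain b where b: "b \<in> W" "b\<star> = b" "\<And>\<xi>. norm (b \<xi>) \<le> norm \<xi>" "\<And>\<xi>. 0 \<le> inner (b \<xi>) \<xi>"
    "(id_blinfun - b) \<cdot> (id_blinfun - b) = id_blinfun - ?a" "\<And>z. z \<cdot> ?a = ?a \<cdot> z \<Longrightarrow> z \<cdot> b = b \<cdot> z"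
    using sqrt_exists[OF aW asa] by metis
  have sq: "(id_blinfun - b) \<cdot> (id_blinfun - b) = ?c" using b(5) by simp
  have "(norm (x \<xi>))\<^sup>2 = (norm (\<xi> - b \<xi>))\<^sup>2" for \<xi>
  proof -
    have "(id_blinfun - b)\<star> = id_blinfun - b" using b(1,2) by (simp add: adj_simps mem_intros)
    then show ?thesis
      using norm_sq_apply[OF ops[OF xW], of \<xi>] norm_sq_apply[OF ops[OF diff_mem[OF id_mem b(1)]], of \<xi>] sq
      by (simp add: blinfun.diff_left)
  qed
  then have "norm (x \<xi>) = norm (\<xi> - b \<xi>)" for \<xi> by (simp add: power2_eq_iff_nonneg)
  then show thesis
    by (rule that[OF b(1-4) sq]) (auto intro!: b(6) simp: comp_distribs)
qed

text \<open>
  Because \<open>b\<^sup>2 \<le> b\<close>, the numbers \<open>\<langle>b\<^sup>k \<xi>, \<xi>\<rangle>\<close> decrease, and they control the distances between the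
  vectors \<open>b\<^sup>k \<xi>\<close>. The limit is the projection onto the fixed vectors of \<open>b\<close>.
\<close>

lemma power_limit:
  assumes bW: "b \<in> W" and sa: "b\<star> = b" and b1: "\<And>\<xi>. norm (blinfun_apply b \<xi>) \<le> norm \<xi>"
    and pos: "\<And>\<xi>. 0 \<le> inner (blinfun_apply b \<xi>) \<xi>"
  obtains n where "n \<in> projections W" "b \<cdot> n = n" "n \<cdot> b = n"
    "\<And>\<xi>. (\<lambda>k. (blinfun_apply b ^^ k) \<xi>) \<longlonglongrightarrow> blinfun_apply n \<xi>"
proof -
  define P where "P k = ((\<cdot>) b ^^ k) id_blinfun" for k
  have P: "P k \<xi> = (blinfun_apply b ^^ k) \<xi>" for k \<xi>
    unfolding P_def by (induction k arbitrary: \<xi>) auto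
  have PW: "P k \<in> W" for k unfolding P_def by (induction k) (auto intro: mem_intros bW)
  have Pbd: "norm (P k \<xi>) \<le> 1 * norm \<xi>" for k \<xi>
    unfolding P by (induction k) (auto intro: order_trans[OF b1])
  have sym: "inner (b u) v = inner u (b v)" for u v using inner_cadjoint[OF ops[OF bW]] sa by metis
  have funpow_sym: "inner ((blinfun_apply b ^^ k) u) v = inner u ((blinfun_apply b ^^ k) v)" for k u v
    by (induction k arbitrary: v) (simp, metis comp_apply funpow.simps(2) funpow_swap1 sym)
  define \<beta> where "\<beta> \<xi> k = inner ((blinfun_apply b ^^ k) \<xi>) \<xi>" for \<xi> k
  have inner_P: "inner (P m \<xi>) (P n \<xi>) = \<beta> \<xi> (m + n)" for m n \<xi>
    unfolding P \<beta>_def by (simp add: funpow_sym funpow_add add.commute[of m n])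
  have form: "(norm (b \<xi>))\<^sup>2 \<le> inner (b \<xi>) \<xi>" for \<xi>
    by (rule contraction_sq_le_form[OF ops[OF bW] sa pos b1])
  have even: "\<beta> \<xi> (2 * k) = (norm (P k \<xi>))\<^sup>2" for \<xi> k
    by (simp add: power2_norm_eq_inner inner_P mult_2)
  have odd: "\<beta> \<xi> (Suc (2 * k)) = inner (b (P k \<xi>)) (P k \<xi>)" for \<xi> k
    using inner_P[of "Suc k" \<xi> k] by (simp add: P mult_2)
  have step: "\<beta> \<xi> (Suc k) \<le> \<beta> \<xi> k" and nonneg: "0 \<le> \<beta> \<xi> k" for \<xi> k
  proof -
    show "\<beta> \<xi> (Suc k) \<le> \<beta> \<xi> k"
    proof (cases "even k")
      case True
      then obtain j where "k = 2 * j" by blast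
      moreover have "inner (b (P j \<xi>)) (P j \<xi>) \<le> norm (P j \<xi>) * norm (P j \<xi>)"
        by (intro order_trans[OF norm_cauchy_schwarz] mult_right_mono b1) simp
      ultimately show ?thesis by (simp add: even odd power2_eq_square)
    next
      case False
      then obtain j where "k = Suc (2 * j)" by (metis oddE Suc_eq_plus1)
      moreover have "\<beta> \<xi> (2 * Suc j) = (norm (b (P j \<xi>)))\<^sup>2" unfolding even by (simp add: P)
      ultimately show ?thesis using form[of "P j \<xi>"] by (simp add: odd)
    qed
    show "0 \<le> \<beta> \<xi> k"
      using even[of \<xi> "k div 2"] odd[of \<xi> "k div 2"] pos
      by (cases "even k") (simp_all add: odd_two_times_div_two_succ flip: Suc_eq_plus1)
  qed
  have Cauchy: "Cauchy (\<lambda>k. P k \<xi>)" for \<xi>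
  proof -
    have "decseq (\<beta> \<xi>)" using step by (intro decseq_SucI)
    then obtain L where L: "\<beta> \<xi> \<longlonglongrightarrow> L" using decseq_convergent[of "\<beta> \<xi>" 0] nonneg by metis
    show ?thesis
    proof (rule CauchyI)
      fix e :: real assume "0 < e"
      then have "0 < e\<^sup>2 / 4" by simp
      then obtain N where N: "\<And>k. k \<ge> N \<Longrightarrow> norm (\<beta> \<xi> k - L) < e\<^sup>2 / 4"
        using LIMSEQ_D[OF L] by blast
      have "norm (P m \<xi> - P n \<xi>) < e" if "m \<ge> N" "n \<ge> N" for m n
      proof (rule power2_less_imp_less)
        have "(norm (P m \<xi> - P n \<xi>))\<^sup>2 = \<beta> \<xi> (m + m) + \<beta> \<xi> (n + n) - 2 * \<beta> \<xi> (m + n)"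
          unfolding power2_norm_eq_inner
          by (simp add: inner_diff_left inner_diff_right inner_P add.commute[of n m])
        also have "\<dots> < e\<^sup>2"
          using N[of "m + m"] N[of "n + n"] N[of "m + n"] that
          unfolding real_norm_def abs_less_iff by linarith
        finally show "(norm (P m \<xi> - P n \<xi>))\<^sup>2 < e\<^sup>2" .
      qed (use \<open>0 < e\<close> in simp)
      then show "\<exists>M. \<forall>m\<ge>M. \<forall>n\<ge>M. norm (P m \<xi> - P n \<xi>) < e" by blast
    qed
  qed
  from strong_limit[of P 1, OF PW Pbd Cauchy] obtain n where
    n: "n \<in> W" "\<And>\<xi>. (\<lambda>k. P k \<xi>) \<longlonglongrightarrow> n \<xi>" by metis
  have bn: "b (n \<xi>) = n \<xi>" for \<xi>
  proof (rule LIMSEQ_unique)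
    show "(\<lambda>k. b (P k \<xi>)) \<longlonglongrightarrow> b (n \<xi>)"
      by (rule bounded_linear.tendsto[OF blinfun.bounded_linear_right n(2)])
    show "(\<lambda>k. b (P k \<xi>)) \<longlonglongrightarrow> n \<xi>"
      using LIMSEQ_Suc[OF n(2)[of \<xi>]] by (simp add: P)
  qed
  have nb: "n (b \<xi>) = n \<xi>" for \<xi>
    by (rule LIMSEQ_unique[OF n(2)]) (use LIMSEQ_Suc[OF n(2)[of \<xi>]] in \<open>simp add: P funpow_swap1\<close>)
  have nn: "n (n \<xi>) = n \<xi>" for \<xi>
  proof (rule LIMSEQ_unique[OF n(2)])
    have "P k (n \<xi>) = n \<xi>" for k unfolding P by (induction k) (auto simp: bn)
    then show "(\<lambda>k. P k (n \<xi>)) \<longlonglongrightarrow> n \<xi>" by simp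
  qed
  have "(P k)\<star> = P k" for k by (rule cadjoint_eqI[OF ops[OF PW]]) (simp add: P funpow_sym)
  then have "n\<star> = n" by (rule limit_selfadjoint[OF PW _ n])
  then show thesis
    using n nn bn nb by (intro that[of n]) (auto simp: projections_def P intro!: blinfun_eqI)
qed

text \<open>
  With \<open>|x| = 1 - b\<close> and \<open>B\<^sub>k = 1 + b + \<dots> + b\<^sup>k\<^sup>-\<^sup>1\<close>, the operators \<open>|x| B\<^sub>k = 1 - b\<^sup>k\<close> tend to the support
  projection of \<open>x\<close>. As \<open>x\<close> and \<open>|x|\<close> have the same norms on vectors, \<open>x B\<^sub>k\<close> converges strongly as
  well, and its limit is the partial isometry of the polar decomposition.
\<close>

lemma contraction_polar:
  assumes xW: "x \<in> W" and x: "\<And>\<xi>. norm (blinfun_apply x \<xi>) \<le> norm \<xi>"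
  obtains v where "v \<in> W" "v \<cdot> v\<star> \<cdot> v = v" "x \<cdot> (v\<star> \<cdot> v) = x" "(v \<cdot> v\<star>) \<cdot> x = x"
    "\<And>z::'a \<Rightarrow>\<^sub>L 'a. x \<cdot> z = 0 \<Longrightarrow> v \<cdot> z = 0" "\<And>z::'a \<Rightarrow>\<^sub>L 'a. z \<cdot> x = 0 \<Longrightarrow> z \<cdot> v = 0"
proof -
  obtain b where b: "b \<in> W" "b\<star> = b" "\<And>\<xi>. norm (b \<xi>) \<le> norm \<xi>" "\<And>\<xi>. 0 \<le> inner (b \<xi>) \<xi>"
    and nx: "\<And>\<xi>. norm (x \<xi>) = norm (\<xi> - b \<xi>)"
    using abs_exists[OF xW x] by metis
  obtain n where n: "n \<in> projections W" "b \<cdot> n = n" "n \<cdot> b = n" and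
    lim: "\<And>\<xi>. (\<lambda>k. (blinfun_apply b ^^ k) \<xi>) \<longlonglongrightarrow> n \<xi>"
    using power_limit[OF b] by metis
  have nW: "n \<in> W" "n\<star> = n" "n \<cdot> n = n" using n(1) by (auto simp: projections_def)
  define P where "P k = ((\<cdot>) b ^^ k) id_blinfun" for k
  have P: "P k \<xi> = (blinfun_apply b ^^ k) \<xi>" for k \<xi>
    unfolding P_def by (induction k arbitrary: \<xi>) auto
  have PW: "P k \<in> W" for k unfolding P_def by (induction k) (auto intro: mem_intros b)
  have Pbd: "norm (P k \<xi>) \<le> norm \<xi>" for k \<xi>
    unfolding P by (induction k) (auto intro: order_trans[OF b(3)])
  define B where "B k = (\<Sum>i<k. P i)" for k
  have BW: "B k \<in> W" for k unfolding B_def by (induction k) (auto intro: mem_intros PW)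
  have B: "B k \<xi> - b (B k \<xi>) = \<xi> - P k \<xi>" for k \<xi>
  proof (induction k)
    case (Suc k)
    have "B (Suc k) \<xi> - b (B (Suc k) \<xi>) = (B k \<xi> - b (B k \<xi>)) + (P k \<xi> - P (Suc k) \<xi>)"
      by (simp add: B_def P blinfun.add_left blinfun.add_right)
    then show ?case by (simp only: Suc) simp
  qed (simp add: B_def P)
  have B': "B k (\<xi> - b \<xi>) = \<xi> - P k \<xi>" for k \<xi>
  proof (induction k)
    case (Suc k)
    have "B (Suc k) (\<xi> - b \<xi>) = B k (\<xi> - b \<xi>) + (P k \<xi> - P (Suc k) \<xi>)"
      by (simp add: B_def P blinfun.add_left blinfun.diff_right funpow_swap1)
    then show ?case by (simp only: Suc) simp
  qed (simp add: B_def P)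
  have diff: "norm ((x \<cdot> B k) \<xi> - (x \<cdot> B j) \<xi>) = norm (P j \<xi> - P k \<xi>)" for j k \<xi>
  proof -
    have "norm ((x \<cdot> B k) \<xi> - (x \<cdot> B j) \<xi>) = norm (x (B k \<xi> - B j \<xi>))" by (simp add: blinfun.diff_right)
    also have "\<dots> = norm ((B k \<xi> - b (B k \<xi>)) - (B j \<xi> - b (B j \<xi>)))"
      unfolding nx by (simp add: blinfun.diff_right algebra_simps)
    finally show ?thesis by (simp add: B norm_minus_commute)
  qed
  have nxB: "norm ((x \<cdot> B k) \<xi>) = norm (\<xi> - P k \<xi>)" for k \<xi> by (simp add: nx B)
  have bd: "norm ((x \<cdot> B k) \<xi>) \<le> 2 * norm \<xi>" for k \<xi>
    unfolding nxB using norm_triangle_ineq4[of \<xi> "P k \<xi>"] Pbd[of k \<xi>] by linarith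
  have "Cauchy (\<lambda>k. (x \<cdot> B k) \<xi>)" for \<xi>
  proof (rule Cauchy_dominated[where C = 1])
    show "Cauchy (\<lambda>k. P k \<xi>)" using LIMSEQ_imp_Cauchy[OF lim[of \<xi>]] by (simp add: P)
    show "norm ((x \<cdot> B k) \<xi> - (x \<cdot> B j) \<xi>) \<le> 1 * norm (P k \<xi> - P j \<xi>)" for j k
      unfolding diff by (simp add: norm_minus_commute)
  qed
  from strong_limit[of "\<lambda>k. x \<cdot> B k" 2, OF comp_mem[OF xW BW] bd this] obtain v where
    v: "v \<in> W" "\<And>\<xi>. (\<lambda>k. (x \<cdot> B k) \<xi>) \<longlonglongrightarrow> v \<xi>" by metis
  have nv: "norm (v \<xi>) = norm (\<xi> - n \<xi>)" for \<xi>
  proof (rule LIMSEQ_unique)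
    show "(\<lambda>k. norm ((x \<cdot> B k) \<xi>)) \<longlonglongrightarrow> norm (v \<xi>)" by (intro tendsto_norm v)
    show "(\<lambda>k. norm ((x \<cdot> B k) \<xi>)) \<longlonglongrightarrow> norm (\<xi> - n \<xi>)"
      unfolding nxB by (intro tendsto_norm tendsto_diff tendsto_const) (simp add: P lim)
  qed
  have psa: "(id_blinfun - n)\<star> = id_blinfun - n" "(id_blinfun - n) \<cdot> (id_blinfun - n) = id_blinfun - n"
    using nW by (simp_all add: adj_simps mem_intros comp_distribs)
  have pW: "id_blinfun - n \<in> W" by (intro mem_intros nW)
  have vv: "v\<star> \<cdot> v = id_blinfun - n"
  proof (rule selfadjoint_eqI)
    show "v\<star> \<cdot> v \<in> bounded_ops" "id_blinfun - n \<in> bounded_ops"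
      by (intro ops mem_intros v nW)+
    show "(v\<star> \<cdot> v)\<star> = v\<star> \<cdot> v" using v(1) by (simp add: adj_simps mem_intros)
    fix \<xi>
    show "inner ((v\<star> \<cdot> v) \<xi>) \<xi> = inner ((id_blinfun - n) \<xi>) \<xi>"
      using norm_sq_apply[OF ops[OF v(1)], of \<xi>] norm_sq_apply[OF ops[OF pW], of \<xi>] nv[of \<xi>]
      by (simp only: psa blinfun.diff_left blinfun_apply_id_blinfun)
  qed (rule psa)
  have "v \<cdot> n = 0"
  proof (rule blinfun_eqI)
    fix \<xi>
    have "n (n \<xi>) = n \<xi>" using nW(3) by (metis blinfun_apply_blinfun_compose)
    then show "(v \<cdot> n) \<xi> = blinfun_apply 0 \<xi>" using nv[of "n \<xi>"] by simp
  qed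
  then have vvv: "v \<cdot> v\<star> \<cdot> v = v" by (simp add: comp_assoc vv comp_distribs)
  have "x \<cdot> n = 0"
  proof (rule blinfun_eqI)
    fix \<xi>
    have "b (n \<xi>) = n \<xi>" using n(2) by (metis blinfun_apply_blinfun_compose)
    then show "(x \<cdot> n) \<xi> = blinfun_apply 0 \<xi>" using nx[of "n \<xi>"] by simp
  qed
  then have xvv: "x \<cdot> (v\<star> \<cdot> v) = x" by (simp add: vv comp_distribs)
  have vx: "v \<cdot> (id_blinfun - b) = x"
  proof (rule blinfun_eqI)
    fix \<xi>
    have "(\<lambda>k. x (\<xi> - P k \<xi>)) \<longlonglongrightarrow> x (\<xi> - n \<xi>)"
      by (intro bounded_linear.tendsto[OF blinfun.bounded_linear_right] tendsto_diff tendsto_const)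
        (simp add: P lim)
    moreover have "(\<lambda>k. x (\<xi> - P k \<xi>)) \<longlonglongrightarrow> v (\<xi> - b \<xi>)"
      using v(2)[of "\<xi> - b \<xi>"] by (simp add: B')
    moreover have "x (n \<xi>) = 0" using \<open>x \<cdot> n = 0\<close> by (metis blinfun_apply_blinfun_compose blinfun.zero_left)
    ultimately show "(v \<cdot> (id_blinfun - b)) \<xi> = x \<xi>"
      using LIMSEQ_unique by (fastforce simp: blinfun.diff_left blinfun.diff_right)
  qed
  have vvx: "v \<cdot> v\<star> \<cdot> x = x"
    by (subst (1 2) vx[symmetric]) (simp only: comp_assoc[symmetric] vvv)
  have left: "z \<cdot> v = 0" if "z \<cdot> x = 0" for z :: "'a \<Rightarrow>\<^sub>L 'a"
  proof (rule blinfun_eqI)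
    fix \<xi>
    have "z ((x \<cdot> B k) \<xi>) = 0" for k
      using that by simp (metis blinfun_apply_blinfun_compose blinfun.zero_left)
    moreover have "(\<lambda>k. z ((x \<cdot> B k) \<xi>)) \<longlonglongrightarrow> z (v \<xi>)"
      by (intro bounded_linear.tendsto[OF blinfun.bounded_linear_right v(2)])
    ultimately show "(z \<cdot> v) \<xi> = blinfun_apply 0 \<xi>"
      by (simp add: LIMSEQ_const_iff)
  qed
  have right: "v \<cdot> z = 0" if "x \<cdot> z = 0" for z :: "'a \<Rightarrow>\<^sub>L 'a"
  proof (rule blinfun_eqI)
    fix \<xi>
    have "x (z \<xi>) = 0" using that by (metis blinfun_apply_blinfun_compose blinfun.zero_left)
    then have bz: "b (z \<xi>) = z \<xi>" using nx[of "z \<xi>"] by simp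
    have "P k (z \<xi>) = z \<xi>" for k unfolding P by (induction k) (auto simp: bz)
    then have "n (z \<xi>) = z \<xi>" using LIMSEQ_unique[OF lim[of "z \<xi>"], of "z \<xi>"] by (simp flip: P)
    then show "(v \<cdot> z) \<xi> = blinfun_apply 0 \<xi>" using nv[of "z \<xi>"] by simp
  qed
  show thesis by (rule that[OF v(1) vvv xvv vvx right left])
qed

text \<open>
  The operator \<open>v\<close> is the partial isometry of the polar decomposition \<open>x = v |x|\<close>. The last two
  properties express that its initial and final spaces are no larger than those of \<open>x\<close>.
\<close>

lemma polar_decomposition:
  assumes xW: "x \<in> W"
  obtains v where "v \<in> W" "v \<cdot> v\<star> \<cdot> v = v" "x \<cdot> (v\<star> \<cdot> v) = x" "(v \<cdot> v\<star>) \<cdot> x = x"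
    "\<And>z::'a \<Rightarrow>\<^sub>L 'a. x \<cdot> z = 0 \<Longrightarrow> v \<cdot> z = 0" "\<And>z::'a \<Rightarrow>\<^sub>L 'a. z \<cdot> x = 0 \<Longrightarrow> z \<cdot> v = 0"
proof -
  define r where "r = 1 / (norm x + 1)"
  have r: "r > 0" by (simp add: r_def add_nonneg_pos)
  have "norm ((r *\<^sub>R x) \<xi>) \<le> norm \<xi>" for \<xi>
  proof -
    have "norm ((r *\<^sub>R x) \<xi>) \<le> r * (norm x * norm \<xi>)"
      using norm_blinfun[of x \<xi>] r by (simp add: blinfun.scaleR_left)
    also have "\<dots> \<le> r * ((norm x + 1) * norm \<xi>)"
      using r by (intro mult_left_mono mult_right_mono) auto
    also have "\<dots> = norm \<xi>" unfolding r_def by (simp add: add_nonneg_pos less_imp_neq[symmetric])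
    finally show ?thesis .
  qed
  from contraction_polar[OF scaleR_mem[OF xW] this] obtain v where
    v: "v \<in> W" "v \<cdot> v\<star> \<cdot> v = v" "(r *\<^sub>R x) \<cdot> (v\<star> \<cdot> v) = r *\<^sub>R x" "(v \<cdot> v\<star>) \<cdot> (r *\<^sub>R x) = r *\<^sub>R x"
    "\<And>z::'a \<Rightarrow>\<^sub>L 'a. (r *\<^sub>R x) \<cdot> z = 0 \<Longrightarrow> v \<cdot> z = 0" "\<And>z::'a \<Rightarrow>\<^sub>L 'a. z \<cdot> (r *\<^sub>R x) = 0 \<Longrightarrow> z \<cdot> v = 0" by metis
  show thesis
  proof (rule that[OF v(1,2)])
    show "x \<cdot> (v\<star> \<cdot> v) = x" "v \<cdot> v\<star> \<cdot> x = x" using v(3,4) r by (simp_all add: comp_distribs)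
    show "v \<cdot> z = 0" if "x \<cdot> z = 0" for z :: "'a \<Rightarrow>\<^sub>L 'a" using that by (intro v(5)) (simp add: comp_distribs)
    show "z \<cdot> v = 0" if "z \<cdot> x = 0" for z :: "'a \<Rightarrow>\<^sub>L 'a" using that by (intro v(6)) (simp add: comp_distribs)
  qed
qed

end

section \<open>Projections and partial isometries\<close>

definition pisoms :: "('a::complex_hilbert_space \<Rightarrow>\<^sub>L 'a) set \<Rightarrow> ('a \<Rightarrow>\<^sub>L 'a) set"
  where "pisoms W = {v \<in> W. v \<cdot> (v\<star> \<cdot> v) = v}"

context strong_algebra
begin

lemma projD:
  assumes "p \<in> projections W"
  shows "p \<in> W" "p\<star> = p" "p \<cdot> p = p" "p \<cdot> (p \<cdot> z) = p \<cdot> z"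
  using assms by (auto simp: projections_def simp flip: comp_assoc)

lemma projI: "p \<in> W \<Longrightarrow> p\<star> = p \<Longrightarrow> p \<cdot> p = p \<Longrightarrow> p \<in> projections W"
  by (simp add: projections_def)

lemma proj_id: "id_blinfun \<in> projections W" by (intro projI) (simp_all add: id_mem)

lemma proj_zero: "0 \<in> projections W" by (intro projI) (simp_all add: zero_mem)

lemma mult_zero_swap: "x \<in> W \<Longrightarrow> y \<in> W \<Longrightarrow> x \<cdot> y = 0 \<Longrightarrow> y\<star> \<cdot> x\<star> = 0"
  by (metis adj_simps(1) cadjoint_zero)

lemma proj_le_swap:
  assumes "p \<in> projections W" "q \<in> projections W" "q \<cdot> p = p"
  shows "p \<cdot> q = p" "p \<cdot> (q \<cdot> z) = p \<cdot> z" "q \<cdot> (p \<cdot> z) = p \<cdot> z"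
proof -
  show "p \<cdot> q = p" using assms adj_simps(1)[of q p] projD by metis
  then show "p \<cdot> (q \<cdot> z) = p \<cdot> z" by (rule comp_reduce)
  show "q \<cdot> (p \<cdot> z) = p \<cdot> z" using assms(3) by (rule comp_reduce)
qed

lemma proj_diff:
  assumes "p \<in> projections W" "q \<in> projections W" "q \<cdot> p = p"
  shows "q - p \<in> projections W"
  by (intro projI)
    (simp_all add: mem_intros adj_simps op_simps assms(3)
      projD[OF assms(1)] projD[OF assms(2)] proj_le_swap[OF assms])

lemma proj_compl: "p \<in> projections W \<Longrightarrow> id_blinfun - p \<in> projections W"
  by (rule proj_diff) (auto simp: proj_id)

lemma proj_norm:
  assumes "p \<in> projections W" shows "norm (p \<xi>) \<le> norm \<xi>" "(norm (p \<xi>))\<^sup>2 = inner (p \<xi>) \<xi>"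
proof -
  note p = projD[OF assms]
  show sq: "(norm (p \<xi>))\<^sup>2 = inner (p \<xi>) \<xi>"
    using norm_sq_apply[OF ops[OF p(1)], of \<xi>] by (simp only: p)
  have "norm (p \<xi>) * norm (p \<xi>) \<le> norm (p \<xi>) * norm \<xi>"
    using norm_cauchy_schwarz[of "p \<xi>" \<xi>] sq by (simp add: power2_eq_square)
  then show "norm (p \<xi>) \<le> norm \<xi>" by (cases "norm (p \<xi>) = 0") auto
qed

lemma pisomD:
  assumes "v \<in> pisoms W"
  shows "v \<in> W" "v \<cdot> (v\<star> \<cdot> v) = v" "v \<cdot> (v\<star> \<cdot> (v \<cdot> z)) = v \<cdot> z"
    "v\<star> \<cdot> (v \<cdot> v\<star>) = v\<star>" "v\<star> \<cdot> (v \<cdot> (v\<star> \<cdot> z)) = v\<star> \<cdot> z"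
proof -
  show v: "v \<in> W" "v \<cdot> (v\<star> \<cdot> v) = v" using assms by (auto simp: pisoms_def)
  have "(v \<cdot> (v\<star> \<cdot> v))\<star> = v\<star>" by (simp only: v)
  then show v': "v\<star> \<cdot> (v \<cdot> v\<star>) = v\<star>" using v(1) by (simp add: adj_simps mem_intros op_simps)
  show "v \<cdot> (v\<star> \<cdot> (v \<cdot> z)) = v \<cdot> z" using v(2) by (metis comp_assoc)
  show "v\<star> \<cdot> (v \<cdot> (v\<star> \<cdot> z)) = v\<star> \<cdot> z" using v' by (metis comp_assoc)
qed

lemma pisom_proj:
  assumes "v \<in> pisoms W" shows "v\<star> \<cdot> v \<in> projections W" "v \<cdot> v\<star> \<in> projections W"
  by (intro projI; simp add: pisomD[OF assms] mem_intros adj_simps op_simps)+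

lemma pisomI:
  assumes v: "v \<in> W" and idem: "(v\<star> \<cdot> v) \<cdot> (v\<star> \<cdot> v) = v\<star> \<cdot> v"
  shows "v \<in> pisoms W"
proof -
  let ?d = "v - v \<cdot> (v\<star> \<cdot> v)"
  have idem': "v\<star> \<cdot> (v \<cdot> (v\<star> \<cdot> (v \<cdot> z))) = v\<star> \<cdot> (v \<cdot> z)" for z
    using idem by (metis comp_assoc)
  have dW: "?d \<in> W" by (intro mem_intros v)
  have "?d\<star> \<cdot> ?d = 0"
    using v idem by (simp add: adj_simps mem_intros op_simps idem')
  then have "?d = 0" by (rule cadjoint_compose_self_eq_zero[OF ops[OF dW]])
  then show ?thesis using v by (simp add: pisoms_def)
qed

lemma pisomI_proj: "v \<in> W \<Longrightarrow> v\<star> \<cdot> v = p \<Longrightarrow> p \<in> projections W \<Longrightarrow> v \<in> pisoms W"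
  using pisomI projD by metis

lemma pisom_norm: assumes v: "v \<in> pisoms W" shows "norm (v \<xi>) = norm ((v\<star> \<cdot> v) \<xi>)"
proof -
  have "(norm (v \<xi>))\<^sup>2 = (norm ((v\<star> \<cdot> v) \<xi>))\<^sup>2"
    using norm_sq_apply[OF ops[OF pisomD(1)[OF v]], of \<xi>] proj_norm(2)[OF pisom_proj(1)[OF v], of \<xi>] by simp
  then show ?thesis by (simp add: power2_eq_iff_nonneg)
qed

lemma pisom_contraction: "v \<in> pisoms W \<Longrightarrow> norm (v \<xi>) \<le> norm \<xi>"
  using pisom_norm proj_norm(1) pisom_proj by metis

lemma pisom_sum:
  assumes v: "v \<in> pisoms W" and w: "w \<in> pisoms W" and orth: "v\<star> \<cdot> w = 0" "v \<cdot> w\<star> = 0"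
  shows "v + w \<in> pisoms W" "(v + w)\<star> \<cdot> (v + w) = v\<star> \<cdot> v + w\<star> \<cdot> w"
    "(v + w) \<cdot> (v + w)\<star> = v \<cdot> v\<star> + w \<cdot> w\<star>" "(v + w) \<cdot> (v\<star> \<cdot> v) = v"
proof -
  note v' = pisomD[OF v] and w' = pisomD[OF w]
  have orth': "w\<star> \<cdot> v = 0" "w \<cdot> v\<star> = 0"
    using mult_zero_swap[OF adj_mem[OF v'(1)] w'(1) orth(1)] mult_zero_swap[OF v'(1) adj_mem[OF w'(1)] orth(2)]
      v' w' by (simp_all add: adj_simps)
  show 1: "(v + w)\<star> \<cdot> (v + w) = v\<star> \<cdot> v + w\<star> \<cdot> w"
    "(v + w) \<cdot> (v + w)\<star> = v \<cdot> v\<star> + w \<cdot> w\<star>"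
    by (simp_all add: adj_simps op_simps mem_intros orth orth' v' w')
  show "(v + w) \<cdot> (v\<star> \<cdot> v) = v"
    by (simp add: op_simps v' comp_reduce[OF orth'(2)])
  show "v + w \<in> pisoms W"
    by (rule pisomI) (use v' w' in \<open>simp_all only: 1 mem_intros\<close>,
      simp add: op_simps comp_reduce[OF orth(1)] comp_reduce[OF orth(2)] comp_reduce[OF orth'(1)] comp_reduce[OF orth'(2)] v' w')
qed

text \<open>
  With \<open>p = v\<^sup>* v\<close> and \<open>q = w\<^sup>* w\<close> one has \<open>p q p = p\<close>, and this forces \<open>q p = p\<close> because
  \<open>\<parallel>(1 - q) p \<xi>\<parallel>\<^sup>2 = \<langle>(p - p q p) \<xi>, \<xi>\<rangle>\<close>.
\<close>

lemma pisom_extension: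
  assumes v: "v \<in> pisoms W" and w: "w \<in> pisoms W" and ext: "w \<cdot> (v\<star> \<cdot> v) = v"
  shows "(w\<star> \<cdot> w) \<cdot> (v\<star> \<cdot> v) = v\<star> \<cdot> v" "(w \<cdot> w\<star>) \<cdot> v = v"
proof -
  note v' = pisomD[OF v] and w' = pisomD[OF w]
  let ?p = "v\<star> \<cdot> v" and ?q = "w\<star> \<cdot> w"
  note p = projD[OF pisom_proj(1)[OF v]] and q = projD[OF pisom_proj(1)[OF w]]
  have vp: "v\<star> = ?p \<cdot> w\<star>"
    using arg_cong[OF ext, of cadjoint] by (simp add: v'(1) w'(1) adj_simps mem_intros op_simps)
  have pqp: "?p \<cdot> (?q \<cdot> ?p) = ?p"
  proof -
    have "?p \<cdot> (?q \<cdot> ?p) = (?p \<cdot> w\<star>) \<cdot> (w \<cdot> ?p)" by (simp only: comp_assoc)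
    also have "\<dots> = ?p" by (simp only: ext vp[symmetric])
    finally show ?thesis .
  qed
  let ?d = "?p - ?q \<cdot> ?p"
  have dW: "?d \<in> W" by (intro mem_intros v' w')
  have dsa: "?d\<star> = ?p - ?p \<cdot> ?q"
    by (simp only: adj_simps(1,3) comp_mem p(1,2) q(1,2))
  have "?d\<star> \<cdot> ?d = 0"
    unfolding dsa by (simp only: comp_distribs p pqp comp_assoc[of ?p ?q] q) (simp add: pqp)
  then have "?d = 0" by (rule cadjoint_compose_self_eq_zero[OF ops[OF dW]])
  then show "?q \<cdot> ?p = ?p" by simp
  have "(w \<cdot> w\<star>) \<cdot> (w \<cdot> ?p) = w \<cdot> ?p" by (simp only: comp_assoc w')
  then show "(w \<cdot> w\<star>) \<cdot> v = v" by (simp only: ext)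
qed

text \<open>
  For \<open>m \<le> n\<close> the number \<open>\<parallel>p\<^sub>n \<xi> - p\<^sub>m \<xi>\<parallel>\<^sup>2\<close> is \<open>\<parallel>p\<^sub>n \<xi>\<parallel>\<^sup>2 - \<parallel>p\<^sub>m \<xi>\<parallel>\<^sup>2\<close>, and the norms increase and are
  bounded.
\<close>

lemma increasing_projections:
  assumes p: "\<And>n. p n \<in> projections W" and inc: "\<And>n. p (Suc n) \<cdot> p n = p n"
  obtains q where "q \<in> projections W" "\<And>n. q \<cdot> p n = p n"
    "\<And>\<xi>. (\<lambda>n. blinfun_apply (p n) \<xi>) \<longlonglongrightarrow> blinfun_apply q \<xi>"
    "\<forall>r. (\<forall>n. r \<cdot> p n = p n) \<longrightarrow> r \<cdot> q = q"
proof -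
  note p' = projD[OF p]
  have le: "p n \<cdot> p m = p m" if "m \<le> n" for m n
    using that
  proof (induction n rule: dec_induct)
    case (step n)
    have "p (Suc n) \<cdot> (p n \<cdot> p m) = p n \<cdot> p m" using inc by (rule comp_reduce)
    then show ?case by (simp add: step.IH)
  qed (simp add: p')
  have diff: "(norm (p n \<xi> - p m \<xi>))\<^sup>2 = (norm (p n \<xi>))\<^sup>2 - (norm (p m \<xi>))\<^sup>2" if "m \<le> n" for m n \<xi>
    using proj_norm(2)[OF proj_diff[OF p p le[OF that]], of \<xi>] proj_norm(2)[OF p]
    by (simp add: blinfun.diff_left inner_diff_left)
  have "Cauchy (\<lambda>n. p n \<xi>)" for \<xi>
  proof -
    have "(norm (p n \<xi>))\<^sup>2 \<le> (norm (p (Suc n) \<xi>))\<^sup>2" for n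
      using diff[of n "Suc n" \<xi>] zero_le_power2[of "norm (p (Suc n) \<xi> - p n \<xi>)"] by linarith
    then have "incseq (\<lambda>n. (norm (p n \<xi>))\<^sup>2)" by (rule incseq_SucI)
    moreover have "(norm (p n \<xi>))\<^sup>2 \<le> (norm \<xi>)\<^sup>2" for n by (intro power_mono proj_norm p) simp
    ultimately obtain L where "(\<lambda>n. (norm (p n \<xi>))\<^sup>2) \<longlonglongrightarrow> L"
      using incseq_convergent[of "\<lambda>n. (norm (p n \<xi>))\<^sup>2"] by blast
    then have Cau: "Cauchy (\<lambda>n. (norm (p n \<xi>))\<^sup>2)" by (rule LIMSEQ_imp_Cauchy)
    show ?thesis
    proof (rule CauchyI)
      fix e :: real assume e: "0 < e"
      then obtain N where N: "\<And>m n. m \<ge> N \<Longrightarrow> n \<ge> N \<Longrightarrow> norm ((norm (p m \<xi>))\<^sup>2 - (norm (p n \<xi>))\<^sup>2) < e\<^sup>2"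
        using CauchyD[OF Cau, of "e\<^sup>2"] by auto
      have *: "norm (p n \<xi> - p m \<xi>) < e" if "N \<le> m" "m \<le> n" for m n
      proof (rule power2_less_imp_less)
        show "(norm (p n \<xi> - p m \<xi>))\<^sup>2 < e\<^sup>2" using N[of n m] diff[OF that(2)] that by simp
      qed (use e in simp)
      have "norm (p m \<xi> - p n \<xi>) < e" if "N \<le> m" "N \<le> n" for m n
        using *[of m n] *[of n m] that by (cases "m \<le> n") (auto simp: norm_minus_commute)
      then show "\<exists>M. \<forall>m\<ge>M. \<forall>n\<ge>M. norm (p m \<xi> - p n \<xi>) < e" by blast
    qed
  qed
  from strong_limit[of p 1, OF p'(1) _ this] obtain q where
    q: "q \<in> W" "\<And>\<xi>. (\<lambda>n. p n \<xi>) \<longlonglongrightarrow> q \<xi>" using proj_norm(1)[OF p] unfolding mult_1 by metis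
  have upper: "q \<cdot> p n = p n" for n
  proof (rule blinfun_eqI)
    fix \<xi>
    have "eventually (\<lambda>k. p k (p n \<xi>) = p n \<xi>) sequentially"
      using le[of n] by (intro eventually_sequentiallyI[of n]) (metis blinfun_apply_blinfun_compose)
    then have "(\<lambda>k. p k (p n \<xi>)) \<longlonglongrightarrow> p n \<xi>" by (rule tendsto_eventually)
    then show "(q \<cdot> p n) \<xi> = p n \<xi>" using LIMSEQ_unique[OF q(2)[of "p n \<xi>"]] by simp
  qed
  have least: "r \<cdot> q = q" if "\<And>n. r \<cdot> p n = p n" for r
  proof (rule blinfun_eqI)
    fix \<xi>
    have "r (p n \<xi>) = p n \<xi>" for n using that by (metis blinfun_apply_blinfun_compose)
    moreover have "(\<lambda>n. r (p n \<xi>)) \<longlonglongrightarrow> r (q \<xi>)"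
      by (rule bounded_linear.tendsto[OF blinfun.bounded_linear_right q(2)])
    ultimately have "(\<lambda>n. p n \<xi>) \<longlonglongrightarrow> r (q \<xi>)" by simp
    from LIMSEQ_unique[OF this q(2)] show "(r \<cdot> q) \<xi> = q \<xi>" by simp
  qed
  have "q\<star> = q" by (rule limit_selfadjoint[OF p'(1,2) q])
  then have "q \<in> projections W" using q(1) least[OF upper] by (intro projI)
  then show thesis by (rule that) (use upper q(2) least in blast)+
qed

text \<open>
  Infinite sums of partial isometries with orthogonal initial and orthogonal final spaces are of this
  kind. The convergence is inherited from that of the initial projections.
\<close>

lemma pisom_limit:
  assumes v: "\<And>n. v n \<in> pisoms W" and ext: "\<And>n. v (Suc n) \<cdot> ((v n)\<star> \<cdot> v n) = v n"
  obtains w where "w \<in> pisoms W" "\<And>n. w \<cdot> ((v n)\<star> \<cdot> v n) = v n"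
    "\<And>\<xi>. (\<lambda>n. blinfun_apply ((v n)\<star> \<cdot> v n) \<xi>) \<longlonglongrightarrow> blinfun_apply (w\<star> \<cdot> w) \<xi>"
    "\<And>\<xi>. (\<lambda>n. blinfun_apply (v n \<cdot> (v n)\<star>) \<xi>) \<longlonglongrightarrow> blinfun_apply (w \<cdot> w\<star>) \<xi>"
    "\<forall>r. (\<forall>n. r \<cdot> v n = v n) \<longrightarrow> r \<cdot> w = w" "\<forall>r. (\<forall>n. v n \<cdot> r = v n) \<longrightarrow> w \<cdot> r = w"
proof -
  let ?p = "\<lambda>n. (v n)\<star> \<cdot> v n"
  note v' = pisomD[OF v] and pP = pisom_proj(1)[OF v]
  define p where "p n = (v n)\<star> \<cdot> v n" for n
  have "p n \<in> projections W" "p (Suc n) \<cdot> p n = p n" for n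
    unfolding p_def by (rule pP, rule pisom_extension(1)[OF v v ext])
  from increasing_projections[of p, OF this] obtain q where
    q: "q \<in> projections W" and q_lim: "\<And>\<xi>. (\<lambda>n. p n \<xi>) \<longlonglongrightarrow> q \<xi>" by metis
  note q_lim = q_lim[unfolded p_def]
  have le: "?p n \<cdot> ?p m = ?p m \<and> v n \<cdot> ?p m = v m" if "m \<le> n" for m n
    using that
  proof (induction n rule: dec_induct)
    case (step n)
    have 1: "?p (Suc n) \<cdot> (?p n \<cdot> ?p m) = ?p n \<cdot> ?p m" 
      using pisom_extension(1)[OF v v ext] by (rule comp_reduce)
    have 2: "v (Suc n) \<cdot> (?p n \<cdot> ?p m) = v n \<cdot> ?p m" using ext by (rule comp_reduce)
    show ?case using 1 2 by (simp only: step.IH)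
  qed (simp add: projD(3)[OF pP] v')
  have diff: "norm (v n \<xi> - v m \<xi>) \<le> norm (?p n \<xi> - ?p m \<xi>)" if "m \<le> n" for m n \<xi>
  proof -
    have "v n \<cdot> (?p n - ?p m) = v n - v m" using le[OF that] by (simp add: comp_distribs v')
    then have "v n \<xi> - v m \<xi> = v n (?p n \<xi> - ?p m \<xi>)"
      by (metis blinfun.diff_left blinfun_apply_blinfun_compose)
    then show ?thesis using pisom_contraction[OF v] by metis
  qed
  have "Cauchy (\<lambda>n. v n \<xi>)" for \<xi>
    by (rule Cauchy_dominated[OF LIMSEQ_imp_Cauchy[OF q_lim[of \<xi>]], where C = 1])
      (simp only: mult_1 diff)
  from strong_limit[of v 1, OF v'(1) _ this] obtain w where
    w: "w \<in> W" "\<And>\<xi>. (\<lambda>n. v n \<xi>) \<longlonglongrightarrow> w \<xi>" using pisom_contraction[OF v] unfolding mult_1 by metis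
  have wv: "w \<cdot> ?p n = v n" for n
  proof (rule blinfun_eqI)
    fix \<xi>
    have "eventually (\<lambda>k. v k (?p n \<xi>) = v n \<xi>) sequentially"
      using le[of n] by (intro eventually_sequentiallyI[of n]) (metis blinfun_apply_blinfun_compose)
    then have "(\<lambda>k. v k (?p n \<xi>)) \<longlonglongrightarrow> v n \<xi>" by (rule tendsto_eventually)
    then show "(w \<cdot> ?p n) \<xi> = v n \<xi>" using LIMSEQ_unique[OF w(2)[of "?p n \<xi>"]] by simp
  qed
  have wq: "w \<cdot> q = w"
  proof (rule blinfun_eqI)
    fix \<xi>
    have "w (?p n \<xi>) = v n \<xi>" for n using wv by (metis blinfun_apply_blinfun_compose)
    moreover have "(\<lambda>n. w (?p n \<xi>)) \<longlonglongrightarrow> w (q \<xi>)"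
      by (rule bounded_linear.tendsto[OF blinfun.bounded_linear_right q_lim])
    ultimately show "(w \<cdot> q) \<xi> = w \<xi>"
      using LIMSEQ_unique[OF w(2)[of \<xi>], of "w (q \<xi>)"] by (simp del: blinfun_apply_blinfun_compose) simp
  qed
  have nw: "norm (w \<xi>) = norm (q \<xi>)" for \<xi>
    using tendsto_norm[OF w(2)[of \<xi>]] tendsto_norm[OF q_lim[of \<xi>]] LIMSEQ_unique
    unfolding pisom_norm[OF v] by blast
  have ww: "w\<star> \<cdot> w = q"
  proof (rule selfadjoint_eqI)
    show "w\<star> \<cdot> w \<in> bounded_ops" "q \<in> bounded_ops" by (intro ops mem_intros w projD[OF q])+
    show "(w\<star> \<cdot> w)\<star> = w\<star> \<cdot> w" using w(1) by (simp add: adj_simps mem_intros)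
    show "inner ((w\<star> \<cdot> w) \<xi>) \<xi> = inner (q \<xi>) \<xi>" for \<xi>
      using norm_sq_apply[OF ops[OF w(1)], of \<xi>] proj_norm(2)[OF q, of \<xi>] nw[of \<xi>] by simp
  qed (rule projD[OF q])
  have range: "(\<lambda>n. (v n \<cdot> (v n)\<star>) \<xi>) \<longlonglongrightarrow> (w \<cdot> w\<star>) \<xi>" for \<xi>
  proof -
    have eq: "v n \<cdot> (v n)\<star> = w \<cdot> (?p n \<cdot> w\<star>)" for n
    proof -
      have "(w \<cdot> ?p n)\<star> = ?p n \<cdot> w\<star>"
        using adj_simps(1)[OF w(1) projD(1)[OF pP]] projD(2)[OF pP] by metis
      then have "v n \<cdot> (v n)\<star> = w \<cdot> ?p n \<cdot> (?p n \<cdot> w\<star>)" by (simp only: wv)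
      then show ?thesis by (simp only: comp_assoc[of w "?p n"] projD(4)[OF pP])
    qed
    have "(\<lambda>n. w (?p n (w\<star> \<xi>))) \<longlonglongrightarrow> w (q (w\<star> \<xi>))"
      by (rule bounded_linear.tendsto[OF blinfun.bounded_linear_right q_lim])
    moreover have "w (q (w\<star> \<xi>)) = (w \<cdot> w\<star>) \<xi>" using wq by (metis blinfun_apply_blinfun_compose)
    ultimately show ?thesis unfolding eq by simp
  qed
  have left: "r \<cdot> w = w" if "\<And>n. r \<cdot> v n = v n" for r
  proof (rule blinfun_eqI)
    fix \<xi>
    have "r (v n \<xi>) = v n \<xi>" for n using that by (metis blinfun_apply_blinfun_compose)
    moreover have "(\<lambda>n. r (v n \<xi>)) \<longlonglongrightarrow> r (w \<xi>)"
      by (rule bounded_linear.tendsto[OF blinfun.bounded_linear_right w(2)])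
    ultimately have "(\<lambda>n. v n \<xi>) \<longlonglongrightarrow> r (w \<xi>)" by simp
    from LIMSEQ_unique[OF this w(2)] show "(r \<cdot> w) \<xi> = w \<xi>" by simp
  qed
  have right: "w \<cdot> r = w" if "\<And>n. v n \<cdot> r = v n" for r
  proof (rule blinfun_eqI)
    fix \<xi>
    have "v n (r \<xi>) = v n \<xi>" for n using that by (metis blinfun_apply_blinfun_compose)
    with w(2)[of "r \<xi>"] have "(\<lambda>n. v n \<xi>) \<longlonglongrightarrow> w (r \<xi>)" by simp
    from LIMSEQ_unique[OF this w(2)] show "(w \<cdot> r) \<xi> = w \<xi>" by simp
  qed
  show thesis
  proof (rule that[of w])
    show "w \<in> pisoms W" using w(1) wq by (simp add: pisoms_def ww)
    show "(\<lambda>n. ?p n \<xi>) \<longlonglongrightarrow> (w\<star> \<cdot> w) \<xi>" for \<xi> unfolding ww by (rule q_lim)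
  qed (use wv range left right in blast)+
qed

end

section \<open>Faithful normal states\<close>

text \<open>
  Normality takes the form of continuity along bounded strongly convergent sequences.
\<close>

locale state_algebra = strong_algebra M
  for M :: "('a::complex_hilbert_space \<Rightarrow>\<^sub>L 'a) set" +
  fixes \<phi> :: "('a \<Rightarrow>\<^sub>L 'a) \<Rightarrow> complex"
  assumes phi_add: "x \<in> M \<Longrightarrow> y \<in> M \<Longrightarrow> \<phi> (x + y) = \<phi> x + \<phi> y"
    and phi_scalar: "x \<in> M \<Longrightarrow> \<phi> (scalar_op c \<cdot> x) = c * \<phi> x"
    and phi_pos: "x \<in> M \<Longrightarrow> \<phi> (x\<star> \<cdot> x) \<in> \<real>\<^sub>\<ge>\<^sub>0"
    and phi_id: "\<phi> id_blinfun = 1"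
    and phi_faithful: "x \<in> M \<Longrightarrow> \<phi> (x\<star> \<cdot> x) = 0 \<Longrightarrow> x = 0"
    and phi_normal: "(\<And>n. X n \<in> M) \<Longrightarrow> Y \<in> M \<Longrightarrow> (\<And>n \<xi>. norm (blinfun_apply (X n) \<xi>) \<le> C * norm \<xi>) \<Longrightarrow>
      (\<And>\<xi>. (\<lambda>n. blinfun_apply (X n) \<xi>) \<longlonglongrightarrow> blinfun_apply Y \<xi>) \<Longrightarrow> (\<lambda>n. \<phi> (X n)) \<longlonglongrightarrow> \<phi> Y"

lemma state_algebra_subalgebra:
  assumes "state_algebra M \<phi>" "strong_algebra V" "V \<subseteq> M"
  shows "state_algebra V \<phi>"
proof -
  interpret state_algebra M \<phi> by fact
  interpret V: strong_algebra V by fact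
  have sub: "x \<in> V \<Longrightarrow> x \<in> M" for x using assms(3) by blast
  show ?thesis
  proof
    fix X Y C
    assume "\<And>n. X n \<in> V" "Y \<in> V" "\<And>n \<xi>. norm (blinfun_apply (X n) \<xi>) \<le> C * norm \<xi>"
      "\<And>\<xi>. (\<lambda>n. blinfun_apply (X n) \<xi>) \<longlonglongrightarrow> blinfun_apply Y \<xi>"
    then show "(\<lambda>n. \<phi> (X n)) \<longlonglongrightarrow> \<phi> Y" by (intro phi_normal[of X Y C] sub)
  qed (simp_all add: phi_add phi_scalar phi_pos phi_id phi_faithful sub)
qed

context state_algebra
begin

lemma phi_scaleR: "x \<in> M \<Longrightarrow> \<phi> (r *\<^sub>R x) = of_real r * \<phi> x"
  by (metis phi_scalar scalar_op_of_real)

lemma phi_zero: "\<phi> 0 = 0" using phi_scaleR[of id_blinfun 0] by (simp add: id_mem)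

lemma phi_diff: "x \<in> M \<Longrightarrow> y \<in> M \<Longrightarrow> \<phi> (x - y) = \<phi> x - \<phi> y"
  using phi_add[of "x - y" y] by (simp add: diff_mem)

lemma phi_scalar_op: "\<phi> (scalar_op c) = c"
  using phi_scalar[OF id_mem, of c] by (simp add: phi_id)

lemma phi_adj:
  assumes x: "x \<in> M" shows "\<phi> (x\<star>) = cnj (\<phi> x)"
proof -
  have *: "Im (\<phi> y + \<phi> (y\<star>)) = 0" if y: "y \<in> M" for y
  proof -
    have "(id_blinfun + y)\<star> \<cdot> (id_blinfun + y) = id_blinfun + (y + (y\<star> + y\<star> \<cdot> y))"
      using y by (simp add: adj_simps mem_intros op_simps)
    then have "\<phi> ((id_blinfun + y)\<star> \<cdot> (id_blinfun + y)) = 1 + (\<phi> y + (\<phi> (y\<star>) + \<phi> (y\<star> \<cdot> y)))"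
      using y by (simp add: phi_add mem_intros phi_id)
    moreover have "\<phi> ((id_blinfun + y)\<star> \<cdot> (id_blinfun + y)) \<in> \<real>\<^sub>\<ge>\<^sub>0"
      by (intro phi_pos mem_intros y)
    moreover have "\<phi> (y\<star> \<cdot> y) \<in> \<real>\<^sub>\<ge>\<^sub>0" by (intro phi_pos y)
    ultimately show ?thesis by (simp add: complex_nonneg_Reals_iff)
  qed
  have "(scalar_op \<i> \<cdot> x)\<star> = scalar_op (- \<i>) \<cdot> x\<star>"
    using x by (simp add: adj_simps mem_intros cadjoint_scalar_op scalar_op_commute ops)
  then have "Im (\<i> * \<phi> x - \<i> * \<phi> (x\<star>)) = 0"
    using *[of "scalar_op \<i> \<cdot> x"] x by (simp add: phi_scalar mem_intros)
  then show ?thesis using *[OF x] by (intro complex_eqI) auto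
qed

lemma phi_proj:
  assumes p: "p \<in> projections M"
  shows "\<phi> p = of_real (Re (\<phi> p))" "0 \<le> Re (\<phi> p)" "Re (\<phi> p) = 0 \<Longrightarrow> p = 0"
proof -
  note p' = projD[OF p]
  have "\<phi> p \<in> \<real>\<^sub>\<ge>\<^sub>0" using phi_pos[OF p'(1)] p' by simp
  then show 1: "\<phi> p = of_real (Re (\<phi> p))" "0 \<le> Re (\<phi> p)"
    by (auto simp: complex_nonneg_Reals_iff complex_eq_iff)
  show "p = 0" if "Re (\<phi> p) = 0"
    using phi_faithful[OF p'(1)] p' 1(1) that by simp
qed

lemma phi_proj_pos: "p \<in> projections M \<Longrightarrow> p \<noteq> 0 \<Longrightarrow> 0 < Re (\<phi> p)"
  using phi_proj(2,3)[of p] by (metis less_le)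

lemma phi_mono:
  assumes "p \<in> projections M" "q \<in> projections M" "q \<cdot> p = p"
  shows "Re (\<phi> p) \<le> Re (\<phi> q)"
  using phi_proj(2)[OF proj_diff[OF assms]] by (simp add: phi_diff projD[OF assms(1)] projD[OF assms(2)])

lemma phi_proj_le_one: "p \<in> projections M \<Longrightarrow> Re (\<phi> p) \<le> 1"
  using phi_mono[of p id_blinfun] by (simp add: proj_id phi_id)

lemma projection_limit_phi:
  assumes "\<And>n. p n \<in> projections M" "q \<in> projections M"
    "\<And>\<xi>. (\<lambda>n. blinfun_apply (p n) \<xi>) \<longlonglongrightarrow> blinfun_apply q \<xi>"
  shows "(\<lambda>n. Re (\<phi> (p n))) \<longlonglongrightarrow> Re (\<phi> q)"
proof -
  have "(\<lambda>n. \<phi> (p n)) \<longlonglongrightarrow> \<phi> q"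
    by (rule phi_normal[of p q 1]) (use assms in \<open>simp_all add: projD proj_norm\<close>)
  then show ?thesis by (rule tendsto_Re)
qed

text \<open>
  A self-adjoint \<open>y \<noteq> 0\<close> with \<open>\<phi> y = 0\<close> has nonzero positive and negative parts by faithfulness; the
  support of the negative part is then a nontrivial projection.
\<close>

lemma nontrivial_projection_selfadjoint:
  assumes yM: "y \<in> M" and ysa: "y\<star> = y" and y0: "y \<noteq> 0" and phi_y: "\<phi> y = 0"
  obtains z where "z \<in> projections M" "z \<noteq> 0" "z \<noteq> id_blinfun"
proof -
  define r where "r = 1 / norm y"
  have r: "r > 0" using y0 by (simp add: r_def)
  define x where "x = r *\<^sub>R y"
  have xM: "x \<in> M" and xsa: "x\<star> = x" and x0: "x \<noteq> 0" and phi_x: "\<phi> x = 0"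
    using yM ysa y0 phi_y r by (simp_all add: x_def mem_intros adj_simps phi_scaleR)
  have "norm (x \<xi>) \<le> norm \<xi>" for \<xi>
    using norm_blinfun[of y \<xi>] y0 by (simp add: x_def r_def blinfun.scaleR_left field_simps)
  from abs_exists[OF xM this] obtain b where b: "b \<in> M" "b\<star> = b" "\<And>\<xi>. norm (b \<xi>) \<le> norm \<xi>"
    "\<And>\<xi>. 0 \<le> inner (b \<xi>) \<xi>" "(id_blinfun - b) \<cdot> (id_blinfun - b) = x\<star> \<cdot> x"
    "\<And>z. z \<cdot> (x\<star> \<cdot> x) = (x\<star> \<cdot> x) \<cdot> z \<Longrightarrow> z \<cdot> b = b \<cdot> z" by metis
  define s where "s = id_blinfun - b"
  have sM: "s \<in> M" by (simp add: s_def mem_intros b)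
  have ss: "s \<cdot> s = x \<cdot> x" using b(5) by (simp add: s_def xsa)
  have "x \<cdot> b = b \<cdot> x" by (rule b(6)) (simp add: xsa comp_assoc)
  then have comm: "x \<cdot> s = s \<cdot> x" by (simp add: s_def comp_distribs)
  have s0: "\<phi> s \<noteq> 0"
  proof
    assume phi_s: "\<phi> s = 0"
    have "norm b \<le> 1" using norm_blinfun_bound[of 1 b] b(3) by simp
    from sqrt_exists[OF b(1,2) this b(4)] obtain c where c: "c \<in> M" "c\<star> = c"
      "(id_blinfun - c) \<cdot> (id_blinfun - c) = id_blinfun - b" by metis
    define t where "t = id_blinfun - c"
    have t: "t \<in> M" "t\<star> \<cdot> t = s" using c by (simp_all add: t_def s_def mem_intros adj_simps)
    then have "t = 0" using phi_faithful phi_s by simp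
    then have "x\<star> \<cdot> x = 0" using t ss xsa by simp
    then show False using cadjoint_compose_self_eq_zero[OF ops[OF xM]] x0 by simp
  qed
  have plus: "s + x \<noteq> 0" and minus: "s - x \<noteq> 0"
    using s0 phi_x phi_add[OF sM xM] phi_diff[OF sM xM] phi_zero by auto
  have prod: "(s - x) \<cdot> (s + x) = 0" by (simp add: comp_distribs ss comm)
  obtain v where v: "v \<in> M" "v \<cdot> v\<star> \<cdot> v = v" "(s - x) \<cdot> (v\<star> \<cdot> v) = s - x"
    "\<And>z :: 'a \<Rightarrow>\<^sub>L 'a. (s - x) \<cdot> z = 0 \<Longrightarrow> v \<cdot> z = 0"
    using polar_decomposition[OF diff_mem[OF sM xM]] by metis
  have "v \<in> pisoms M" using v by (simp add: pisoms_def comp_assoc)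
  then have "v\<star> \<cdot> v \<in> projections M" by (rule pisom_proj)
  moreover have "v\<star> \<cdot> v \<noteq> 0" using v(3) minus by force
  moreover have "v\<star> \<cdot> v \<noteq> id_blinfun"
  proof
    assume "v\<star> \<cdot> v = id_blinfun"
    then have "s + x = v\<star> \<cdot> v \<cdot> (s + x)" by simp
    also have "\<dots> = 0" by (simp only: comp_assoc v(4)[OF prod] comp_zero)
    finally show False using plus by simp
  qed
  ultimately show thesis by (rule that)
qed

lemma nontrivial_projection:
  assumes x: "x \<in> M" "x \<notin> range scalar_op"
  obtains z where "z \<in> projections M" "z \<noteq> 0" "z \<noteq> id_blinfun"
proof (rule ccontr)
  assume none: "\<not> thesis"
  note found = that
  have selfadj: "y = scalar_op (\<phi> y)" if y: "y \<in> M" "y\<star> = y" for y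
  proof -
    have "cnj (\<phi> y) = \<phi> y" using phi_adj[OF y(1)] y(2) by simp
    then have "(y - scalar_op (\<phi> y))\<star> = y - scalar_op (\<phi> y)"
      using y by (simp add: adj_simps mem_intros cadjoint_scalar_op)
    moreover have "\<phi> (y - scalar_op (\<phi> y)) = 0" using y by (simp add: phi_diff mem_intros phi_scalar_op)
    moreover have "y - scalar_op (\<phi> y) \<in> M" by (intro mem_intros y)
    ultimately have "y - scalar_op (\<phi> y) = 0"
      using nontrivial_projection_selfadjoint[of "y - scalar_op (\<phi> y)"] found none by metis
    then show ?thesis by simp
  qed
  let ?u = "x + x\<star>" and ?v = "scalar_op \<i> \<cdot> (x - x\<star>)"
  have u: "?u = scalar_op (\<phi> ?u)"
    by (rule selfadj) (use x in \<open>simp_all add: mem_intros adj_simps add.commute\<close>)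
  have "?v\<star> = (x\<star> - x) \<cdot> scalar_op (- \<i>)"
    using x by (simp add: mem_intros adj_simps cadjoint_scalar_op)
  also have "\<dots> = scalar_op (- \<i>) \<cdot> (x\<star> - x)"
    using x by (intro scalar_op_commute ops mem_intros)
  also have "\<dots> = scalar_op \<i> \<cdot> (scalar_op (- 1) \<cdot> (x\<star> - x))"
    by (simp flip: comp_assoc add: scalar_op_compose)
  also have "\<dots> = ?v"
    using scalar_op_of_real[of "-1" "x\<star> - x"] by simp
  finally have v: "?v = scalar_op (\<phi> ?v)"
    by (intro selfadj) (use x in \<open>simp_all add: mem_intros\<close>)
  have "scalar_op (-\<i>) \<cdot> ?v = x - x\<star>"
    by (simp flip: comp_assoc add: scalar_op_compose)
  then have "x - x\<star> = scalar_op (- \<i> * \<phi> ?v)" using v scalar_op_compose by metis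
  then have "scalar_op (\<phi> ?u + (- \<i> * \<phi> ?v)) = (x + x\<star>) + (x - x\<star>)"
    by (simp only: scalar_op_add u[symmetric])
  then have "x + x = scalar_op (\<phi> ?u + (- \<i> * \<phi> ?v))" by simp
  then have "(1/2) *\<^sub>R (x + x) = scalar_op (complex_of_real (1/2)) \<cdot> scalar_op (\<phi> ?u + (- \<i> * \<phi> ?v))"
    by (simp only: scalar_op_of_real)
  then have "x = scalar_op (complex_of_real (1/2) * (\<phi> ?u + (- \<i> * \<phi> ?v)))"
    by (simp add: scalar_op_compose flip: scaleR_2)
  then show False using x(2) by blast
qed

text \<open>
  A greedy choice takes the place of Zorn's lemma: the initial projection of \<open>y\<^sub>n\<^sub>+\<^sub>1\<close> comes within
  \<open>2\<^sup>-\<^sup>n\<close> of the supremum of \<open>\<phi>\<close> over the initial projections of all admissible extensions of \<open>y\<^sub>n\<close>. The bounds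
  \<open>F\<^sub>n\<close> on the final spaces may grow with \<open>n\<close>.
\<close>

lemma exhausting_sequence:
  assumes F: "\<And>n. F n \<in> projections M" "\<And>n. F (Suc n) \<cdot> F n = F n"
  obtains y where "\<And>n. y n \<in> pisoms M" "\<And>n. y n \<cdot> e = y n" "\<And>n. F n \<cdot> y n = y n"
    "\<And>n. y (Suc n) \<cdot> ((y n)\<star> \<cdot> y n) = y n"
    "\<And>n w. w \<in> pisoms M \<Longrightarrow> w \<cdot> ((y n)\<star> \<cdot> y n) = y n \<Longrightarrow> w \<cdot> e = w \<Longrightarrow> F (Suc n) \<cdot> w = w \<Longrightarrow>
      Re (\<phi> (w\<star> \<cdot> w)) \<le> Re (\<phi> ((y (Suc n))\<star> \<cdot> y (Suc n))) + (1/2)^n"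
proof -
  define P where "P n y \<longleftrightarrow> y \<in> pisoms M \<and> y \<cdot> e = y \<and> F n \<cdot> y = y" for n y
  define E where "E n y w \<longleftrightarrow> P (Suc n) w \<and> w \<cdot> (y\<star> \<cdot> y) = y" for n y w
  define Q where "Q n y y' \<longleftrightarrow> y' \<cdot> (y\<star> \<cdot> y) = y \<and>
    (\<forall>w. E n y w \<longrightarrow> Re (\<phi> (w\<star> \<cdot> w)) \<le> Re (\<phi> (y'\<star> \<cdot> y')) + (1/2)^n)" for n y y'
  have "\<exists>y. \<forall>n. P n (y n) \<and> Q n (y n) (y (Suc n))"
  proof (rule dependent_nat_choice)
    show "\<exists>y. P 0 y" by (rule exI[of _ 0]) (simp add: P_def pisoms_def zero_mem)
    fix y n assume y: "P n y"
    have "F (Suc n) \<cdot> (F n \<cdot> y) = F n \<cdot> y" using F(2) by (rule comp_reduce)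
    then have Ey: "E n y y" using y by (simp add: E_def P_def pisomD)
    let ?S = "(\<lambda>w. Re (\<phi> (w\<star> \<cdot> w))) ` {w. E n y w}"
    have bdd: "bdd_above ?S"
      by (rule bdd_aboveI[of _ 1]) (auto simp: E_def P_def intro!: phi_proj_le_one pisom_proj)
    have "?S \<noteq> {}" using Ey by blast
    then obtain s where "s \<in> ?S" "Sup ?S - (1/2)^n < s"
      using less_cSup_iff[OF _ bdd, of "Sup ?S - (1/2)^n"] by auto
    then obtain y' where y': "E n y y'" "Sup ?S - (1/2)^n < Re (\<phi> (y'\<star> \<cdot> y'))" by auto
    have "Re (\<phi> (w\<star> \<cdot> w)) \<le> Re (\<phi> (y'\<star> \<cdot> y')) + (1/2)^n" if "E n y w" for w
      using cSup_upper[OF _ bdd, of "Re (\<phi> (w\<star> \<cdot> w))"] that y'(2) by auto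
    then show "\<exists>y'. P (Suc n) y' \<and> Q n y y'" using y'(1) by (auto simp: Q_def E_def)
  qed
  then obtain y where "\<And>n. P n (y n)" "\<And>n. Q n (y n) (y (Suc n))" by blast
  then show thesis by (intro that[of y]) (auto simp: P_def Q_def E_def)
qed

end

section \<open>Comparison of projections in a factor\<close>

locale prime_state_algebra = state_algebra +
  assumes prime: "e \<in> projections M \<Longrightarrow> f \<in> projections M \<Longrightarrow> e \<noteq> 0 \<Longrightarrow> f \<noteq> 0 \<Longrightarrow> \<exists>x\<in>M. f \<cdot> (x \<cdot> e) \<noteq> 0"
begin

text \<open>
  The polar decomposition of some \<open>f x e \<noteq> 0\<close>.
\<close>

lemma nonzero_pisom:
  assumes e: "e \<in> projections M" "e \<noteq> 0" and f: "f \<in> projections M" "f \<noteq> 0"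
  obtains v where "v \<in> pisoms M" "v \<noteq> 0" "v \<cdot> e = v" "f \<cdot> v = v"
proof -
  obtain x where x: "x \<in> M" "f \<cdot> (x \<cdot> e) \<noteq> 0" using prime e f by blast
  let ?x = "f \<cdot> (x \<cdot> e)"
  have "?x \<in> M" by (intro mem_intros x projD[OF e(1)] projD[OF f(1)])
  then obtain v where v: "v \<in> M" "v \<cdot> v\<star> \<cdot> v = v" "?x \<cdot> (v\<star> \<cdot> v) = ?x"
    "\<And>z :: 'a \<Rightarrow>\<^sub>L 'a. ?x \<cdot> z = 0 \<Longrightarrow> v \<cdot> z = 0" "\<And>z :: 'a \<Rightarrow>\<^sub>L 'a. z \<cdot> ?x = 0 \<Longrightarrow> z \<cdot> v = 0"
    using polar_decomposition by metis
  show thesis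
  proof (rule that)
    show "v \<in> pisoms M" using v by (simp add: pisoms_def comp_assoc)
    show "v \<noteq> 0" using v(3) x(2) by force
    have "v \<cdot> (id_blinfun - e) = 0" by (rule v(4)) (simp add: op_simps projD[OF e(1)])
    then show "v \<cdot> e = v" by (simp add: comp_distribs)
    have "(id_blinfun - f) \<cdot> v = 0" by (rule v(5)) (simp add: op_simps projD[OF f(1)])
    then show "f \<cdot> v = v" by (simp add: comp_distribs)
  qed
qed

text \<open>
  If the limit \<open>v\<close> of an exhausting sequence left a rest on both sides, a nonzero partial isometry \<open>z\<close>
  between the rests would make \<open>v + z\<close> an extension of every term whose gain in \<open>\<phi>\<close> does not tend
  to \<open>0\<close>.
\<close>

lemma comparison:
  assumes e: "e \<in> projections M" and f: "f \<in> projections M"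
  obtains v where "v \<in> pisoms M" "v \<cdot> e = v" "f \<cdot> v = v" "v\<star> \<cdot> v = e \<or> v \<cdot> v\<star> = f"
proof -
  obtain y where y: "\<And>n. y n \<in> pisoms M" "\<And>n. y n \<cdot> e = y n" "\<And>n. f \<cdot> y n = y n"
    "\<And>n. y (Suc n) \<cdot> ((y n)\<star> \<cdot> y n) = y n" and
    max: "\<And>n w. w \<in> pisoms M \<Longrightarrow> w \<cdot> ((y n)\<star> \<cdot> y n) = y n \<Longrightarrow> w \<cdot> e = w \<Longrightarrow> f \<cdot> w = w \<Longrightarrow>
      Re (\<phi> (w\<star> \<cdot> w)) \<le> Re (\<phi> ((y (Suc n))\<star> \<cdot> y (Suc n))) + (1/2)^n"
    using exhausting_sequence[of "\<lambda>_. f" e, OF f projD(3)[OF f]] by metis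
  obtain v where v: "v \<in> pisoms M" "\<And>n. v \<cdot> ((y n)\<star> \<cdot> y n) = y n" "v \<cdot> e = v" "f \<cdot> v = v"
    using pisom_limit[of y, OF y(1,4)] y(2,3) by metis
  note v' = pisomD[OF v(1)]
  have ve: "(v\<star> \<cdot> v) \<cdot> e = v\<star> \<cdot> v" "e \<cdot> v\<star> = v\<star>"
    using v(3) adj_simps(1)[OF v'(1) projD(1)[OF e]] projD(2)[OF e] by (simp_all add: comp_assoc)
  have vf: "f \<cdot> (v \<cdot> v\<star>) = v \<cdot> v\<star>" using v(4) by (rule comp_reduce)
  have e_v: "e \<cdot> (v\<star> \<cdot> v) = v\<star> \<cdot> v" using ve(2) by (rule comp_reduce)
  have "v\<star> \<cdot> v = e \<or> v \<cdot> v\<star> = f"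
  proof (rule ccontr)
    assume "\<not> ?thesis"
    then have ne: "e - v\<star> \<cdot> v \<noteq> 0" "f - v \<cdot> v\<star> \<noteq> 0" by auto
    have p1: "e - v\<star> \<cdot> v \<in> projections M" by (rule proj_diff[OF pisom_proj(1)[OF v(1)] e e_v])
    have p2: "f - v \<cdot> v\<star> \<in> projections M" by (rule proj_diff[OF pisom_proj(2)[OF v(1)] f vf])
    obtain z where z: "z \<in> pisoms M" "z \<noteq> 0" "z \<cdot> (e - v\<star> \<cdot> v) = z" "(f - v \<cdot> v\<star>) \<cdot> z = z"
      using nonzero_pisom[OF p1 ne(1) p2 ne(2)] by metis
    have zv: "v\<star> \<cdot> z = 0"
    proof -
      have "v\<star> \<cdot> f = v\<star>" using v(4) adj_simps(1)[OF projD(1)[OF f] v'(1)] projD(2)[OF f] by simp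
      then have "v\<star> \<cdot> (f - v \<cdot> v\<star>) = 0" by (simp add: comp_distribs v')
      then have "v\<star> \<cdot> ((f - v \<cdot> v\<star>) \<cdot> z) = 0 \<cdot> z" by (rule comp_reduce)
      then show ?thesis by (simp only: z(4) comp_zero)
    qed
    have vz: "v \<cdot> z\<star> = 0"
    proof -
      have "v \<cdot> (e - v\<star> \<cdot> v) = 0" by (simp add: comp_distribs v' v(3))
      then have "v \<cdot> ((e - v\<star> \<cdot> v) \<cdot> z\<star>) = 0 \<cdot> z\<star>" by (rule comp_reduce)
      moreover have "(e - v\<star> \<cdot> v) \<cdot> z\<star> = z\<star>"
        using arg_cong[OF z(3), of cadjoint] adj_simps(1)[OF pisomD(1)[OF z(1)] projD(1)[OF p1]]
        by (simp only: projD(2)[OF p1])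
      ultimately show ?thesis by simp
    qed
    have z_e: "z \<cdot> e = z"
      by (metis z(3) comp_assoc proj_le_swap(1)[OF pisom_proj(1)[OF v(1)] e e_v] comp_distribs(3) projD(3)[OF e])
    have f_z: "f \<cdot> z = z"
      by (metis z(4) comp_assoc vf comp_distribs(4) projD(3)[OF f])
    note w = pisom_sum[OF v(1) z(1) zv vz]
    have ext: "(v + z) \<cdot> ((y n)\<star> \<cdot> y n) = y n" for n
    proof -
      have "(v\<star> \<cdot> v) \<cdot> ((y n)\<star> \<cdot> y n) = (y n)\<star> \<cdot> y n" by (rule pisom_extension[OF y(1) v(1) v(2)])
      then have "(v + z) \<cdot> ((y n)\<star> \<cdot> y n) = (v + z) \<cdot> ((v\<star> \<cdot> v) \<cdot> ((y n)\<star> \<cdot> y n))" by simp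
      also have "\<dots> = v \<cdot> ((y n)\<star> \<cdot> y n)" using w(4) by (rule comp_reduce)
      finally show ?thesis by (simp only: v(2))
    qed
    have "Re (\<phi> (z\<star> \<cdot> z)) \<le> (1/2)^n" for n
    proof -
      have "Re (\<phi> ((v + z)\<star> \<cdot> (v + z))) \<le> Re (\<phi> ((y (Suc n))\<star> \<cdot> y (Suc n))) + (1/2)^n"
        by (rule max[OF w(1) ext]) (simp_all add: comp_distribs v z_e f_z)
      moreover have "Re (\<phi> ((y (Suc n))\<star> \<cdot> y (Suc n))) \<le> Re (\<phi> (v\<star> \<cdot> v))"
        by (intro phi_mono pisom_proj y v pisom_extension[OF y(1) v(1) v(2)])
      ultimately show ?thesis
        unfolding w(2) using v'(1) pisomD(1)[OF z(1)] by (simp add: phi_add mem_intros)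
    qed
    moreover have "0 < Re (\<phi> (z\<star> \<cdot> z))"
      using pisomD(2)[OF z(1)] z(2) by (intro phi_proj_pos pisom_proj z) force
    ultimately show False
      using real_arch_pow_inv[of "Re (\<phi> (z\<star> \<cdot> z))" "1/2"] by (force simp: not_less[symmetric])
  qed
  with v show thesis by (intro that)
qed

text \<open>
  If \<open>e\<close> is infinite, it contains infinitely many orthogonal copies of a nonzero projection
  \<open>p = e - v v\<^sup>*\<close>. An exhaustion that may spend one more copy of \<open>p\<close> at each step cannot leave over
  anything of \<open>1\<close>: a nonzero rest contains a part equivalent to a subprojection of \<open>p\<close>, and this part
  would have to be picked up again and again.
\<close>

lemma one_le_infinite:
  assumes e: "e \<in> projections M" and v: "v \<in> M" "v\<star> \<cdot> v = e" "e \<cdot> v = v" "v \<cdot> v\<star> \<noteq> e"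
  obtains w where "w \<in> M" "w\<star> \<cdot> w = id_blinfun" "e \<cdot> w = w"
proof -
  note e' = projD[OF e]
  have vP: "v \<in> pisoms M" using v(1,2) e by (rule pisomI_proj)
  note v' = pisomD[OF vP]
  have ve: "v \<cdot> e = v" using v' by (simp flip: v(2))
  have v_e: "e \<cdot> v\<star> = v\<star>" "v\<star> \<cdot> e = v\<star>"
    using arg_cong[OF ve, of cadjoint] arg_cong[OF v(3), of cadjoint] v(1) e' by (simp_all add: adj_simps)
  \<comment> \<open>\<open>V n = v\<^sup>n\<close> with \<open>v\<^sup>0 = e\<close>; the copies of \<open>p = e - v v\<^sup>*\<close> are \<open>V n p (V n)\<^sup>*\<close>, and \<open>F n\<close> is the sum of the
    first \<open>n + 1\<close> of them.\<close>
  define V where "V n = ((\<lambda>x. x \<cdot> v) ^^ n) e" for n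
  have V0: "V 0 = e" and VS: "V (Suc n) = V n \<cdot> v" for n by (simp_all add: V_def)
  have VM: "V n \<in> M" for n by (induction n) (simp_all add: V0 VS e' v mem_intros)
  have eV: "e \<cdot> V n = V n" for n
    by (induction n) (simp_all add: V0 VS e' flip: comp_assoc)
  have VV: "(V n)\<star> \<cdot> V n = e" for n
  proof (induction n)
    case (Suc n)
    have "(V (Suc n))\<star> \<cdot> V (Suc n) = v\<star> \<cdot> (((V n)\<star> \<cdot> V n) \<cdot> v)"
      by (simp add: VS adj_simps VM v comp_assoc)
    then show ?case by (simp add: Suc v)
  qed (simp add: V0 e')
  have VP: "V n \<in> pisoms M" for n using VM VV e by (rule pisomI_proj)
  define F where "F n = e - V (Suc n) \<cdot> (V (Suc n))\<star>" for n
  have FP: "F n \<in> projections M" for n unfolding F_def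
    by (intro proj_diff pisom_proj VP e) (simp add: eV flip: comp_assoc)
  have VV_le: "V n \<cdot> ((V n)\<star> \<cdot> V (Suc n)) = V (Suc n)" for n
    by (simp add: comp_reduce[OF VV] VS v(3))
  have FF: "F (Suc n) \<cdot> F n = F n" for n
  proof -
    have "V (Suc n) \<cdot> (V (Suc n))\<star> \<cdot> (V (Suc (Suc n)) \<cdot> (V (Suc (Suc n)))\<star>) =
      V (Suc (Suc n)) \<cdot> (V (Suc (Suc n)))\<star>"
      using VV_le[of "Suc n"] by (metis comp_assoc)
    from proj_le_swap(1)[OF pisom_proj(2)[OF VP] pisom_proj(2)[OF VP] this]
    show ?thesis
      using proj_le_swap(1)[OF pisom_proj(2)[OF VP] e comp_reduce[OF eV]] comp_reduce[OF eV]
      by (simp add: F_def comp_distribs e')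
  qed
  obtain y where y: "\<And>n. y n \<in> pisoms M" "\<And>n. F n \<cdot> y n = y n"
    "\<And>n. y (Suc n) \<cdot> ((y n)\<star> \<cdot> y n) = y n" and
    max: "\<And>n w. w \<in> pisoms M \<Longrightarrow> w \<cdot> ((y n)\<star> \<cdot> y n) = y n \<Longrightarrow> w \<cdot> id_blinfun = w \<Longrightarrow> F (Suc n) \<cdot> w = w \<Longrightarrow>
      Re (\<phi> (w\<star> \<cdot> w)) \<le> Re (\<phi> ((y (Suc n))\<star> \<cdot> y (Suc n))) + (1/2)^n"
    using exhausting_sequence[of F id_blinfun, OF FP FF] by metis
  have eF: "e \<cdot> F n = F n" for n by (simp add: F_def comp_distribs e' comp_reduce[OF eV])
  have ey: "e \<cdot> y n = y n" for n using comp_reduce[OF eF, of n "y n"] by (simp add: y(2))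
  obtain w where w: "w \<in> pisoms M" "\<And>n. w \<cdot> ((y n)\<star> \<cdot> y n) = y n" "e \<cdot> w = w"
    using pisom_limit[of y, OF y(1,3)] ey by metis
  have "w\<star> \<cdot> w = id_blinfun"
  proof (rule ccontr)
    assume "w\<star> \<cdot> w \<noteq> id_blinfun"
    then have r: "id_blinfun - w\<star> \<cdot> w \<in> projections M" "id_blinfun - w\<star> \<cdot> w \<noteq> 0"
      using proj_compl[OF pisom_proj(1)[OF w(1)]] by auto
    have p: "e - v \<cdot> v\<star> \<in> projections M" "e - v \<cdot> v\<star> \<noteq> 0"
      using proj_diff[OF pisom_proj(2)[OF vP] e comp_reduce[OF v(3)]] v(4) by auto
    \<comment> \<open>At every step \<open>n\<close> the term \<open>y n\<close> could be extended by \<open>V (n + 1) t\<close>.\<close>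
    obtain t where t: "t \<in> pisoms M" "t \<noteq> 0" "t \<cdot> (id_blinfun - w\<star> \<cdot> w) = t" "(e - v \<cdot> v\<star>) \<cdot> t = t"
      using nonzero_pisom[OF r p] by metis
    have et: "e \<cdot> t = t" 
      by (metis t(4) comp_assoc comp_reduce[OF v(3)] comp_distribs(4) projD(3)[OF e])
    have vt: "v\<star> \<cdot> t = 0"
    proof -
      have "v\<star> \<cdot> (e - v \<cdot> v\<star>) = 0" by (simp add: comp_distribs v' v_e)
      then have "v\<star> \<cdot> ((e - v \<cdot> v\<star>) \<cdot> t) = 0 \<cdot> t" by (rule comp_reduce)
      then show ?thesis by (simp only: t(4) comp_zero)
    qed
    have step: "Re (\<phi> ((y n)\<star> \<cdot> y n)) + Re (\<phi> (t\<star> \<cdot> t)) \<le> Re (\<phi> ((y (Suc n))\<star> \<cdot> y (Suc n))) + (1/2)^n" for n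
    proof -
      let ?z = "V (Suc n) \<cdot> t"
      have zz: "?z\<star> \<cdot> ?z = t\<star> \<cdot> t"
        by (simp add: adj_simps VM pisomD[OF t(1)] comp_assoc comp_reduce[OF VV] et)
      have zM: "?z \<in> M" by (intro mem_intros VM pisomD[OF t(1)])
      have zP: "?z \<in> pisoms M" by (rule pisomI_proj[OF zM zz pisom_proj(1)[OF t(1)]])
      have Fz: "F n \<cdot> ?z = 0"
        by (simp add: F_def comp_distribs comp_assoc comp_reduce[OF VV] et comp_reduce[OF eV])
      have "(V (Suc (Suc n)))\<star> \<cdot> ?z = 0"
      proof -
        have "(V (Suc (Suc n)))\<star> \<cdot> ?z = v\<star> \<cdot> ((V (Suc n))\<star> \<cdot> (V (Suc n) \<cdot> t))"
          by (subst VS) (simp only: adj_simps VM v comp_assoc)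
        then show ?thesis by (simp add: comp_reduce[OF VV] et vt)
      qed
      then have FSz: "F (Suc n) \<cdot> ?z = ?z"
        by (simp only: F_def comp_distribs comp_assoc comp_reduce[OF eV]) simp
      have orth1: "(y n)\<star> \<cdot> ?z = 0"
      proof -
        have "(y n)\<star> = (y n)\<star> \<cdot> F n"
          using arg_cong[OF y(2), of cadjoint] adj_simps(1)[OF projD(1)[OF FP] pisomD(1)[OF y(1)]]
          by (simp only: projD(2)[OF FP])
        then have "(y n)\<star> \<cdot> ?z = (y n)\<star> \<cdot> (F n \<cdot> ?z)" by (metis comp_assoc)
        then show ?thesis by (simp add: Fz)
      qed
      have orth2: "y n \<cdot> ?z\<star> = 0"
      proof -
        have "y n \<cdot> (w\<star> \<cdot> w) = y n"
          using w(2) proj_le_swap(1)[OF pisom_proj(1)[OF y(1)] pisom_proj(1)[OF w(1)]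
            pisom_extension(1)[OF y(1) w(1) w(2)]] by (metis comp_assoc)
        then have 1: "y n \<cdot> (id_blinfun - w\<star> \<cdot> w) = 0" by (simp add: comp_distribs)
        have 2: "(id_blinfun - w\<star> \<cdot> w) \<cdot> t\<star> = t\<star>"
          using arg_cong[OF t(3), of cadjoint] adj_simps(1)[OF pisomD(1)[OF t(1)] projD(1)[OF r(1)]]
          by (simp only: projD(2)[OF r(1)])
        have "y n \<cdot> t\<star> = y n \<cdot> ((id_blinfun - w\<star> \<cdot> w) \<cdot> t\<star>)" by (simp only: 2)
        also have "\<dots> = 0" by (simp only: comp_reduce[OF 1] comp_zero)
        finally show ?thesis by (simp add: adj_simps VM pisomD[OF t(1)] comp_reduce)
      qed
      note s = pisom_sum[OF y(1) zP orth1 orth2]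
      have "F (Suc n) \<cdot> (y n + ?z) = y n + ?z"
        using comp_reduce[OF FF[of n], of "y n"] by (simp only: comp_distribs FSz y(2))
      from max[OF s(1) s(4) _ this] show ?thesis
        using s(2) by (simp add: zz phi_add mem_intros pisomD(1)[OF y(1)] pisomD(1)[OF t(1)])
    qed
    define a where "a n = Re (\<phi> ((y n)\<star> \<cdot> y n))" for n
    have "incseq a" unfolding a_def
      by (intro incseq_SucI phi_mono pisom_proj y pisom_extension[OF y(1) y(1) y(3)])
    moreover have "a n \<le> 1" for n unfolding a_def by (intro phi_proj_le_one pisom_proj y)
    ultimately obtain L where L: "a \<longlonglongrightarrow> L" using incseq_convergent by metis
    have "(\<lambda>n. a n + Re (\<phi> (t\<star> \<cdot> t))) \<longlonglongrightarrow> L + Re (\<phi> (t\<star> \<cdot> t))"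
      by (intro tendsto_add L tendsto_const)
    moreover have "(\<lambda>n. a (Suc n) + (1/2)^n) \<longlonglongrightarrow> L + 0"
      by (intro tendsto_add LIMSEQ_Suc L LIMSEQ_power_zero) simp
    ultimately have "L + Re (\<phi> (t\<star> \<cdot> t)) \<le> L + 0"
      using step unfolding a_def by (intro LIMSEQ_le) (auto simp: a_def)
    moreover have "0 < Re (\<phi> (t\<star> \<cdot> t))"
      using pisomD(2)[OF t(1)] t(2) by (intro phi_proj_pos pisom_proj t) force
    ultimately show False by simp
  qed
  then show thesis using w pisomD(1)[OF w(1)] that by blast
qed

end

context strong_algebra
begin

text \<open>
  The argument of Schroeder and Bernstein: with \<open>d = \<Sum>\<^sub>n w\<^sup>n (1 - e) w\<^sup>*\<^sup>n\<close>, the partial isometry \<open>w d\<close>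
  moves each term of the sum to the next one, so that \<open>w d + (1 - d)\<close> misses exactly \<open>1 - e\<close>.
\<close>

lemma isometry_onto:
  assumes e: "e \<in> projections W" and w: "w \<in> W" "w\<star> \<cdot> w = id_blinfun" "e \<cdot> w = w"
  obtains v where "v \<in> W" "v\<star> \<cdot> v = id_blinfun" "v \<cdot> v\<star> = e"
proof -
  note e' = projD[OF e]
  have we: "w\<star> \<cdot> e = w\<star>" using arg_cong[OF w(3), of cadjoint] w(1) e' by (simp add: adj_simps)
  have ww: "w\<star> \<cdot> (w \<cdot> z) = z" for z using comp_reduce[OF w(2)] by simp
  have ew: "e \<cdot> (w \<cdot> z) = w \<cdot> z" for z using w(3) by (rule comp_reduce)
  define D where "D = rec_nat (id_blinfun - e) (\<lambda>_ d. (id_blinfun - e) + w \<cdot> (d \<cdot> w\<star>))"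
  have D: "D 0 = id_blinfun - e" "D (Suc n) = (id_blinfun - e) + w \<cdot> (D n \<cdot> w\<star>)" for n
    by (simp_all add: D_def)
  have DP: "D n \<in> projections W" for n
  proof (induction n)
    case (Suc n)
    note d = projD[OF Suc]
    show ?case unfolding D
      by (rule projI) (simp_all add: mem_intros adj_simps op_simps d e' w(1) we ww ew comp_reduce[OF we])
  qed (simp add: D proj_compl e)
  have "D (Suc n) \<cdot> D n = D n" for n
  proof (induction n)
    case (Suc n)
    have "D (Suc n) \<cdot> (D n \<cdot> z) = D n \<cdot> z" for z :: "'a \<Rightarrow>\<^sub>L 'a" using Suc by (rule comp_reduce)
    then have "((id_blinfun - e) + w \<cdot> (D (Suc n) \<cdot> w\<star>)) \<cdot> ((id_blinfun - e) + w \<cdot> (D n \<cdot> w\<star>)) =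
        (id_blinfun - e) + w \<cdot> (D n \<cdot> w\<star>)"
      by (simp add: op_simps e' we ww ew comp_reduce[OF we])
    then show ?case by (simp only: D(2)[symmetric])
  qed (simp add: D op_simps e' we ww ew comp_reduce[OF we])
  from increasing_projections[of D, OF DP this] obtain d where
    d: "d \<in> projections W" and lim: "\<And>\<xi>. (\<lambda>n. D n \<xi>) \<longlonglongrightarrow> d \<xi>" by metis
  note d' = projD[OF d]
  have fix_d: "d = (id_blinfun - e) + w \<cdot> (d \<cdot> w\<star>)"
  proof (rule blinfun_eqI)
    fix \<xi>
    have "(\<lambda>n. D (Suc n) \<xi>) \<longlonglongrightarrow> d \<xi>" by (rule LIMSEQ_Suc[OF lim])
    moreover have "(\<lambda>n. (\<xi> - e \<xi>) + w (D n (w\<star> \<xi>))) \<longlonglongrightarrow> (\<xi> - e \<xi>) + w (d (w\<star> \<xi>))"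
      by (intro tendsto_add tendsto_const bounded_linear.tendsto[OF blinfun.bounded_linear_right lim])
    ultimately show "d \<xi> = ((id_blinfun - e) + w \<cdot> (d \<cdot> w\<star>)) \<xi>"
      using LIMSEQ_unique by (simp add: D blinfun.add_left blinfun.diff_left) blast
  qed
  have wd: "w\<star> \<cdot> d = d \<cdot> w\<star>"
    by (subst fix_d) (simp add: comp_distribs we ww)
  have dw: "d \<cdot> w = w \<cdot> d"
    using arg_cong[OF wd, of cadjoint] w(1) d' by (simp add: adj_simps mem_intros)
  define v where "v = w \<cdot> d + (id_blinfun - d)"
  have v_adj: "v\<star> = d \<cdot> w\<star> + (id_blinfun - d)"
    using w(1) d' by (simp add: v_def adj_simps mem_intros)
  have dwz: "d \<cdot> (w \<cdot> z) = w \<cdot> (d \<cdot> z)" for z using dw by (metis comp_assoc)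
  show thesis
  proof (rule that)
    show "v \<in> W" unfolding v_def by (intro mem_intros w d')
    show "v\<star> \<cdot> v = id_blinfun"
      unfolding v_adj by (simp add: v_def op_simps d' ww dwz wd)
    have "w \<cdot> (d \<cdot> w\<star>) = d - (id_blinfun - e)" by (subst (2) fix_d) simp
    then show "v \<cdot> v\<star> = e"
      unfolding v_adj by (simp add: v_def op_simps d')
  qed
qed

end

context prime_state_algebra
begin

text \<open>
  For finite \<open>e\<close> the given partial isometries can be modified so that each extends the one before,
  since equivalent subprojections of a finite \<open>e\<close> have equivalent complements in \<open>e\<close>. The
  case of infinite \<open>e\<close> is \<open>one_le_infinite\<close>.
\<close>

lemma one_le_limit:
  assumes e: "e \<in> projections M"
    and g: "\<And>n. g n \<in> projections M" "\<And>n. g (Suc n) \<cdot> g n = g n"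
      "\<And>\<xi>. (\<lambda>n. blinfun_apply (g n) \<xi>) \<longlonglongrightarrow> \<xi>"
    and x: "\<And>n. x n \<in> M" "\<And>n. (x n)\<star> \<cdot> x n = g n" "\<And>n. e \<cdot> x n = x n"
  obtains w where "w \<in> M" "w\<star> \<cdot> w = id_blinfun" "e \<cdot> w = w"
proof (cases "\<exists>v\<in>M. v\<star> \<cdot> v = e \<and> e \<cdot> v = v \<and> v \<cdot> v\<star> \<noteq> e")
  case True
  then show thesis using one_le_infinite[OF e] that by metis
next
  case False
  then have fin: "v \<cdot> v\<star> = e" if "v \<in> M" "v\<star> \<cdot> v = e" "e \<cdot> v = v" for v using that by blast
  note e' = projD[OF e]
  note g' = projD[OF g(1)]
  have xP: "x n \<in> pisoms M" for n using x(1,2) g(1) by (rule pisomI_proj)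
  define P where "P n y \<longleftrightarrow> y \<in> pisoms M \<and> y\<star> \<cdot> y = g n \<and> e \<cdot> y = y" for n y
  have "\<exists>y. \<forall>n. P n (y n) \<and> y (Suc n) \<cdot> ((y n)\<star> \<cdot> y n) = y n"
  proof (rule dependent_nat_choice)
    show "\<exists>y. P 0 y" by (rule exI[of _ "x 0"]) (simp add: P_def xP x)
    fix y n assume "P n y"
    then have y: "y \<in> pisoms M" "y\<star> \<cdot> y = g n" "e \<cdot> y = y" by (auto simp: P_def)
    note y' = pisomD[OF y(1)]
    define X where "X = x (Suc n)"
    have X: "X \<in> M" "X\<star> \<cdot> X = g (Suc n)" "e \<cdot> X = X" "X \<cdot> g (Suc n) = X"
      using x pisomD(2)[OF xP] by (simp_all add: X_def)
    note gg = proj_le_swap[OF g(1) g(1) g(2)]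
    have yg: "y \<cdot> g n = y" using y'(2) by (simp only: y(2))
    have gy: "g n \<cdot> y\<star> = y\<star>" using arg_cong[OF yg, of cadjoint] y'(1) g' by (simp add: adj_simps)
    have ye: "y\<star> \<cdot> e = y\<star>" using arg_cong[OF y(3), of cadjoint] y'(1) e' by (simp add: adj_simps)
    let ?s = "X \<cdot> (g n \<cdot> X\<star>)" and ?r = "y \<cdot> y\<star>"
    have XX: "X\<star> \<cdot> (X \<cdot> z) = g (Suc n) \<cdot> z" for z using X(2) by (rule comp_reduce)
    have sP: "?s \<in> projections M"
      by (rule projI) (simp_all add: mem_intros adj_simps X g' comp_assoc XX gg)
    have es: "e \<cdot> ?s = ?s" using X(3) by (rule comp_reduce)
    have er: "e \<cdot> ?r = ?r" using y(3) by (rule comp_reduce)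
    have aP: "e - ?s \<in> projections M" by (rule proj_diff[OF sP e es])
    have bP: "e - ?r \<in> projections M" by (rule proj_diff[OF pisom_proj(2)[OF y(1)] e er])
    obtain z0 where z0: "z0 \<in> pisoms M" "z0 \<cdot> (e - ?s) = z0" "(e - ?r) \<cdot> z0 = z0"
      "z0\<star> \<cdot> z0 = e - ?s \<or> z0 \<cdot> z0\<star> = e - ?r" using comparison[OF aP bP] by metis
    have dom: "z0\<star> \<cdot> z0 = e - ?s"
    proof (rule ccontr)
      assume "\<not> ?thesis"
      with z0(4) have zz: "z0 \<cdot> z0\<star> = e - ?r" by blast
      note z0' = pisomD[OF z0(1)]
      have az: "(e - ?s) \<cdot> z0\<star> = z0\<star>"
        using arg_cong[OF z0(2), of cadjoint] adj_simps(1)[OF z0'(1) projD(1)[OF aP]]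
        by (simp only: projD(2)[OF aP])
      \<comment> \<open>Otherwise \<open>e - s\<close> is strictly larger than \<open>e - r\<close>, and \<open>e\<close> would be equivalent to a proper
        subprojection through \<open>u\<close>, which maps \<open>r\<close> onto \<open>s\<close> and \<open>e - r\<close> into \<open>e - s\<close>.\<close>
      let ?u = "X \<cdot> (g n \<cdot> y\<star>) + z0\<star>"
      have sX: "?s \<cdot> (X \<cdot> (g n \<cdot> z)) = X \<cdot> (g n \<cdot> z)" for z by (simp add: comp_assoc XX gg g')
      have "(e - ?s) \<cdot> ?s = 0" by (simp only: comp_distribs(3) es projD(3)[OF sP] diff_self)
      then have "z0 \<cdot> ?s = 0" using z0(2) by (metis comp_assoc comp_zero(1))
      then have zX: "z0 \<cdot> (X \<cdot> g n) = 0"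
        using sX[of id_blinfun] by (metis comp_assoc comp_zero(2) comp_id(1))
      have zX': "z0 \<cdot> (X \<cdot> (g n \<cdot> z)) = 0" for z using zX by (metis comp_assoc comp_zero(2))
      have Xz: "g n \<cdot> (X\<star> \<cdot> z0\<star>) = 0"
        using arg_cong[OF zX, of cadjoint] X(1) g' z0'(1) by (simp add: adj_simps mem_intros comp_assoc)
      have uM: "?u \<in> M" by (intro mem_intros X y' z0' g')
      have "?u\<star> = y \<cdot> (g n \<cdot> X\<star>) + z0"
        by (simp add: adj_simps mem_intros X y' z0' g' comp_assoc)
      then have "?u\<star> \<cdot> ?u = e"
        using zX'[of "y\<star>"] by (simp add: op_simps XX gg g' gy Xz zX' zz)
      moreover have "e \<cdot> ?u = ?u"
      proof -
        have "e \<cdot> z0\<star> = z0\<star>"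
          using arg_cong[OF az, of "\<lambda>t. e \<cdot> t"] az
          by (metis comp_assoc comp_distribs(4) e'(3) es)
        then show ?thesis by (simp add: comp_distribs comp_reduce[OF X(3)])
      qed
      ultimately have uu: "?u \<cdot> ?u\<star> = e" using fin uM by blast
      have yz: "y\<star> \<cdot> z0 = 0"
      proof -
        have "y\<star> \<cdot> (e - ?r) = 0" by (simp add: comp_distribs ye y')
        then have "y\<star> \<cdot> ((e - ?r) \<cdot> z0) = 0 \<cdot> z0" by (rule comp_reduce)
        then show ?thesis by (simp only: z0(3) comp_zero)
      qed
      have zy: "z0\<star> \<cdot> y = 0"
        using arg_cong[OF yz, of cadjoint] y'(1) z0'(1) by (simp add: adj_simps mem_intros)
      have yy: "y\<star> \<cdot> (y \<cdot> z) = g n \<cdot> z" for z using y(2) by (rule comp_reduce)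
      have "?u \<cdot> ?u\<star> = ?s + z0\<star> \<cdot> z0"
        using \<open>?u\<star> = _\<close> by (simp add: op_simps yy g' yz comp_reduce[OF zy])
      with uu have "z0\<star> \<cdot> z0 = e - ?s" by (simp add: algebra_simps)
      with \<open>\<not> z0\<star> \<cdot> z0 = e - ?s\<close> show False by blast
    qed
    note z0' = pisomD[OF z0(1)]
    let ?d = "g (Suc n) - g n"
    let ?q = "z0 \<cdot> (X \<cdot> ?d)"
    have dP: "?d \<in> projections M" by (rule proj_diff[OF g(1) g(1) g(2)])
    have aX: "(e - ?s) \<cdot> (X \<cdot> ?d) = X \<cdot> ?d"
      by (simp add: op_simps comp_reduce[OF X(3)] X XX g' gg g(2))
    have "?q\<star> \<cdot> ?q = ?d \<cdot> (X\<star> \<cdot> ((z0\<star> \<cdot> z0) \<cdot> (X \<cdot> ?d)))"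
      using X(1) z0'(1) projD(1)[OF dP] by (simp add: adj_simps(1) mem_intros projD(2)[OF dP] comp_assoc)
    also have "\<dots> = ?d \<cdot> (X\<star> \<cdot> (X \<cdot> ?d))" by (simp only: dom aX)
    also have "\<dots> = ?d"
      by (simp add: XX comp_distribs g' gg g(2))
    finally have qq: "?q\<star> \<cdot> ?q = ?d" .
    have qM: "?q \<in> M" by (intro mem_intros X z0' g')
    have qP: "?q \<in> pisoms M" by (rule pisomI_proj[OF qM qq dP])
    have orth1: "y\<star> \<cdot> ?q = 0"
    proof -
      have "y\<star> \<cdot> (e - ?r) = 0" by (simp add: comp_distribs ye y')
      then have "y\<star> \<cdot> ((e - ?r) \<cdot> z0) = 0 \<cdot> z0" by (rule comp_reduce)
      then have "y\<star> \<cdot> z0 = 0" by (simp only: z0(3) comp_zero)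
      then show ?thesis using comp_reduce by fastforce
    qed
    have orth2: "y \<cdot> ?q\<star> = 0"
    proof -
      have "?d \<cdot> ?q\<star> = ?q\<star>"
      proof -
        have "?q \<cdot> ?d = ?q" by (simp only: comp_assoc projD(3)[OF dP])
        then show ?thesis using adj_simps(1)[OF qM projD(1)[OF dP]] by (simp only: projD(2)[OF dP])
      qed
      moreover have "y \<cdot> ?d = 0"
      proof -
        have "y \<cdot> g (Suc n) = y" using yg gg(1) by (metis comp_assoc)
        then show ?thesis by (simp add: comp_distribs yg)
      qed
      ultimately show ?thesis using comp_reduce[of y ?d 0 "?q\<star>"] by simp
    qed
    note s = pisom_sum[OF y(1) qP orth1 orth2]
    have "e \<cdot> z0 = z0" using z0(3) by (metis comp_assoc comp_distribs(4) e'(3) er)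
    then have "e \<cdot> (y + ?q) = y + ?q" using comp_reduce[of e z0 z0 "X \<cdot> ?d"] by (simp add: comp_distribs(2) y(3))
    moreover have "(y + ?q)\<star> \<cdot> (y + ?q) = g (Suc n)" using s(2) by (simp only: y(2) qq) simp
    ultimately show "\<exists>y'. P (Suc n) y' \<and> y' \<cdot> (y\<star> \<cdot> y) = y"
      using s(1,4) by (auto simp: P_def)
  qed
  then obtain y where y: "\<And>n. P n (y n)" "\<And>n. y (Suc n) \<cdot> ((y n)\<star> \<cdot> y n) = y n" by blast
  have y': "\<And>n. y n \<in> pisoms M" "\<And>n. (y n)\<star> \<cdot> y n = g n" "\<And>n. e \<cdot> y n = y n"
    using y(1) by (auto simp: P_def)
  obtain w where w: "w \<in> pisoms M" "\<And>\<xi>. (\<lambda>n. ((y n)\<star> \<cdot> y n) \<xi>) \<longlonglongrightarrow> (w\<star> \<cdot> w) \<xi>" "e \<cdot> w = w"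
    by (rule pisom_limit[of y, OF y'(1) y(2)]) (use y'(3) in blast)
  have "w\<star> \<cdot> w = id_blinfun"
  proof (rule blinfun_eqI)
    fix \<xi>
    have "(\<lambda>n. g n \<xi>) \<longlonglongrightarrow> (w\<star> \<cdot> w) \<xi>" using w(2)[of \<xi>] by (simp only: y'(2))
    from LIMSEQ_unique[OF this g(3)] show "(w\<star> \<cdot> w) \<xi> = id_blinfun \<xi>" by simp
  qed
  then show thesis using that w pisomD(1)[OF w(1)] by blast
qed

end

section \<open>Suprema of projections under a trace\<close>

locale trace_algebra = state_algebra +
  assumes trace: "x \<in> M \<Longrightarrow> y \<in> M \<Longrightarrow> \<phi> (x \<cdot> y) = \<phi> (y \<cdot> x)"
begin

text \<open>
  The supremum of \<open>p\<close> and \<open>q\<close> exceeds \<open>q\<close> by the range projection of \<open>(1 - q) p\<close>, which is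
  equivalent to a subprojection of \<open>p\<close>.
\<close>

lemma supremum_two:
  assumes p: "p \<in> projections M" and q: "q \<in> projections M"
  obtains r where "r \<in> projections M" "r \<cdot> p = p" "r \<cdot> q = q"
    "\<forall>s. s \<cdot> p = p \<longrightarrow> s \<cdot> q = q \<longrightarrow> s \<cdot> r = r" "Re (\<phi> r) \<le> Re (\<phi> p) + Re (\<phi> q)"
proof -
  note p' = projD[OF p] and q' = projD[OF q]
  let ?x = "(id_blinfun - q) \<cdot> p"
  have "?x \<in> M" by (intro mem_intros p' q')
  then obtain v where v: "v \<in> M" "v \<cdot> v\<star> \<cdot> v = v" "(v \<cdot> v\<star>) \<cdot> ?x = ?x"
    "\<And>z :: 'a \<Rightarrow>\<^sub>L 'a. ?x \<cdot> z = 0 \<Longrightarrow> v \<cdot> z = 0" "\<And>z :: 'a \<Rightarrow>\<^sub>L 'a. z \<cdot> ?x = 0 \<Longrightarrow> z \<cdot> v = 0"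
    using polar_decomposition by metis
  have vP: "v \<in> pisoms M" using v by (simp add: pisoms_def comp_assoc)
  have qv: "q \<cdot> v = 0" by (rule v(5)) (simp add: op_simps q')
  have vq: "v\<star> \<cdot> q = 0" using arg_cong[OF qv, of cadjoint] v(1) q' by (simp add: adj_simps)
  have "v \<cdot> (id_blinfun - p) = 0" by (rule v(4)) (simp add: op_simps p')
  then have vp: "v \<cdot> p = v" by (simp add: comp_distribs)
  have pv: "p \<cdot> v\<star> = v\<star>" using arg_cong[OF vp, of cadjoint] v(1) p' by (simp add: adj_simps)
  let ?r = "q + v \<cdot> v\<star>"
  show thesis
  proof (rule that)
    show "?r \<in> projections M"
      by (rule projI)
        (simp_all add: mem_intros adj_simps v(1) q' op_simps vq comp_reduce[OF qv] pisomD[OF vP])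
    have "v \<cdot> (v\<star> \<cdot> (q \<cdot> p)) = 0" by (simp add: comp_reduce[OF vq])
    then have "v \<cdot> (v\<star> \<cdot> p) = p - q \<cdot> p" using v(3) by (simp add: op_simps)
    then show "?r \<cdot> p = p" by (simp add: op_simps)
    show "?r \<cdot> q = q" by (simp add: op_simps q' vq)
    show "\<forall>s. s \<cdot> p = p \<longrightarrow> s \<cdot> q = q \<longrightarrow> s \<cdot> ?r = ?r"
    proof (intro allI impI)
      fix s assume s: "s \<cdot> p = p" "s \<cdot> q = q"
      have "(s - id_blinfun) \<cdot> v = 0" by (rule v(5)) (simp add: op_simps s comp_reduce[OF s(2)])
      then have "s \<cdot> v = v" by (simp add: comp_distribs)
      then show "s \<cdot> ?r = ?r" by (simp add: comp_distribs s comp_reduce)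
    qed
    have "Re (\<phi> (v \<cdot> v\<star>)) = Re (\<phi> (v\<star> \<cdot> v))" using trace[OF v(1) adj_mem[OF v(1)]] by simp
    also have "\<dots> \<le> Re (\<phi> p)" by (intro phi_mono pisom_proj vP p comp_reduce pv)
    finally show "Re (\<phi> ?r) \<le> Re (\<phi> p) + Re (\<phi> q)" using v(1) q' by (simp add: phi_add mem_intros)
  qed
qed

text \<open>
  By normality the trace of the supremum is the limit of the traces of the finite suprema.
\<close>

lemma supremum_sequence:
  assumes p: "\<And>n::nat. p n \<in> projections M" and C: "\<And>n. (\<Sum>i<n. Re (\<phi> (p i))) \<le> C"
  obtains r where "r \<in> projections M" "\<And>n. r \<cdot> p n = p n"
    "\<forall>s. (\<forall>n. s \<cdot> p n = p n) \<longrightarrow> s \<cdot> r = r" "Re (\<phi> r) \<le> C"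
proof -
  define P where "P n R \<longleftrightarrow> R \<in> projections M \<and> Re (\<phi> R) \<le> (\<Sum>i<n. Re (\<phi> (p i))) \<and>
    (\<forall>s. (\<forall>i. s \<cdot> p i = p i) \<longrightarrow> s \<cdot> R = R)" for n :: nat and R
  have "\<exists>R. \<forall>n. P n (R n) \<and> (R (Suc n) \<cdot> R n = R n \<and> R (Suc n) \<cdot> p n = p n)"
  proof (rule dependent_nat_choice)
    show "\<exists>R. P 0 R" by (rule exI[of _ 0]) (simp add: P_def proj_zero phi_zero)
    fix R n assume R: "P n R"
    then have RP: "R \<in> projections M" by (simp add: P_def)
    obtain r where r: "r \<in> projections M" "r \<cdot> R = R" "r \<cdot> p n = p n"
      "\<forall>s. s \<cdot> R = R \<longrightarrow> s \<cdot> p n = p n \<longrightarrow> s \<cdot> r = r" "Re (\<phi> r) \<le> Re (\<phi> R) + Re (\<phi> (p n))"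
      using supremum_two[OF RP p[of n]] by metis
    then have "P (Suc n) r" using R by (auto simp: P_def)
    then show "\<exists>R'. P (Suc n) R' \<and> (R' \<cdot> R = R \<and> R' \<cdot> p n = p n)" using r by blast
  qed
  then obtain R where "\<And>n. P n (R n)" and inc: "\<And>n. R (Suc n) \<cdot> R n = R n"
    and Rp: "\<And>n. R (Suc n) \<cdot> p n = p n" by blast
  then have R: "\<And>n. R n \<in> projections M" "\<And>n. Re (\<phi> (R n)) \<le> (\<Sum>i<n. Re (\<phi> (p i)))"
    "\<And>n s. (\<forall>i. s \<cdot> p i = p i) \<Longrightarrow> s \<cdot> R n = R n" by (auto simp: P_def)
  obtain r where r: "r \<in> projections M" "\<And>n. r \<cdot> R n = R n" "\<And>\<xi>. (\<lambda>n. R n \<xi>) \<longlonglongrightarrow> r \<xi>"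
    and least: "\<forall>s. (\<forall>n. s \<cdot> R n = R n) \<longrightarrow> s \<cdot> r = r"
    using increasing_projections[of R, OF R(1) inc] by metis
  show thesis
  proof (rule that[OF r(1)])
    show "r \<cdot> p n = p n" for n using r(2)[of "Suc n"] Rp[of n] by (metis comp_assoc)
    show "\<forall>s. (\<forall>n. s \<cdot> p n = p n) \<longrightarrow> s \<cdot> r = r" using least R(3) by blast
    show "Re (\<phi> r) \<le> C"
      by (rule LIMSEQ_le_const2[OF projection_limit_phi[OF R(1) r(1,3)]])
        (use R(2) C order_trans in blast)
  qed
qed

text \<open>
  Take for \<open>g\<^sub>k\<close> the complement of the supremum of the \<open>1 - f\<^sub>n\<close> with \<open>n \<ge> k\<close>. Subadditivity of the trace
  bounds \<open>\<phi> (1 - g\<^sub>k)\<close> by a geometric tail.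
\<close>

lemma increasing_infima:
  assumes f: "\<And>n::nat. f n \<in> projections M" and small: "\<And>n. 1 - Re (\<phi> (f n)) \<le> (1/2)^Suc n"
  obtains g where "\<And>n. g n \<in> projections M" "\<And>n. g (Suc n) \<cdot> g n = g n"
    "\<And>n. f n \<cdot> g n = g n" "\<And>\<xi>. (\<lambda>n. blinfun_apply (g n) \<xi>) \<longlonglongrightarrow> \<xi>"
proof -
  note f' = projD[OF f]
  define p where "p n = id_blinfun - f n" for n
  have p: "p n \<in> projections M" for n unfolding p_def by (rule proj_compl[OF f])
  have phi_p: "Re (\<phi> (p n)) \<le> (1/2)^Suc n" for n
    using small[of n] by (simp add: p_def phi_diff mem_intros f' phi_id)
  have "(\<Sum>i<n. Re (\<phi> (p (i + k)))) \<le> (1/2)^k" for n k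
  proof -
    have "(\<Sum>i<n. Re (\<phi> (p (i + k)))) \<le> (1/2)^k - (1/2)^(n + k)"
    proof (induction n)
      case (Suc n)
      then show ?case using phi_p[of "n + k"] by simp
    qed simp
    also have "\<dots> \<le> (1/2)^k" by simp
    finally show ?thesis .
  qed
  then have "\<exists>r. r \<in> projections M \<and> (\<forall>n. r \<cdot> p (n + k) = p (n + k)) \<and>
      (\<forall>s. (\<forall>n. s \<cdot> p (n + k) = p (n + k)) \<longrightarrow> s \<cdot> r = r) \<and> Re (\<phi> r) \<le> (1/2)^k" for k
    using supremum_sequence[of "\<lambda>n. p (n + k)" "(1/2)^k", OF p] by metis
  then obtain r where r: "\<And>k. r k \<in> projections M" "\<And>k n. r k \<cdot> p (n + k) = p (n + k)"
    "\<And>k s. (\<forall>n. s \<cdot> p (n + k) = p (n + k)) \<Longrightarrow> s \<cdot> r k = r k" "\<And>k. Re (\<phi> (r k)) \<le> (1/2)^k"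
    by metis
  define g where "g k = id_blinfun - r k" for k
  have g: "g k \<in> projections M" for k unfolding g_def by (rule proj_compl[OF r(1)])
  have dec: "r k \<cdot> r (Suc k) = r (Suc k)" for k
    by (rule r(3)) (use r(2)[of k "Suc n" for n] in simp)
  have inc: "g (Suc k) \<cdot> g k = g k" for k
    using proj_le_swap(1)[OF r(1) r(1) dec] by (simp add: g_def comp_distribs)
  have fg: "f k \<cdot> g k = g k" for k
  proof -
    have "p k \<cdot> r k = p k" using proj_le_swap(1)[OF p r(1)] r(2)[of k 0] by simp
    moreover have "f k = id_blinfun - p k" by (simp add: p_def)
    ultimately show ?thesis by (simp add: g_def comp_distribs)
  qed
  obtain q where q: "q \<in> projections M" "\<And>n. q \<cdot> g n = g n" "\<And>\<xi>. (\<lambda>n. g n \<xi>) \<longlonglongrightarrow> q \<xi>"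
    using increasing_projections[of g, OF g inc] by metis
  have "Re (\<phi> (id_blinfun - q)) \<le> (1/2)^k" for k
  proof -
    have "Re (\<phi> (g k)) \<le> Re (\<phi> q)" by (rule phi_mono[OF g q(1,2)])
    then show ?thesis
      using r(4)[of k] by (simp add: g_def phi_diff mem_intros projD[OF r(1)] projD[OF q(1)])
  qed
  then have "\<not> 0 < Re (\<phi> (id_blinfun - q))"
    using real_arch_pow_inv[of "Re (\<phi> (id_blinfun - q))" "1/2"] by (force simp: not_less[symmetric])
  then have "id_blinfun - q = 0" using phi_proj_pos[OF proj_compl[OF q(1)]] by blast
  then have "q = id_blinfun" by simp
  then show thesis using that[of g] g inc fg q(3) by auto
qed

end

section \<open>Orthogonal projections onto closed subspaces\<close>

text \<open>
  A minimizing sequence for the distance to \<open>x\<close> is Cauchy by the parallelogram law.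
\<close>

lemma projection_theorem_point:
  fixes K :: "'a::complex_hilbert_space set"
  assumes closed: "closed K" and ne: "0 \<in> K" and add: "\<And>x y. x \<in> K \<Longrightarrow> y \<in> K \<Longrightarrow> x + y \<in> K"
    and scale: "\<And>r x. x \<in> K \<Longrightarrow> r *\<^sub>R x \<in> K"
  shows "\<exists>z\<in>K. \<forall>k\<in>K. inner (x - z) k = 0"
proof -
  define J where "J k = (norm (x - k))\<^sup>2" for k
  define m where "m = Inf (J ` K)"
  have bdd: "bdd_below (J ` K)" by (rule bdd_belowI[of _ 0]) (auto simp: J_def)
  have m_le: "m \<le> J k" if "k \<in> K" for k unfolding m_def using bdd that by (intro cInf_lower) auto
  have "\<exists>k\<in>K. J k < m + inverse (real (Suc n))" for n
  proof -
    have "Inf (J ` K) < m + inverse (real (Suc n))" by (simp add: m_def)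
    then show ?thesis using cInf_lessD[of "J ` K"] ne by auto
  qed
  then obtain X where X: "\<And>n. X n \<in> K" "\<And>n. J (X n) < m + inverse (real (Suc n))" by metis
  have par: "(norm (k - l))\<^sup>2 = 2 * J k + 2 * J l - 4 * J ((1/2) *\<^sub>R (k + l))" for k l
    unfolding J_def power2_norm_eq_inner
    by (simp add: inner_simps inner_commute field_simps)
  have dist: "(norm (X i - X j))\<^sup>2 < 4 * inverse (real (Suc n))" if "n \<le> i" "n \<le> j" for i j n
  proof -
    have "inverse (real (Suc i)) \<le> inverse (real (Suc n))"
      "inverse (real (Suc j)) \<le> inverse (real (Suc n))"
      using that by (auto intro!: le_imp_inverse_le)
    moreover have "m \<le> J ((1/2) *\<^sub>R (X i + X j))" by (intro m_le scale add X)
    ultimately show ?thesis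
      using X(2)[of i] X(2)[of j] par[of "X i" "X j"] by linarith
  qed
  have "Cauchy X"
  proof (rule CauchyI)
    fix e :: real assume "0 < e"
    then obtain n where n: "inverse (real (Suc n)) < e\<^sup>2 / 4"
      using reals_Archimedean[of "e\<^sup>2 / 4"] by auto
    have "norm (X i - X j) < e" if "n \<le> i" "n \<le> j" for i j
    proof (rule power2_less_imp_less)
      show "(norm (X i - X j))\<^sup>2 < e\<^sup>2" using dist[OF that] n by linarith
    qed (use \<open>0 < e\<close> in simp)
    then show "\<exists>M. \<forall>m\<ge>M. \<forall>n\<ge>M. norm (X m - X n) < e" by blast
  qed
  then obtain z where z: "X \<longlonglongrightarrow> z" using Cauchy_convergent convergent_def by blast
  have zK: "z \<in> K" using closed_sequentially[OF closed X(1) z] .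
  have lim: "(\<lambda>n. J (X n)) \<longlonglongrightarrow> J z" unfolding J_def by (intro tendsto_intros z)
  have "(\<lambda>n. m + inverse (real (Suc n))) \<longlonglongrightarrow> m"
    using tendsto_add[OF tendsto_const LIMSEQ_inverse_real_of_nat, of m] by simp
  then have Jz: "J z \<le> m" using X(2) by (intro LIMSEQ_le[OF lim]) (auto intro: less_imp_le)
  have "inner (x - z) k = 0" if k: "k \<in> K" for k
  proof (cases "k = 0")
    case False
    define a where "a = inner (x - z) k"
    define t where "t = a / inner k k"
    have pos: "inner k k > 0" using False by simp
    have "J z \<le> J (z + t *\<^sub>R k)" using Jz m_le[OF add[OF zK scale[OF k]]] order_trans by blast
    moreover have "J (z + t *\<^sub>R k) = J z - 2 * t * a + t\<^sup>2 * inner k k"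
      unfolding J_def power2_norm_eq_inner
      by (simp add: a_def inner_simps inner_commute power2_eq_square algebra_simps)
    moreover have "t\<^sup>2 * inner k k - 2 * t * a = - (a\<^sup>2 / inner k k)"
      using pos by (simp add: t_def power2_eq_square field_simps)
    ultimately have "a = 0" using pos by (simp add: divide_le_0_iff)
    then show ?thesis by (simp add: a_def)
  qed simp
  then show ?thesis using zK by blast
qed

lemma projection_theorem:
  fixes K :: "'a::complex_hilbert_space set"
  assumes closed: "closed K" and ne: "0 \<in> K" and add: "\<And>x y. x \<in> K \<Longrightarrow> y \<in> K \<Longrightarrow> x + y \<in> K"
    and scale: "\<And>c x. x \<in> K \<Longrightarrow> c *\<^sub>C x \<in> K"
  obtains P where "P \<in> bounded_ops" "P \<cdot> P = P" "P\<star> = P" "\<And>x. blinfun_apply P x \<in> K"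
    "\<And>x. x \<in> K \<Longrightarrow> blinfun_apply P x = x"
proof -
  have scaleR: "r *\<^sub>R x \<in> K" if "x \<in> K" for r x using scale[OF that] by (metis scaleC_of_real)
  have "\<forall>x. \<exists>z\<in>K. \<forall>k\<in>K. inner (x - z) k = 0"
    using projection_theorem_point[OF closed ne add scaleR] by blast
  then obtain P where P: "\<And>x. P x \<in> K" "\<And>x k. k \<in> K \<Longrightarrow> inner (x - P x) k = 0" by metis
  have unique: "P x = z" if z: "z \<in> K" "\<And>k. k \<in> K \<Longrightarrow> inner (x - z) k = 0" for x z
  proof -
    have "P x - z \<in> K" using add[OF P(1) scaleR[OF z(1), of "-1"]] by simp
    then have "inner (x - z) (P x - z) - inner (x - P x) (P x - z) = 0" using P(2) z(2) by simp
    then have "inner (P x - z) (P x - z) = 0" by (simp add: inner_diff_left)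
    then show ?thesis by simp
  qed
  have id: "P x = x" if "x \<in> K" for x using that by (intro unique) auto
  have P_add: "P (x + y) = P x + P y" for x y
    using P(2)[of _ x] P(2)[of _ y] by (intro unique add P) (simp add: inner_simps)
  have P_scaleC: "P (c *\<^sub>C x) = c *\<^sub>C P x" for c x
  proof (intro unique scale P)
    fix k assume k: "k \<in> K"
    have "cinner (c *\<^sub>C x - c *\<^sub>C P x) k = cinner (x - P x) (cnj c *\<^sub>C k)"
    proof -
      have "c *\<^sub>C x - c *\<^sub>C P x = c *\<^sub>C (x - P x)"
        using bounded_linear.linear[OF bounded_linear_scaleC, THEN linear_diff] by metis
      then show ?thesis by (simp add: cinner_scaleC_left cinner_scaleC_right)
    qed
    then have "inner (c *\<^sub>C x - c *\<^sub>C P x) k = inner (x - P x) (cnj c *\<^sub>C k)" by (metis Re_cinner)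
    then show "inner (c *\<^sub>C x - c *\<^sub>C P x) k = 0" using P(2) scale[OF k] by simp
  qed
  have contr: "norm (P x) \<le> norm x" for x
  proof -
    have "inner (P x) (P x) = inner x (P x)" using P(2)[OF P(1), of x x] by (simp add: inner_diff_left)
    then have "norm (P x) * norm (P x) \<le> norm x * norm (P x)"
      using norm_cauchy_schwarz[of x "P x"] by (simp add: dot_square_norm power2_eq_square)
    then show ?thesis by (cases "norm (P x) = 0") auto
  qed
  have "bounded_linear P"
  proof (rule bounded_linear_intro[where K = 1])
    show "P (r *\<^sub>R x) = r *\<^sub>R P x" for r x by (metis P_scaleC scaleC_of_real)
  qed (simp_all add: P_add contr)
  then have B: "blinfun_apply (Blinfun P) x = P x" for x by (simp add: bounded_linear_Blinfun_apply)
  have ops: "Blinfun P \<in> bounded_ops" by (simp add: bounded_ops_def B P_scaleC)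
  have "inner (P x) y = inner x (P y)" for x y
    using P(2)[OF P(1), of x y] P(2)[OF P(1), of y x] unfolding inner_diff_left by (metis right_minus_eq inner_commute)
  then have "(Blinfun P)\<star> = Blinfun P" by (intro cadjoint_eqI ops) (simp add: B)
  then show thesis using ops
    by (intro that[of "Blinfun P"]) (auto simp: B P id intro!: blinfun_eqI)
qed

lemma projection_commutes:
  assumes P: "P \<in> bounded_ops" "P\<star> = P" and A: "A \<in> bounded_ops"
    and inv: "P \<cdot> (A \<cdot> P) = A \<cdot> P" "P \<cdot> (A\<star> \<cdot> P) = A\<star> \<cdot> P"
  shows "A \<cdot> P = P \<cdot> A"
proof -
  have "(P \<cdot> (A\<star> \<cdot> P))\<star> = (A\<star> \<cdot> P)\<star>" by (simp only: inv)
  then have "P \<cdot> (A \<cdot> P) = P \<cdot> A"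
    using P A by (simp add: cadjoint_compose bounded_ops_compose bounded_ops_cadjoint cadjoint_cadjoint comp_assoc)
  then show ?thesis by (simp only: inv)
qed

text \<open>
  For projections \<open>e\<close>, \<open>f\<close> of a factor with \<open>f x e = 0\<close> for all \<open>x\<close>, the vectors \<open>\<xi>\<close> with
  \<open>f x \<xi> = 0\<close> for all \<open>x\<close> are the range of a central projection above \<open>e\<close>.
\<close>

lemma factor_prime:
  assumes M: "factor M" and e: "e \<in> projections M" "e \<noteq> 0" and f: "f \<in> projections M" "f \<noteq> 0"
  shows "\<exists>x\<in>M. f \<cdot> (x \<cdot> e) \<noteq> 0"
proof (rule ccontr)
  assume contr: "\<not> ?thesis"
  have vN: "von_neumann_algebra M" and center: "vn_center M = range scalar_op"
    using M by (auto simp: factor_def)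
  interpret strong_algebra M using vN by (rule strong_algebra_von_neumann)
  have bicomm: "commutant (commutant M) = M" using vN by (simp add: von_neumann_algebra_def)
  define K where "K = {\<xi>. \<forall>x\<in>M. f (x \<xi>) = 0}"
  have K_Inter: "K = (\<Inter>x\<in>M. (\<lambda>\<xi>. f (blinfun_apply x \<xi>)) -` {0})" by (auto simp: K_def)
  have "closed ((\<lambda>\<xi>. f (blinfun_apply x \<xi>)) -` {0})" for x
    by (intro closed_vimage closed_singleton bounded_linear.continuous_on[OF blinfun.bounded_linear_right] continuous_on_id)
  then have "closed K" unfolding K_Inter by (intro closed_INT) auto
  moreover have "0 \<in> K" "\<And>\<xi> \<eta>. \<xi> \<in> K \<Longrightarrow> \<eta> \<in> K \<Longrightarrow> \<xi> + \<eta> \<in> K"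
    by (auto simp: K_def blinfun.add_right)
  moreover have "c *\<^sub>C \<xi> \<in> K" if "\<xi> \<in> K" for c \<xi>
  proof -
    have "f (x (c *\<^sub>C \<xi>)) = c *\<^sub>C f (x \<xi>)" if "x \<in> M" for x
      using that ops projD(1)[OF f(1)] by (simp add: bounded_opsD)
    moreover have "c *\<^sub>C (0::'a) = 0"
      using bounded_linear.linear[OF bounded_linear_scaleC, THEN linear_0] by metis
    ultimately show ?thesis using that by (simp add: K_def)
  qed
  ultimately obtain P where P: "P \<in> bounded_ops" "P \<cdot> P = P" "P\<star> = P" "\<And>x. P x \<in> K" "\<And>x. x \<in> K \<Longrightarrow> P x = x"
    using projection_theorem[of K] by metis
  have inv: "P \<cdot> (A \<cdot> P) = A \<cdot> P" if "\<And>\<xi>. \<xi> \<in> K \<Longrightarrow> A \<xi> \<in> K" for A :: "'a \<Rightarrow>\<^sub>L 'a"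
    using that P(4,5) by (intro blinfun_eqI) simp
  have K_M: "A \<xi> \<in> K" if "A \<in> M" "\<xi> \<in> K" for A \<xi>
    unfolding K_def
  proof (intro CollectI ballI)
    fix x assume "x \<in> M"
    then have "f ((x \<cdot> A) \<xi>) = 0" using that comp_mem unfolding K_def by blast
    then show "f (x (A \<xi>)) = 0" by simp
  qed
  have K_M': "A \<xi> \<in> K" if A: "A \<in> commutant M" and \<xi>: "\<xi> \<in> K" for A \<xi>
    unfolding K_def
  proof (intro CollectI ballI)
    fix x assume "x \<in> M"
    then have "(f \<cdot> x) \<cdot> A = A \<cdot> (f \<cdot> x)"
      using A comp_mem[OF projD(1)[OF f(1)]] by (simp add: commutant_def)
    then have "f (x (A \<xi>)) = A (f (x \<xi>))" by (metis blinfun_apply_blinfun_compose)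
    then show "f (x (A \<xi>)) = 0" using \<xi> \<open>x \<in> M\<close> by (simp add: K_def)
  qed
  have "A \<cdot> P = P \<cdot> A" if "A \<in> M" for A
    by (intro projection_commutes P inv K_M ops adj_mem that)
  then have 1: "P \<in> commutant M" using P(1) by (simp add: commutant_def)
  have "A\<star> \<in> commutant M" if "A \<in> commutant M" for A
    by (rule commutant_cadjoint[OF _ _ that]) (auto intro: ops adj_mem)
  then have "A \<cdot> P = P \<cdot> A" if "A \<in> commutant M" for A
    using that by (intro projection_commutes P inv K_M') (auto simp: commutant_def)
  then have "P \<in> commutant (commutant M)" using P(1) by (simp add: commutant_def)
  then have "P \<in> vn_center M" using 1 bicomm by (simp add: vn_center_def)
  then obtain c where c: "P = scalar_op c" using center by auto
  have eK: "e \<xi> \<in> K" for \<xi>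
    unfolding K_def
  proof (intro CollectI ballI)
    fix x assume "x \<in> M"
    then have "f \<cdot> (x \<cdot> e) = 0" using contr by blast
    then show "f (x (e \<xi>)) = 0" by (metis blinfun_apply_blinfun_compose blinfun.zero_left)
  qed
  obtain \<xi> where \<xi>: "e \<xi> \<noteq> 0" using e(2) by (metis blinfun_eqI blinfun.zero_left)
  have "c *\<^sub>C e \<xi> = e \<xi>" using P(5)[OF eK, of \<xi>] by (simp add: c)
  then have "(c - 1) *\<^sub>C e \<xi> = 0"
    using scaleC_add_left[of "c - 1" 1 "e \<xi>"] by simp
  then have "c = 1" using norm_scaleC[of "c - 1" "e \<xi>"] \<xi> by simp
  then have "\<eta> \<in> K" for \<eta> using P(4)[of \<eta>] by (simp add: c)
  then have "f \<eta> = 0" for \<eta> unfolding K_def using id_mem by fastforce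
  then have "f = 0" by (intro blinfun_eqI) simp
  then show False using f(2) by simp
qed

section \<open>The Hilbert space of square-summable sequences\<close>

abbreviation sq_summable :: "(nat \<Rightarrow> 'a::real_normed_vector) \<Rightarrow> bool"
  where "sq_summable f \<equiv> summable (\<lambda>n. (norm (f n))\<^sup>2)"

lemma sq_summable_product:
  assumes "sq_summable f" "sq_summable g"
  shows "summable (\<lambda>n. norm (f n) * norm (g n))"
proof (rule summable_comparison_test')
  show "summable (\<lambda>n. (norm (f n))\<^sup>2 + (norm (g n))\<^sup>2)" using assms by (rule summable_add)
  fix n
  have "2 * (norm (f n) * norm (g n)) \<le> (norm (f n))\<^sup>2 + (norm (g n))\<^sup>2"
    using sum_squares_bound[of "norm (f n)" "norm (g n)"] by simp
  moreover have "0 \<le> norm (f n) * norm (g n)" by simp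
  ultimately show "norm (norm (f n) * norm (g n)) \<le> (norm (f n))\<^sup>2 + (norm (g n))\<^sup>2"
    unfolding real_norm_def by linarith
qed

lemma sq_summable_add:
  assumes "sq_summable f" "sq_summable g"
  shows "sq_summable (\<lambda>n. f n + g n)"
proof (rule summable_comparison_test')
  show "summable (\<lambda>n. 2 * ((norm (f n))\<^sup>2 + (norm (g n))\<^sup>2))"
    using assms by (intro summable_mult summable_add)
  fix n
  have "(norm (f n + g n))\<^sup>2 \<le> (norm (f n) + norm (g n))\<^sup>2" by (intro power_mono norm_triangle_ineq) simp
  also have "\<dots> \<le> 2 * ((norm (f n))\<^sup>2 + (norm (g n))\<^sup>2)"
    using sum_squares_bound[of "norm (f n)" "norm (g n)"] by (simp add: power2_sum)
  finally show "norm ((norm (f n + g n))\<^sup>2) \<le> 2 * ((norm (f n))\<^sup>2 + (norm (g n))\<^sup>2)" by simp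
qed

lemma sq_summable_bounded:
  assumes "sq_summable f" "\<And>n. norm (g n) \<le> C * norm (f n)"
  shows "sq_summable g"
proof (rule summable_comparison_test')
  show "summable (\<lambda>n. C\<^sup>2 * (norm (f n))\<^sup>2)" using assms(1) by (rule summable_mult)
  show "norm ((norm (g n))\<^sup>2) \<le> C\<^sup>2 * (norm (f n))\<^sup>2" for n
    using power_mono[OF assms(2)[of n] norm_ge_zero, of 2] by (simp add: power_mult_distrib)
qed

lemma norm_cinner_le: "cmod (cinner x y) \<le> norm x * norm y"
proof (cases "cinner x y = 0")
  case False
  define c where "c = cnj (cinner x y) / cmod (cinner x y)"
  have "cmod c = 1" using False by (simp add: c_def norm_divide)
  have "cinner (c *\<^sub>C x) y = complex_of_real (cmod (cinner x y))"
    using False by (simp add: cinner_scaleC_left c_def complex_norm_square[symmetric] power2_eq_square mult.commute)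
  then have "cmod (cinner x y) = inner (c *\<^sub>C x) y" by (metis Re_cinner Re_complex_of_real)
  also have "\<dots> \<le> norm (c *\<^sub>C x) * norm y" by (rule norm_cauchy_schwarz)
  finally show ?thesis by (simp add: norm_scaleC \<open>cmod c = 1\<close>)
qed simp

lemma sq_summable_cinner:
  fixes f g :: "nat \<Rightarrow> 'a::complex_hilbert_space"
  assumes "sq_summable f" "sq_summable g"
  shows "summable (\<lambda>n. cinner (f n) (g n))"
  by (rule summable_comparison_test'[OF sq_summable_product[OF assms]]) (rule norm_cinner_le)

lemma sq_summable_inner:
  fixes f g :: "nat \<Rightarrow> 'a::complex_hilbert_space"
  assumes "sq_summable f" "sq_summable g"
  shows "summable (\<lambda>n. inner (f n) (g n))"
  using summable_Re[OF sq_summable_cinner[OF assms]] by (simp add: Re_cinner)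

text \<open>
  Ultraweakly continuous functionals are given by square-summable sequences of vectors, that is, by
  vectors of the Hilbert space on which operators act diagonally.
\<close>

typedef (overloaded) 'a ell2 = "{f :: nat \<Rightarrow> 'a::complex_hilbert_space. sq_summable f}"
  by (rule exI[of _ "\<lambda>_. 0"]) simp

setup_lifting type_definition_ell2

instantiation ell2 :: (complex_hilbert_space) real_inner
begin

lift_definition zero_ell2 :: "'a ell2" is "\<lambda>_. 0" by simp
lift_definition plus_ell2 :: "'a ell2 \<Rightarrow> 'a ell2 \<Rightarrow> 'a ell2" is "\<lambda>f g n. f n + g n"
  by (rule sq_summable_add)
lift_definition uminus_ell2 :: "'a ell2 \<Rightarrow> 'a ell2" is "\<lambda>f n. - f n" by simp
lift_definition scaleR_ell2 :: "real \<Rightarrow> 'a ell2 \<Rightarrow> 'a ell2" is "\<lambda>r f n. r *\<^sub>R f n"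
  subgoal for r f by (rule sq_summable_bounded[where C = "\<bar>r\<bar>" and f = f]) simp_all
  done
lift_definition inner_ell2 :: "'a ell2 \<Rightarrow> 'a ell2 \<Rightarrow> real" is "\<lambda>f g. \<Sum>n. inner (f n) (g n)" .
lift_definition norm_ell2 :: "'a ell2 \<Rightarrow> real" is "\<lambda>f. sqrt (\<Sum>n. (norm (f n))\<^sup>2)" .

definition minus_ell2 :: "'a ell2 \<Rightarrow> 'a ell2 \<Rightarrow> 'a ell2" where "f - g = f + - g" for f g :: "'a ell2"
definition dist_ell2 :: "'a ell2 \<Rightarrow> 'a ell2 \<Rightarrow> real" where "dist f g = norm (f - g)" for f g :: "'a ell2"
definition sgn_ell2 :: "'a ell2 \<Rightarrow> 'a ell2" where "sgn f = inverse (norm f) *\<^sub>R f" for f :: "'a ell2"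
definition uniformity_ell2 :: "('a ell2 \<times> 'a ell2) filter"
  where "uniformity_ell2 = (INF e\<in>{0<..}. principal {(x, y). dist x y < e})"
definition open_ell2 :: "'a ell2 set \<Rightarrow> bool"
  where "open_ell2 U \<longleftrightarrow> (\<forall>x\<in>U. eventually (\<lambda>(x', y). x' = x \<longrightarrow> y \<in> U) uniformity)"

instance
proof
  fix f g h :: "'a ell2" and r s :: real and U :: "'a ell2 set"
  show "f + g + h = f + (g + h)" "f + g = g + f" "0 + f = f" by (transfer, simp add: add_ac)+
  show "- f + f = 0" by transfer simp
  show "f - g = f + - g" by (rule minus_ell2_def)
  show "r *\<^sub>R (f + g) = r *\<^sub>R f + r *\<^sub>R g" by transfer (simp add: scaleR_add_right)
  show "(r + s) *\<^sub>R f = r *\<^sub>R f + s *\<^sub>R f" by transfer (simp add: scaleR_add_left)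
  show "r *\<^sub>R s *\<^sub>R f = (r * s) *\<^sub>R f" "1 *\<^sub>R f = f" by (transfer, simp)+
  show "dist f g = norm (f - g)" by (rule dist_ell2_def)
  show "sgn f = inverse (norm f) *\<^sub>R f" by (rule sgn_ell2_def)
  show "uniformity = (INF e\<in>{0<..}. principal {(x, y::'a ell2). dist x y < e})"
    by (rule uniformity_ell2_def)
  show "open U \<longleftrightarrow> (\<forall>x\<in>U. eventually (\<lambda>(x', y). x' = x \<longrightarrow> y \<in> U) uniformity)"
    by (rule open_ell2_def)
  show "inner f g = inner g f" by transfer (simp add: inner_commute)
  show "inner (f + g) h = inner f h + inner g h"
    by transfer (simp add: inner_add_left suminf_add[OF sq_summable_inner sq_summable_inner])
  show "inner (r *\<^sub>R f) g = r * inner f g"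
    by transfer (simp add: suminf_mult sq_summable_inner)
  show "0 \<le> inner f f"
    by transfer (auto intro!: suminf_nonneg simp: sq_summable_inner)
  show "inner f f = 0 \<longleftrightarrow> f = 0"
    by transfer (subst suminf_eq_zero_iff, auto simp: sq_summable_inner fun_eq_iff)
  show "norm f = sqrt (inner f f)"
    by transfer (simp add: power2_norm_eq_inner)
qed

end

lemma norm_ell2_sq: "(norm f)\<^sup>2 = (\<Sum>n. (norm (Rep_ell2 f n))\<^sup>2)"
  using Rep_ell2[of f] by (simp add: norm_ell2.rep_eq suminf_nonneg)

lemma norm_component_le: "norm (Rep_ell2 f n) \<le> norm f"
proof (rule power2_le_imp_le)
  show "(norm (Rep_ell2 f n))\<^sup>2 \<le> (norm f)\<^sup>2"
    unfolding norm_ell2_sq using Rep_ell2[of f] sum_le_suminf[of "\<lambda>n. (norm (Rep_ell2 f n))\<^sup>2" "{n}"] by simp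
qed simp

lemma minus_ell2_rep: "Rep_ell2 (f - g) n = Rep_ell2 f n - Rep_ell2 g n"
  unfolding minus_ell2_def plus_ell2.rep_eq uminus_ell2.rep_eq by simp

instance ell2 :: (complex_hilbert_space) complete_space
proof
  fix X :: "nat \<Rightarrow> 'a ell2"
  assume Cau: "Cauchy X"
  have "Cauchy (\<lambda>k. Rep_ell2 (X k) n)" for n
    by (rule Cauchy_dominated[OF Cau, where C = 1]) (simp only: mult_1 norm_component_le flip: minus_ell2_rep)
  then have "\<forall>n. \<exists>l. (\<lambda>k. Rep_ell2 (X k) n) \<longlonglongrightarrow> l"
    using Cauchy_convergent convergent_def by blast
  then obtain f where f: "\<And>n. (\<lambda>k. Rep_ell2 (X k) n) \<longlonglongrightarrow> f n" by metis
  have tail: "\<exists>N. \<forall>j\<ge>N. sq_summable (\<lambda>n. Rep_ell2 (X j) n - f n) \<and>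
      (\<Sum>n. (norm (Rep_ell2 (X j) n - f n))\<^sup>2) \<le> e\<^sup>2" if "0 < e" for e :: real
  proof -
    obtain N where N: "\<And>j k. j \<ge> N \<Longrightarrow> k \<ge> N \<Longrightarrow> norm (X j - X k) < e"
      using CauchyD[OF Cau \<open>0 < e\<close>] by blast
    have partial: "(\<Sum>n<m. (norm (Rep_ell2 (X j) n - f n))\<^sup>2) \<le> e\<^sup>2" if j: "j \<ge> N" for j m
    proof (rule LIMSEQ_le_const2)
      show "(\<lambda>k. \<Sum>n<m. (norm (Rep_ell2 (X j) n - Rep_ell2 (X k) n))\<^sup>2) \<longlonglongrightarrow>
          (\<Sum>n<m. (norm (Rep_ell2 (X j) n - f n))\<^sup>2)"
        by (intro tendsto_sum tendsto_power tendsto_norm tendsto_diff tendsto_const f)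
      have "(\<Sum>n<m. (norm (Rep_ell2 (X j) n - Rep_ell2 (X k) n))\<^sup>2) \<le> e\<^sup>2" if k: "k \<ge> N" for k
      proof -
        have "(\<Sum>n<m. (norm (Rep_ell2 (X j - X k) n))\<^sup>2) \<le> (norm (X j - X k))\<^sup>2"
          unfolding norm_ell2_sq using Rep_ell2[of "X j - X k"] by (intro sum_le_suminf) auto
        also have "\<dots> \<le> e\<^sup>2" using N[OF j k] by (intro power_mono) auto
        finally show ?thesis by (simp add: minus_ell2_rep)
      qed
      then show "\<exists>N. \<forall>k\<ge>N. (\<Sum>n<m. (norm (Rep_ell2 (X j) n - Rep_ell2 (X k) n))\<^sup>2) \<le> e\<^sup>2" by blast
    qed
    have "sq_summable (\<lambda>n. Rep_ell2 (X j) n - f n) \<and> (\<Sum>n. (norm (Rep_ell2 (X j) n - f n))\<^sup>2) \<le> e\<^sup>2"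
      if "j \<ge> N" for j
    proof
      show s: "sq_summable (\<lambda>n. Rep_ell2 (X j) n - f n)"
        by (rule summableI_nonneg_bounded[OF _ partial[OF that]]) simp
      show "(\<Sum>n. (norm (Rep_ell2 (X j) n - f n))\<^sup>2) \<le> e\<^sup>2"
        by (rule suminf_le_const[OF s partial[OF that]])
    qed
    then show ?thesis by blast
  qed
  obtain j where "sq_summable (\<lambda>n. Rep_ell2 (X j) n - f n)" using tail[of 1] by auto
  then have "sq_summable (\<lambda>n. f n - Rep_ell2 (X j) n)" by (simp add: norm_minus_commute)
  from sq_summable_add[OF this, of "Rep_ell2 (X j)"] have fs: "sq_summable f"
    using Rep_ell2[of "X j"] by simp
  define F where "F = Abs_ell2 f"
  have F: "Rep_ell2 F = f" using fs by (simp add: F_def Abs_ell2_inverse)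
  have "X \<longlonglongrightarrow> F"
  proof (rule LIMSEQ_I)
    fix e :: real assume "0 < e"
    then obtain N where N: "\<forall>j\<ge>N. (\<Sum>n. (norm (Rep_ell2 (X j) n - f n))\<^sup>2) \<le> (e/2)\<^sup>2"
      using tail[of "e/2"] by auto
    have "norm (X j - F) < e" if "j \<ge> N" for j
    proof -
      have "(norm (X j - F))\<^sup>2 \<le> (e/2)\<^sup>2"
        unfolding norm_ell2_sq minus_ell2_rep F using N that by blast
      then have "norm (X j - F) \<le> e/2" by (rule power2_le_imp_le) (use \<open>0 < e\<close> in simp)
      then show ?thesis using \<open>0 < e\<close> by linarith
    qed
    then show "\<exists>N. \<forall>j\<ge>N. norm (X j - F) < e" by blast
  qed
  then show "convergent X" by (rule convergentI)
qed

instantiation ell2 :: (complex_hilbert_space) complex_hilbert_space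
begin

lift_definition scaleC_ell2 :: "complex \<Rightarrow> 'a ell2 \<Rightarrow> 'a ell2" is "\<lambda>c f n. c *\<^sub>C f n"
  subgoal for c f by (rule sq_summable_bounded[where C = "cmod c" and f = f]) (simp_all add: norm_scaleC)
  done
lift_definition cinner_ell2 :: "'a ell2 \<Rightarrow> 'a ell2 \<Rightarrow> complex" is "\<lambda>f g. \<Sum>n. cinner (f n) (g n)" .

instance
proof
  fix f g h :: "'a ell2" and r :: real and c d :: complex
  show "c *\<^sub>C (f + g) = c *\<^sub>C f + c *\<^sub>C g" by transfer (simp add: scaleC_add_right)
  show "(c + d) *\<^sub>C f = c *\<^sub>C f + d *\<^sub>C f" by transfer (simp add: scaleC_add_left)
  show "c *\<^sub>C d *\<^sub>C f = (c * d) *\<^sub>C f" by transfer (simp add: scaleC_scaleC)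
  show "complex_of_real r *\<^sub>C f = r *\<^sub>R f" by transfer (simp add: scaleC_of_real)
  show "cinner (f + g) h = cinner f h + cinner g h"
    by transfer (simp add: cinner_add_left suminf_add[OF sq_summable_cinner sq_summable_cinner])
  show "cinner (c *\<^sub>C f) g = c * cinner f g"
    by transfer (simp add: cinner_scaleC_left suminf_mult sq_summable_cinner)
  show "cinner f g = cnj (cinner g f)"
  proof transfer
    fix f g :: "nat \<Rightarrow> 'a" assume "sq_summable f" "sq_summable g"
    then have "(\<lambda>n. cnj (cinner (g n) (f n))) sums cnj (\<Sum>n. cinner (g n) (f n))"
      by (intro sums_cnj[THEN iffD2] summable_sums sq_summable_cinner)
    then show "(\<Sum>n. cinner (f n) (g n)) = cnj (\<Sum>n. cinner (g n) (f n))"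
      by (subst cinner_commute) (rule sums_unique[symmetric])
  qed
  show "Re (cinner f g) = inner f g"
    by transfer (simp add: Re_suminf sq_summable_cinner Re_cinner)
qed

end

section \<open>The double commutant and ultraweak density\<close>

lift_definition ell2_single :: "nat \<Rightarrow> 'a::complex_hilbert_space \<Rightarrow> 'a ell2" is "\<lambda>j x n. if n = j then x else 0"
  by (rule summable_finite[of "{j}" for j]) auto

lemma ell2_single_rep: "Rep_ell2 (ell2_single j x) n = (if n = j then x else 0)"
  by (simp add: ell2_single.rep_eq)

lemma norm_ell2_single: "norm (ell2_single j x) = norm x"
proof -
  have "(\<Sum>n. (norm (Rep_ell2 (ell2_single j x) n))\<^sup>2) = (\<Sum>n\<in>{j}. (norm (Rep_ell2 (ell2_single j x) n))\<^sup>2)"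
    by (rule suminf_finite) (auto simp: ell2_single_rep)
  then have "(norm (ell2_single j x))\<^sup>2 = (norm x)\<^sup>2" by (simp add: norm_ell2_sq ell2_single_rep)
  then show ?thesis by (simp add: power2_eq_iff_nonneg)
qed

lemma ell2_eqI: "(\<And>n. Rep_ell2 f n = Rep_ell2 g n) \<Longrightarrow> f = g"
  by (metis Rep_ell2_inject ext)

lemma bounded_linear_ell2_single: "bounded_linear (ell2_single j)"
  by (rule bounded_linear_intro[where K = 1])
    (auto intro!: ell2_eqI simp: ell2_single_rep plus_ell2.rep_eq scaleR_ell2.rep_eq norm_ell2_single)

lemma bounded_linear_component: "bounded_linear (\<lambda>f. Rep_ell2 f n)"
  by (rule bounded_linear_intro[where K = 1])
    (auto simp: plus_ell2.rep_eq scaleR_ell2.rep_eq norm_component_le)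

lemma ell2_singles_tendsto: "(\<lambda>m. \<Sum>j<m. ell2_single j (Rep_ell2 f j)) \<longlonglongrightarrow> f"
proof -
  have rep_sum: "Rep_ell2 (\<Sum>j<m. ell2_single j (Rep_ell2 f j)) n = (if n < m then Rep_ell2 f n else 0)" for m n
    by (induction m) (auto simp: zero_ell2.rep_eq plus_ell2.rep_eq ell2_single_rep less_Suc_eq)
  have s: "sq_summable (Rep_ell2 f)" using Rep_ell2 by auto
  have "(norm (f - (\<Sum>j<m. ell2_single j (Rep_ell2 f j))))\<^sup>2 = (\<Sum>n. (norm (Rep_ell2 f (n + m)))\<^sup>2)" for m
  proof -
    let ?t = "\<lambda>n. (norm (Rep_ell2 (f - (\<Sum>j<m. ell2_single j (Rep_ell2 f j))) n))\<^sup>2"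
    have t: "?t n = (if n < m then 0 else (norm (Rep_ell2 f n))\<^sup>2)" for n
      by (simp add: minus_ell2_rep rep_sum)
    have "summable ?t" using Rep_ell2[of "f - (\<Sum>j<m. ell2_single j (Rep_ell2 f j))"] by simp
    then have "suminf ?t = (\<Sum>n. ?t (n + m)) + (\<Sum>n<m. ?t n)" by (rule suminf_split_initial_segment)
    then show ?thesis unfolding norm_ell2_sq t by simp
  qed
  moreover have "(\<lambda>m. \<Sum>n. (norm (Rep_ell2 f (n + m)))\<^sup>2) \<longlonglongrightarrow> 0"
    by (rule suminf_exist_split2[OF s])
  ultimately have "(\<lambda>m. (norm (f - (\<Sum>j<m. ell2_single j (Rep_ell2 f j))))\<^sup>2) \<longlonglongrightarrow> 0" by simp
  then have "(\<lambda>m. sqrt ((norm (f - (\<Sum>j<m. ell2_single j (Rep_ell2 f j))))\<^sup>2)) \<longlonglongrightarrow> sqrt 0"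
    by (rule tendsto_real_sqrt)
  then have "(\<lambda>m. norm ((\<Sum>j<m. ell2_single j (Rep_ell2 f j)) - f)) \<longlonglongrightarrow> 0"
    by (simp add: norm_minus_commute)
  then show ?thesis by (simp add: tendsto_norm_zero_iff LIM_zero_iff)
qed

lift_definition amplify_fun :: "('a::complex_hilbert_space \<Rightarrow>\<^sub>L 'a) \<Rightarrow> 'a ell2 \<Rightarrow> 'a ell2" is
  "\<lambda>A f n. blinfun_apply A (f n)"
  subgoal for A f by (rule sq_summable_bounded[where C = "norm A" and f = f]) (simp_all add: norm_blinfun)
  done

lemma norm_amplify_fun: "norm (amplify_fun A f) \<le> norm A * norm f"
proof (rule power2_le_imp_le)
  have "(norm (amplify_fun A f))\<^sup>2 \<le> (\<Sum>n. (norm A)\<^sup>2 * (norm (Rep_ell2 f n))\<^sup>2)"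
    unfolding norm_ell2_sq
  proof (rule suminf_le)
    show "(norm (Rep_ell2 (amplify_fun A f) n))\<^sup>2 \<le> (norm A)\<^sup>2 * (norm (Rep_ell2 f n))\<^sup>2" for n
      using power_mono[OF norm_blinfun[of A "Rep_ell2 f n"] norm_ge_zero, of 2]
      by (simp add: amplify_fun.rep_eq power_mult_distrib)
  qed (use Rep_ell2[of f] Rep_ell2[of "amplify_fun A f"] in \<open>auto intro: summable_mult\<close>)
  also have "\<dots> = (norm A * norm f)\<^sup>2"
    using Rep_ell2[of f] by (simp add: suminf_mult norm_ell2_sq power_mult_distrib)
  finally show "(norm (amplify_fun A f))\<^sup>2 \<le> (norm A * norm f)\<^sup>2" .
qed simp

definition amplify :: "('a::complex_hilbert_space \<Rightarrow>\<^sub>L 'a) \<Rightarrow> ('a ell2 \<Rightarrow>\<^sub>L 'a ell2)"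
  where "amplify A = Blinfun (amplify_fun A)"

lemma amplify_rep [simp]: "Rep_ell2 (blinfun_apply (amplify A) f) n = A (Rep_ell2 f n)"
proof -
  have "bounded_linear (amplify_fun A)"
    by (rule bounded_linear_intro[where K = "norm A"])
      (auto intro!: ell2_eqI simp: amplify_fun.rep_eq plus_ell2.rep_eq scaleR_ell2.rep_eq
        blinfun.add_right blinfun.scaleR_right norm_amplify_fun mult.commute[of "norm (f :: 'a ell2)" for f])
  then show ?thesis by (simp add: amplify_def bounded_linear_Blinfun_apply amplify_fun.rep_eq)
qed

lemma amplify_bounded_ops: "A \<in> bounded_ops \<Longrightarrow> amplify A \<in> bounded_ops"
  by (auto simp: bounded_ops_def scaleC_ell2.rep_eq intro!: ell2_eqI)

lemma amplify_compose: "amplify (A \<cdot> B) = amplify A \<cdot> amplify B"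
  by (intro blinfun_eqI ell2_eqI) simp

lemma amplify_cadjoint:
  assumes A: "A \<in> bounded_ops" shows "(amplify A)\<star> = amplify (A\<star>)"
  by (rule cadjoint_eqI[OF amplify_bounded_ops[OF A]])
    (simp add: inner_ell2.rep_eq inner_cadjoint[OF A])

lemma amplify_single: "amplify A (ell2_single j x) = ell2_single j (A x)"
  by (intro ell2_eqI) (simp add: ell2_single_rep)

text \<open>
  The projection onto the closure of \<open>{(a \<zeta>\<^sub>n)\<^sub>n | a \<in> W}\<close> is a matrix of operators from the
  commutant of \<open>W\<close>, so it commutes with the amplification of every \<open>x\<close> in the double commutant.
\<close>

lemma (in strong_algebra) bicommutant_approximation:
  assumes x: "x \<in> commutant (commutant W)" and e: "0 < e"
  shows "\<exists>a\<in>W. norm (amplify a \<zeta> - amplify x \<zeta>) < e"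
proof -
  let ?S = "(\<lambda>a. amplify a \<zeta>) ` W"
  define K where "K = closure ?S"
  have add_S: "f + g \<in> ?S" if "f \<in> ?S" "g \<in> ?S" for f g
  proof -
    obtain a b where ab: "a \<in> W" "b \<in> W" "f = amplify a \<zeta>" "g = amplify b \<zeta>" using \<open>f \<in> ?S\<close> \<open>g \<in> ?S\<close> by blast
    have "amplify (a + b) \<zeta> = f + g" by (intro ell2_eqI) (simp add: ab plus_ell2.rep_eq blinfun.add_left)
    then show ?thesis using ab add_mem by (metis image_eqI)
  qed
  have act_S: "amplify b f \<in> ?S" if bW: "b \<in> W" and f: "f \<in> ?S" for b f
  proof -
    obtain a where a: "a \<in> W" "f = amplify a \<zeta>" using f by blast
    have "amplify (b \<cdot> a) \<zeta> = amplify b f" by (simp add: amplify_compose a)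
    then show ?thesis using a bW comp_mem by (metis image_eqI)
  qed
  have act_K: "amplify b f \<in> K" if b: "b \<in> W" and f: "f \<in> K" for b f
  proof -
    obtain s where s: "\<And>n. s n \<in> ?S" "s \<longlonglongrightarrow> f" using f unfolding K_def closure_sequential by blast
    have "(\<lambda>n. amplify b (s n)) \<longlonglongrightarrow> amplify b f"
      by (rule bounded_linear.tendsto[OF blinfun.bounded_linear_right s(2)])
    moreover have "amplify b (s n) \<in> ?S" for n by (rule act_S[OF b s(1)])
    ultimately have "\<exists>t. (\<forall>n. t n \<in> ?S) \<and> t \<longlonglongrightarrow> amplify b f"
      by (intro exI[of _ "\<lambda>n. amplify b (s n)"] conjI allI)
    then show ?thesis unfolding K_def closure_sequential .
  qed
  have "amplify id_blinfun \<zeta> = \<zeta>" by (rule ell2_eqI) simp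
  then have "\<zeta> \<in> ?S" using id_mem by (metis image_eqI)
  then have \<zeta>K: "\<zeta> \<in> K" unfolding K_def by (rule closure_subset[THEN subsetD])
  have scaleC_amplify: "amplify (scalar_op c) f = c *\<^sub>C f" for c f
    by (intro ell2_eqI) (simp add: scaleC_ell2.rep_eq)
  have "closed K" by (simp add: K_def)
  moreover have scale_K: "c *\<^sub>C f \<in> K" if "f \<in> K" for c f
    using act_K[OF scalar_mem that, of c] by (simp add: scaleC_amplify)
  moreover have "0 \<in> K" using scale_K[OF \<zeta>K, of 0] by simp
  moreover have "f + g \<in> K" if fg: "f \<in> K" "g \<in> K" for f g
  proof -
    obtain s t where st: "\<And>n. s n \<in> ?S" "s \<longlonglongrightarrow> f" "\<And>n. t n \<in> ?S" "t \<longlonglongrightarrow> g"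
      using fg unfolding K_def closure_sequential by blast
    have "(\<lambda>n. s n + t n) \<longlonglongrightarrow> f + g" by (intro tendsto_add st)
    moreover have "s n + t n \<in> ?S" for n by (rule add_S[OF st(1,3)])
    ultimately have "\<exists>u. (\<forall>n. u n \<in> ?S) \<and> u \<longlonglongrightarrow> f + g"
      by (intro exI[of _ "\<lambda>n. s n + t n"] conjI allI)
    then show ?thesis unfolding K_def closure_sequential .
  qed
  ultimately obtain P where P: "P \<in> bounded_ops" "P \<cdot> P = P" "P\<star> = P" "\<And>f. P f \<in> K" "\<And>f. f \<in> K \<Longrightarrow> P f = f"
    using projection_theorem[of K] by metis
  have P_commutes: "amplify a \<cdot> P = P \<cdot> amplify a" if a: "a \<in> W" for a
  proof (rule projection_commutes[OF P(1,3) amplify_bounded_ops[OF ops[OF a]]])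
    show "P \<cdot> (amplify a \<cdot> P) = amplify a \<cdot> P"
      by (rule blinfun_eqI) (simp add: P(4,5) act_K a)
    show "P \<cdot> ((amplify a)\<star> \<cdot> P) = (amplify a)\<star> \<cdot> P"
      unfolding amplify_cadjoint[OF ops[OF a]] by (rule blinfun_eqI) (simp add: P(4,5) act_K a adj_mem)
  qed
  define p where "p i j = Blinfun (\<lambda>\<xi>. Rep_ell2 (P (ell2_single j \<xi>)) i)" for i j
  have p: "p i j \<xi> = Rep_ell2 (P (ell2_single j \<xi>)) i" for i j \<xi>
  proof -
    have "bounded_linear (\<lambda>\<xi>. Rep_ell2 (P (ell2_single j \<xi>)) i)"
      by (intro bounded_linear_compose[OF bounded_linear_component]
          bounded_linear_compose[OF blinfun.bounded_linear_right bounded_linear_ell2_single])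
    then show ?thesis by (simp add: p_def bounded_linear_Blinfun_apply)
  qed
  have "p i j \<in> commutant W" for i j
    unfolding commutant_def
  proof (intro CollectI conjI ballI)
    have "ell2_single j (c *\<^sub>C \<xi>) = c *\<^sub>C ell2_single j \<xi>" for c and \<xi> :: 'a
      using amplify_single[of "scalar_op c" j \<xi>] by (simp add: scaleC_amplify)
    then show "p i j \<in> bounded_ops"
      using P(1) by (auto simp: bounded_ops_def p scaleC_ell2.rep_eq)
    fix a assume "a \<in> W"
    from P_commutes[OF this] have "amplify a (P (ell2_single j \<xi>)) = P (amplify a (ell2_single j \<xi>))" for \<xi>
      by (metis blinfun_apply_blinfun_compose)
    then have "a (p i j \<xi>) = p i j (a \<xi>)" for \<xi>
      unfolding p amplify_single by (metis amplify_rep)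
    then show "a \<cdot> p i j = p i j \<cdot> a" by (intro blinfun_eqI) simp
  qed
  then have "p i j \<cdot> x = x \<cdot> p i j" for i j using x by (auto simp: commutant_def)
  then have px: "p i j (x \<xi>) = x (p i j \<xi>)" for i j \<xi> by (metis blinfun_apply_blinfun_compose)
  have single: "P (amplify x (ell2_single j \<xi>)) = amplify x (P (ell2_single j \<xi>))" for j \<xi>
    by (intro ell2_eqI) (simp add: amplify_single px flip: p)
  have "P (amplify x f) = amplify x (P f)" for f
  proof (rule LIMSEQ_unique)
    let ?s = "\<lambda>m. \<Sum>j<m. ell2_single j (Rep_ell2 f j)"
    show "(\<lambda>m. P (amplify x (?s m))) \<longlonglongrightarrow> P (amplify x f)"
      by (intro bounded_linear.tendsto[OF blinfun.bounded_linear_right] ell2_singles_tendsto)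
    have "P (amplify x (?s m)) = amplify x (P (?s m))" for m by (simp add: blinfun.sum_right single)
    then show "(\<lambda>m. P (amplify x (?s m))) \<longlonglongrightarrow> amplify x (P f)"
      using bounded_linear.tendsto[OF blinfun.bounded_linear_right
          bounded_linear.tendsto[OF blinfun.bounded_linear_right ell2_singles_tendsto[of f]], of "amplify x" P] by simp
  qed
  then have "P (amplify x \<zeta>) = amplify x \<zeta>" by (simp add: P(5)[OF \<zeta>K])
  then have "amplify x \<zeta> \<in> closure ?S" using P(4) unfolding K_def by metis
  then show ?thesis using e unfolding closure_approachable by (auto simp: dist_norm)
qed

section \<open>Normality\<close>

definition ultraweak_subbasis :: "('a::complex_hilbert_space \<Rightarrow>\<^sub>L 'a) set set"
  where "ultraweak_subbasis = {{A. (\<Sum>n. cinner (blinfun_apply A (\<xi> n)) (\<eta> n)) \<in> U} | \<xi> \<eta> U.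
      sq_summable \<xi> \<and> sq_summable \<eta> \<and> open U}"

lemma ultraweak_topology_alt: "ultraweak_topology = topology_generated_by ultraweak_subbasis"
  by (simp add: ultraweak_topology_def ultraweak_subbasis_def)

lemma ultraweak_subbasisI:
  "sq_summable \<xi> \<Longrightarrow> sq_summable \<eta> \<Longrightarrow> open U \<Longrightarrow>
    {A. (\<Sum>n. cinner (blinfun_apply A (\<xi> n)) (\<eta> n)) \<in> U} \<in> ultraweak_subbasis"
  unfolding ultraweak_subbasis_def by blast

lemma topspace_ultraweak: "topspace ultraweak_topology = UNIV"
proof -
  have "UNIV \<in> ultraweak_subbasis"
    using ultraweak_subbasisI[of "\<lambda>_. 0" "\<lambda>_. 0" UNIV] by simp
  then show ?thesis by (auto simp: ultraweak_topology_alt)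
qed

lemma bounded_linear_cinner: "bounded_linear (\<lambda>x. cinner x y)"
proof (rule bounded_linear_intro[where K = "norm y"])
  show "cinner (r *\<^sub>R x) y = r *\<^sub>R cinner x y" for r x
    by (metis cinner_scaleC_left scaleC_of_real scaleR_conv_of_real)
qed (simp_all add: cinner_add_left norm_cinner_le)

text \<open>
  The terms of the series are dominated by \<open>C \<parallel>\<xi>\<^sub>n\<parallel> \<parallel>\<eta>\<^sub>n\<parallel>\<close>, so that Tannery's theorem applies.
\<close>

lemma ultraweak_limit:
  assumes bd: "\<And>n x. norm (blinfun_apply (X n) x) \<le> C * norm x"
    and lim: "\<And>x. (\<lambda>n. blinfun_apply (X n) x) \<longlonglongrightarrow> blinfun_apply Y x"
    and U: "openin ultraweak_topology U" "Y \<in> U"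
  shows "eventually (\<lambda>n. X n \<in> U) sequentially"
proof -
  have "generate_topology_on ultraweak_subbasis U"
    using U(1) by (simp add: ultraweak_topology_alt openin_topology_generated_by_iff)
  then show ?thesis using U(2)
  proof induction
    case (Int a b)
    then show ?case by (simp add: eventually_conj)
  next
    case (UN K)
    then obtain k where "k \<in> K" "Y \<in> k" by blast
    with UN.IH have "eventually (\<lambda>n. X n \<in> k) sequentially" by blast
    then show ?case using \<open>k \<in> K\<close> by (auto elim: eventually_mono)
  next
    case (Basis s)
    then obtain \<xi> \<eta> V where s: "s = {A. (\<Sum>n. cinner (blinfun_apply A (\<xi> n)) (\<eta> n)) \<in> V}"
      and sum: "sq_summable \<xi>" "sq_summable \<eta>" and V: "open V" unfolding ultraweak_subbasis_def by blast
    have "((\<lambda>k. \<Sum>n. cinner (X k (\<xi> n)) (\<eta> n)) \<longlongrightarrow> (\<Sum>n. cinner (Y (\<xi> n)) (\<eta> n))) sequentially"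
    proof (rule tannerys_theorem[THEN conjunct2, THEN conjunct2])
      show "(\<lambda>k. cinner (X k (\<xi> n)) (\<eta> n)) \<longlonglongrightarrow> cinner (Y (\<xi> n)) (\<eta> n)" for n
        by (rule bounded_linear.tendsto[OF bounded_linear_cinner lim])
      have "norm (cinner (X k (\<xi> n)) (\<eta> n)) \<le> C * (norm (\<xi> n) * norm (\<eta> n))" for n k
        using norm_cinner_le[of "X k (\<xi> n)" "\<eta> n"] mult_right_mono[OF bd[of k "\<xi> n"], of "norm (\<eta> n)"]
        by (simp add: mult.assoc)
      then show "\<forall>\<^sub>F (n, k) in sequentially \<times>\<^sub>F sequentially.
          norm (cinner (X k (\<xi> n)) (\<eta> n)) \<le> C * (norm (\<xi> n) * norm (\<eta> n))"
        by (intro always_eventually) auto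
      show "summable (\<lambda>n. C * (norm (\<xi> n) * norm (\<eta> n)))"
        by (intro summable_mult sq_summable_product sum)
    qed simp
    then show ?case using topological_tendstoD[OF _ V] Basis.prems by (force simp: s)
  qed simp
qed

lemma state_algebra_normal_faithful_state:
  assumes M: "von_neumann_algebra M" and \<phi>: "normal_faithful_state M \<phi>"
  shows "state_algebra M \<phi>"
proof -
  interpret strong_algebra M using M by (rule strong_algebra_von_neumann)
  have state: "vn_state M \<phi>" and cont: "continuous_map (subtopology ultraweak_topology M) euclidean \<phi>"
    using \<phi> by (auto simp: normal_faithful_state_def)
  show ?thesis
  proof
    fix X and Y :: "'a \<Rightarrow>\<^sub>L 'a" and C :: real
    assume X: "\<And>n. X n \<in> M" "Y \<in> M" "\<And>n \<xi>. norm (blinfun_apply (X n) \<xi>) \<le> C * norm \<xi>"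
      "\<And>\<xi>. (\<lambda>n. blinfun_apply (X n) \<xi>) \<longlonglongrightarrow> blinfun_apply Y \<xi>"
    show "(\<lambda>n. \<phi> (X n)) \<longlonglongrightarrow> \<phi> Y"
    proof (rule topological_tendstoI)
      fix V assume V: "open V" "\<phi> Y \<in> V"
      have "openin (subtopology ultraweak_topology M) {A \<in> M. \<phi> A \<in> V}"
        using openin_continuous_map_preimage[OF cont, of V] V(1) by (simp add: topspace_ultraweak)
      then obtain U where U: "openin ultraweak_topology U" "{A \<in> M. \<phi> A \<in> V} = U \<inter> M"
        by (auto simp: openin_subtopology)
      have "eventually (\<lambda>n. X n \<in> U) sequentially"
        by (rule ultraweak_limit[OF X(3,4) U(1)]) (use U(2) V(2) X(2) in blast)
      then show "eventually (\<lambda>n. \<phi> (X n) \<in> V) sequentially"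
        by (rule eventually_mono) (use U(2) X(1) in blast)
    qed
  qed (use state \<phi> in \<open>auto simp: vn_state_def normal_faithful_state_def\<close>)
qed

lift_definition ell2_interleave :: "'a::complex_hilbert_space ell2 \<Rightarrow> 'a ell2 \<Rightarrow> 'a ell2" is
  "\<lambda>f g n. if even n then f (n div 2) else g ((n - 1) div 2)"
  subgoal for f g
    using sums_summable[OF sums_if[OF summable_sums summable_sums, of "\<lambda>n. (norm (g n))\<^sup>2" "\<lambda>n. (norm (f n))\<^sup>2"]]
    by (simp add: if_distrib[of "\<lambda>x. (norm x)\<^sup>2"] cong: if_cong)
  done

lemma norm_ell2_interleave: "(norm (ell2_interleave f g))\<^sup>2 = (norm f)\<^sup>2 + (norm g)\<^sup>2"
proof -
  have "(\<lambda>n. (norm (Rep_ell2 (ell2_interleave f g) n))\<^sup>2) sums ((norm g)\<^sup>2 + (norm f)\<^sup>2)"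
    unfolding norm_ell2_sq ell2_interleave.rep_eq if_distrib[of "\<lambda>x. (norm x)\<^sup>2"]
    using Rep_ell2[of f] Rep_ell2[of g] by (intro sums_if summable_sums) auto
  then show ?thesis unfolding norm_ell2_sq[of "ell2_interleave f g"] by (simp add: sums_iff)
qed

lemma ell2_interleave_diff:
  "ell2_interleave f g - ell2_interleave f' g' = ell2_interleave (f - f') (g - g')"
  by (rule ell2_eqI) (simp add: minus_ell2_rep ell2_interleave.rep_eq)

lemma amplify_interleave:
  "amplify A (ell2_interleave f g) = ell2_interleave (amplify A f) (amplify A g)"
  by (rule ell2_eqI) (simp add: ell2_interleave.rep_eq)

text \<open>
  Finitely many square-summable sequences can be merged into one by interleaving.
\<close>

lemma ultraweak_neighbourhood:
  assumes U: "openin ultraweak_topology U" "x \<in> U"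
  shows "\<exists>\<zeta>. \<exists>e>0. \<forall>b. norm (amplify b \<zeta> - amplify x \<zeta>) < e \<longrightarrow> b \<in> U"
proof -
  have "generate_topology_on ultraweak_subbasis U"
    using U(1) by (simp add: ultraweak_topology_alt openin_topology_generated_by_iff)
  then show ?thesis using U(2)
  proof induction
    case (Int a b)
    then obtain \<zeta>1 e1 \<zeta>2 e2 where
      1: "e1 > 0" "\<And>b. norm (amplify b \<zeta>1 - amplify x \<zeta>1) < e1 \<Longrightarrow> b \<in> a" and
      2: "e2 > 0" "\<And>c. norm (amplify c \<zeta>2 - amplify x \<zeta>2) < e2 \<Longrightarrow> c \<in> b" by blast
    let ?z = "ell2_interleave \<zeta>1 \<zeta>2"
    have "c \<in> a \<inter> b" if c: "norm (amplify c ?z - amplify x ?z) < min e1 e2" for c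
    proof -
      have eq: "(norm (amplify c ?z - amplify x ?z))\<^sup>2 =
          (norm (amplify c \<zeta>1 - amplify x \<zeta>1))\<^sup>2 + (norm (amplify c \<zeta>2 - amplify x \<zeta>2))\<^sup>2"
        by (simp add: amplify_interleave ell2_interleave_diff norm_ell2_interleave)
      have "norm (amplify c \<zeta>1 - amplify x \<zeta>1) \<le> norm (amplify c ?z - amplify x ?z)"
        "norm (amplify c \<zeta>2 - amplify x \<zeta>2) \<le> norm (amplify c ?z - amplify x ?z)"
        by (rule power2_le_imp_le; simp add: eq)+
      then show ?thesis using 1(2) 2(2) c by (metis IntI min_less_iff_conj order_le_less_trans)
    qed
    then show ?case using 1(1) 2(1) by (metis min_less_iff_conj)
  next
    case (UN K)
    then obtain k where k: "k \<in> K" "x \<in> k" by blast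
    then obtain \<zeta> e where "e > 0" "\<And>b. norm (amplify b \<zeta> - amplify x \<zeta>) < e \<Longrightarrow> b \<in> k" 
      using UN.IH[OF k] by blast
    then show ?case using k(1) by blast
  next
    case (Basis s)
    then obtain \<xi> \<eta> V where s: "s = {A. (\<Sum>n. cinner (blinfun_apply A (\<xi> n)) (\<eta> n)) \<in> V}"
      and sum: "sq_summable \<xi>" "sq_summable \<eta>" and V: "open V" unfolding ultraweak_subbasis_def by blast
    define f where "f = Abs_ell2 \<xi>"
    define g where "g = Abs_ell2 \<eta>"
    have f: "Rep_ell2 f = \<xi>" and g: "Rep_ell2 g = \<eta>" using sum by (simp_all add: f_def g_def Abs_ell2_inverse)
    have pairing: "(\<Sum>n. cinner (blinfun_apply A (\<xi> n)) (\<eta> n)) = cinner (amplify A f) g" for A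
      by (simp add: cinner_ell2.rep_eq f g)
    obtain r where r: "r > 0" "\<And>z. dist z (cinner (amplify x f) g) < r \<Longrightarrow> z \<in> V"
      using V Basis.prems unfolding open_dist s pairing by blast
    have "b \<in> s" if b: "norm (amplify b f - amplify x f) < r / (norm g + 1)" for b
    proof -
      have "cinner (amplify b f) g - cinner (amplify x f) g = cinner (amplify b f - amplify x f) g"
        using bounded_linear.linear[OF bounded_linear_cinner, THEN linear_diff] by metis
      then have "dist (cinner (amplify b f) g) (cinner (amplify x f) g) \<le> norm (amplify b f - amplify x f) * norm g"
        unfolding dist_norm using norm_cinner_le by metis
      also have "\<dots> \<le> norm (amplify b f - amplify x f) * (norm g + 1)" by (intro mult_left_mono) auto
      also have "\<dots> < r" using b by (simp add: pos_less_divide_eq add_nonneg_pos)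
      finally show ?thesis using r(2) unfolding s mem_Collect_eq pairing by blast
    qed
    moreover have "r / (norm g + 1) > 0" using r(1) by (simp add: add_nonneg_pos)
    ultimately show ?case by blast
  qed simp
qed

lemma (in strong_algebra) ultraweak_density:
  assumes "x \<in> commutant (commutant W)" "openin ultraweak_topology U" "x \<in> U"
  shows "\<exists>a\<in>W. a \<in> U"
proof -
  obtain \<zeta> e where e: "e > 0" "\<And>b. norm (amplify b \<zeta> - amplify x \<zeta>) < e \<Longrightarrow> b \<in> U"
    using ultraweak_neighbourhood[OF assms(2,3)] by metis
  obtain a where "a \<in> W" "norm (amplify a \<zeta> - amplify x \<zeta>) < e"
    using bicommutant_approximation[OF assms(1) e(1)] by metis
  then show ?thesis using e(2) by metis
qed

lemma (in strong_algebra) continuous_map_sandwich: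
  assumes a: "a \<in> W" and b: "b \<in> W"
  shows "continuous_map (subtopology ultraweak_topology W) (subtopology ultraweak_topology W) (\<lambda>x. a \<cdot> (x \<cdot> b))"
proof -
  have "continuous_map (subtopology ultraweak_topology W) (topology_generated_by ultraweak_subbasis) (\<lambda>x. a \<cdot> (x \<cdot> b))"
  proof (rule continuous_on_generated_topo)
    fix U assume "U \<in> (ultraweak_subbasis :: ('a \<Rightarrow>\<^sub>L 'a) set set)"
    then obtain \<xi> \<eta> V where U: "U = {A. (\<Sum>n. cinner (blinfun_apply A (\<xi> n)) (\<eta> n)) \<in> V}"
      and sum: "sq_summable \<xi>" "sq_summable \<eta>" and V: "open V" unfolding ultraweak_subbasis_def by blast
    let ?U = "{A. (\<Sum>n. cinner (blinfun_apply A (b (\<xi> n))) (a\<star> (\<eta> n))) \<in> V}"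
    have "?U \<in> ultraweak_subbasis"
      by (intro ultraweak_subbasisI V sq_summable_bounded[OF sum(1)] sq_summable_bounded[OF sum(2)])
        (rule norm_blinfun)+
    then have "openin ultraweak_topology ?U"
      unfolding ultraweak_topology_alt by (rule topology_generated_by_Basis)
    then have "openin (subtopology ultraweak_topology W) (W \<inter> ?U)" by (rule openin_subtopology_Int2)
    moreover have "(\<lambda>x. a \<cdot> (x \<cdot> b)) -` U \<inter> topspace (subtopology ultraweak_topology W) = W \<inter> ?U"
      by (auto simp: U topspace_ultraweak cinner_cadjoint[OF ops[OF a]])
    ultimately show "openin (subtopology ultraweak_topology W)
        ((\<lambda>x. a \<cdot> (x \<cdot> b)) -` U \<inter> topspace (subtopology ultraweak_topology W))"
      by (simp only:)
  next
    have "\<Union> (ultraweak_subbasis :: ('a \<Rightarrow>\<^sub>L 'a) set set) = UNIV"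
      using topspace_ultraweak unfolding ultraweak_topology_alt by simp
    then show "(\<lambda>x. a \<cdot> (x \<cdot> b)) ` topspace (subtopology ultraweak_topology W) \<subseteq> \<Union> ultraweak_subbasis" by simp
  qed
  then show ?thesis
    unfolding continuous_map_in_subtopology ultraweak_topology_alt[symmetric]
    using a b by (auto simp: topspace_ultraweak intro: comp_mem)
qed

text \<open>
  Two uses: states that split along a projection and its complement, and, with \<open>b = 0\<close>, states
  transported from a corner of the algebra.
\<close>

lemma normal_faithful_state_sandwich:
  assumes M: "von_neumann_algebra M" and \<phi>: "normal_faithful_state M \<phi>"
    and ab: "a \<in> M" "b \<in> M" and rs: "0 < r" "0 < s"
    and unit: "of_real r * \<phi> (a\<star> \<cdot> a) + of_real s * \<phi> (b\<star> \<cdot> b) = 1"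
    and faithful: "\<And>x. x \<in> M \<Longrightarrow> x \<cdot> a = 0 \<Longrightarrow> x \<cdot> b = 0 \<Longrightarrow> x = 0"
  shows "normal_faithful_state M (\<lambda>x. of_real r * \<phi> (a\<star> \<cdot> (x \<cdot> a)) + of_real s * \<phi> (b\<star> \<cdot> (x \<cdot> b)))"
    (is "normal_faithful_state M ?\<psi>")
proof -
  interpret state_algebra M \<phi> by (rule state_algebra_normal_faithful_state[OF M \<phi>])
  have cont: "continuous_map (subtopology ultraweak_topology M) euclidean \<phi>"
    using \<phi> by (simp add: normal_faithful_state_def)
  have sandwich: "a\<star> \<cdot> (x\<star> \<cdot> x \<cdot> a) = (x \<cdot> a)\<star> \<cdot> (x \<cdot> a)" if "x \<in> M" "a \<in> M" for x a
    using that by (simp add: adj_simps comp_assoc)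
  have pos: "\<phi> (a\<star> \<cdot> (x\<star> \<cdot> x \<cdot> a)) \<in> \<real>\<^sub>\<ge>\<^sub>0" if "x \<in> M" "a \<in> M" for x a
    using phi_pos[OF comp_mem[OF that]] sandwich[OF that] by simp
  have "vn_state M ?\<psi>"
    unfolding vn_state_def
  proof (intro conjI ballI allI)
    fix x y assume x: "x \<in> M" and y: "y \<in> M"
    show "?\<psi> (x + y) = ?\<psi> x + ?\<psi> y"
      using x y ab by (simp add: comp_distribs phi_add mem_intros algebra_simps)
  next
    fix c x assume x: "x \<in> M"
    have "a\<star> \<cdot> (scalar_op c \<cdot> x \<cdot> a) = scalar_op c \<cdot> (a\<star> \<cdot> (x \<cdot> a))" if "a \<in> M" for a
      using scalar_op_commute[OF ops[OF adj_mem[OF that]], of c] by (metis comp_assoc)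
    then show "?\<psi> (scalar_op c \<cdot> x) = c * ?\<psi> x"
      using x ab by (simp add: phi_scalar mem_intros algebra_simps)
  next
    fix x assume x: "x \<in> M"
    show "?\<psi> (x\<star> \<cdot> x) \<in> \<real>\<^sub>\<ge>\<^sub>0"
      using rs pos[OF x ab(1)] pos[OF x ab(2)]
      by (intro nonneg_Reals_add_I nonneg_Reals_mult_I) auto
  next
    show "?\<psi> id_blinfun = 1" using unit by simp
  qed
  moreover have "continuous_map (subtopology ultraweak_topology M) euclidean ?\<psi>"
  proof -
    have c: "continuous_map (subtopology ultraweak_topology M) euclidean (\<lambda>x. \<phi> (a\<star> \<cdot> (x \<cdot> a)))" if "a \<in> M" for a
      using continuous_map_compose[OF continuous_map_sandwich[OF adj_mem[OF that] that] cont] by (simp add: o_def)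
    have "continuous_map euclidean euclidean (\<lambda>z::complex. of_real t * z)" for t
      by (simp add: continuous_on_mult_left)
    from continuous_map_compose[OF c this]
    have c': "continuous_map (subtopology ultraweak_topology M) euclidean (\<lambda>x. of_real t * \<phi> (a\<star> \<cdot> (x \<cdot> a)))"
      if "a \<in> M" for a t using that by (simp add: o_def)
    show ?thesis by (intro continuous_map_add c' ab)
  qed
  moreover have "x = 0" if x: "x \<in> M" and 0: "?\<psi> (x\<star> \<cdot> x) = 0" for x
  proof -
    let ?A = "\<phi> (a\<star> \<cdot> (x\<star> \<cdot> x \<cdot> a))" and ?B = "\<phi> (b\<star> \<cdot> (x\<star> \<cdot> x \<cdot> b))"
    have nn: "0 \<le> Re ?A" "0 \<le> Re ?B" "Im ?A = 0" "Im ?B = 0"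
      using pos[OF x ab(1)] pos[OF x ab(2)] by (auto simp: complex_nonneg_Reals_iff)
    have "r * Re ?A + s * Re ?B = 0" using arg_cong[OF 0, of Re] by simp
    moreover have "0 \<le> r * Re ?A" "0 \<le> s * Re ?B" using rs nn by simp_all
    ultimately have "r * Re ?A = 0" "s * Re ?B = 0" by linarith+
    then have "?A = 0" "?B = 0" using rs nn by (auto simp: complex_eq_iff)
    then have "x \<cdot> a = 0" "x \<cdot> b = 0"
      using phi_faithful[OF comp_mem[OF x ab(1)]] phi_faithful[OF comp_mem[OF x ab(2)]]
        sandwich[OF x ab(1)] sandwich[OF x ab(2)] by simp_all
    then show ?thesis using faithful[OF x] by blast
  qed
  ultimately show ?thesis unfolding normal_faithful_state_def by blast
qed

section \<open>The centralizer of a state\<close>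

lemma (in state_algebra) strong_algebra_centralizer: "strong_algebra (centralizer M \<phi>)"
proof
  fix A B :: "'a \<Rightarrow>\<^sub>L 'a" and c
  show "A \<in> centralizer M \<phi> \<Longrightarrow> A \<in> bounded_ops" by (simp add: centralizer_def ops)
  show "scalar_op c \<in> centralizer M \<phi>"
    by (simp add: centralizer_def scalar_mem scalar_op_commute ops)
  assume A: "A \<in> centralizer M \<phi>"
  then have A': "A \<in> M" "\<And>y. y \<in> M \<Longrightarrow> \<phi> (A \<cdot> y) = \<phi> (y \<cdot> A)" by (auto simp: centralizer_def)
  show "A\<star> \<in> centralizer M \<phi>"
    unfolding centralizer_def
  proof (intro CollectI conjI ballI adj_mem A')
    fix y assume y: "y \<in> M"
    have "\<phi> (A\<star> \<cdot> y) = cnj (\<phi> (y\<star> \<cdot> A))"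
      using phi_adj[of "y\<star> \<cdot> A"] y A' by (simp add: adj_simps mem_intros)
    also have "\<dots> = cnj (\<phi> (A \<cdot> y\<star>))" using A'(2)[OF adj_mem[OF y]] by simp
    also have "\<dots> = \<phi> (y \<cdot> A\<star>)"
      using phi_adj[of "A \<cdot> y\<star>"] y A' by (simp add: adj_simps mem_intros)
    finally show "\<phi> (A\<star> \<cdot> y) = \<phi> (y \<cdot> A\<star>)" .
  qed
  assume B: "B \<in> centralizer M \<phi>"
  then have B': "B \<in> M" "\<And>y. y \<in> M \<Longrightarrow> \<phi> (B \<cdot> y) = \<phi> (y \<cdot> B)" by (auto simp: centralizer_def)
  show "A + B \<in> centralizer M \<phi>"
    using A' B' by (simp add: centralizer_def mem_intros comp_distribs phi_add)
  show "A \<cdot> B \<in> centralizer M \<phi>"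
    unfolding centralizer_def
  proof (intro CollectI conjI ballI comp_mem A' B')
    fix y assume y: "y \<in> M"
    show "\<phi> (A \<cdot> B \<cdot> y) = \<phi> (y \<cdot> (A \<cdot> B))"
      using A'(2)[of "B \<cdot> y"] B'(2)[of "y \<cdot> A"] y A'(1) B'(1) by (simp add: comp_assoc mem_intros)
  qed
next
  fix X and Y :: "'a \<Rightarrow>\<^sub>L 'a" and C :: real
  assume X: "\<And>n. X n \<in> centralizer M \<phi>" and bd: "\<And>n \<xi>. norm (blinfun_apply (X n) \<xi>) \<le> C * norm \<xi>"
    and lim: "\<And>\<xi>. (\<lambda>n. blinfun_apply (X n) \<xi>) \<longlonglongrightarrow> blinfun_apply Y \<xi>"
  have X': "X n \<in> M" "\<And>y. y \<in> M \<Longrightarrow> \<phi> (X n \<cdot> y) = \<phi> (y \<cdot> X n)" for n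
    using X by (auto simp: centralizer_def)
  have Y: "Y \<in> M" by (rule lim_mem[OF X'(1) bd lim])
  have bd': "norm (X n \<xi>) \<le> \<bar>C\<bar> * norm \<xi>" for n \<xi>
    using bd[of n \<xi>] mult_right_mono[OF abs_ge_self[of C] norm_ge_zero[of \<xi>]] by linarith
  have "\<phi> (Y \<cdot> y) = \<phi> (y \<cdot> Y)" if y: "y \<in> M" for y
  proof (rule LIMSEQ_unique)
    show "(\<lambda>n. \<phi> (X n \<cdot> y)) \<longlonglongrightarrow> \<phi> (Y \<cdot> y)"
    proof (rule phi_normal[where C = "\<bar>C\<bar> * norm y"])
      show "norm ((X n \<cdot> y) \<xi>) \<le> \<bar>C\<bar> * norm y * norm \<xi>" for n \<xi>
        using bd'[of n "y \<xi>"] mult_left_mono[OF norm_blinfun[of y \<xi>], of "\<bar>C\<bar>"] by (simp add: mult.assoc)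
    qed (use X'(1) Y y lim in \<open>auto intro: comp_mem\<close>)
    have "(\<lambda>n. \<phi> (y \<cdot> X n)) \<longlonglongrightarrow> \<phi> (y \<cdot> Y)"
    proof (rule phi_normal[where C = "norm y * \<bar>C\<bar>"])
      show "norm ((y \<cdot> X n) \<xi>) \<le> norm y * \<bar>C\<bar> * norm \<xi>" for n \<xi>
        using norm_blinfun[of y "X n \<xi>"] mult_left_mono[OF bd'[of n \<xi>], of "norm y"] by (simp add: mult.assoc)
      show "(\<lambda>n. (y \<cdot> X n) \<xi>) \<longlonglongrightarrow> (y \<cdot> Y) \<xi>" for \<xi>
        using bounded_linear.tendsto[OF blinfun.bounded_linear_right lim, of y] by simp
    qed (use X'(1) Y y in \<open>auto intro: comp_mem\<close>)
    then show "(\<lambda>n. \<phi> (X n \<cdot> y)) \<longlonglongrightarrow> \<phi> (y \<cdot> Y)" by (simp only: X'(2)[OF y])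
  qed
  then show "Y \<in> centralizer M \<phi>" using Y by (simp add: centralizer_def)
qed

text \<open>
  The condition \<open>\<phi> (x y) = \<phi> (y x)\<close> is ultraweakly closed in \<open>x\<close>, and the centralizer is ultraweakly
  dense in its double commutant.
\<close>

lemma von_neumann_algebra_centralizer:
  assumes M: "von_neumann_algebra M" and \<phi>: "normal_faithful_state M \<phi>"
  shows "von_neumann_algebra (centralizer M \<phi>)"
proof -
  interpret state_algebra M \<phi> by (rule state_algebra_normal_faithful_state[OF M \<phi>])
  let ?N = "centralizer M \<phi>"
  interpret N: strong_algebra ?N by (rule strong_algebra_centralizer)
  have cont: "continuous_map (subtopology ultraweak_topology M) euclidean \<phi>"
    using \<phi> by (simp add: normal_faithful_state_def)
  have sub: "?N \<subseteq> M" by (auto simp: centralizer_def)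
  have "x \<in> ?N" if x: "x \<in> commutant (commutant ?N)" for x
  proof -
    have "commutant (commutant ?N) \<subseteq> commutant (commutant M)"
      using sub by (auto simp: commutant_def)
    then have xM: "x \<in> M" using x M by (auto simp: von_neumann_algebra_def)
    have "\<phi> (x \<cdot> y) = \<phi> (y \<cdot> x)" if y: "y \<in> M" for y
    proof (rule ccontr)
      assume ne: "\<phi> (x \<cdot> y) \<noteq> \<phi> (y \<cdot> x)"
      let ?F = "\<lambda>b. \<phi> (b \<cdot> y) - \<phi> (y \<cdot> b)"
      have "continuous_map (subtopology ultraweak_topology M) euclidean (\<lambda>b. \<phi> (b \<cdot> y))"
        using continuous_map_compose[OF continuous_map_sandwich[OF id_mem y] cont] by (simp add: o_def)
      moreover have "continuous_map (subtopology ultraweak_topology M) euclidean (\<lambda>b. \<phi> (y \<cdot> b))"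
        using continuous_map_compose[OF continuous_map_sandwich[OF y id_mem] cont] by (simp add: o_def)
      ultimately have "continuous_map (subtopology ultraweak_topology M) euclidean ?F"
        by (rule continuous_map_diff)
      from openin_continuous_map_preimage[OF this, of "- {0}"]
      have "openin (subtopology ultraweak_topology M) {b \<in> M. ?F b \<in> - {0}}"
        by (simp add: topspace_ultraweak open_Compl)
      then obtain U where U: "openin ultraweak_topology U" "{b \<in> M. ?F b \<in> - {0}} = U \<inter> M"
        by (auto simp: openin_subtopology)
      have "x \<in> U" using U(2) xM ne by auto
      then obtain a where a: "a \<in> ?N" "a \<in> U" using N.ultraweak_density[OF x U(1)] by blast
      then have "?F a \<in> - {0}" using U(2) sub by blast
      then show False using a(1) y by (auto simp: centralizer_def)
    qed
    then show ?thesis using xM by (simp add: centralizer_def)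
  qed
  moreover have "?N \<subseteq> commutant (commutant ?N)"
    using N.ops by (auto simp: commutant_def)
  ultimately show ?thesis
    unfolding von_neumann_algebra_def by (auto intro: N.ops N.adj_mem)
qed

section \<open>Strictly homogeneous factors\<close>

locale homogeneous_factor =
  fixes M :: "('a::complex_hilbert_space \<Rightarrow>\<^sub>L 'a) set" and \<phi> :: "('a \<Rightarrow>\<^sub>L 'a) \<Rightarrow> complex"
  assumes factor: "factor M" and not_complex: "\<not> isomorphic_to_complex M"
    and homogeneous: "strictly_homogeneous_state_space M" and nfs: "normal_faithful_state M \<phi>"
begin

lemma von_neumann: "von_neumann_algebra M" using factor by (simp add: factor_def)

sublocale prime_state_algebra M \<phi>
proof -
  interpret state_algebra M \<phi> by (rule state_algebra_normal_faithful_state[OF von_neumann nfs])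
  show "prime_state_algebra M \<phi>" by unfold_locales (rule factor_prime[OF factor])
qed

abbreviation N :: "('a \<Rightarrow>\<^sub>L 'a) set" where "N \<equiv> centralizer M \<phi>"

lemma N_sub: "N \<subseteq> M" by (auto simp: centralizer_def)

lemma N_trace: "x \<in> N \<Longrightarrow> y \<in> M \<Longrightarrow> \<phi> (x \<cdot> y) = \<phi> (y \<cdot> x)" by (simp add: centralizer_def)

sublocale N: trace_algebra N \<phi>
proof -
  interpret N: state_algebra N \<phi>
    by (rule state_algebra_subalgebra[OF state_algebra_axioms strong_algebra_centralizer N_sub])
  show "trace_algebra N \<phi>" by unfold_locales (use N_trace N_sub in blast)
qed

lemma projections_N: "p \<in> projections N \<Longrightarrow> p \<in> projections M"
  using N_sub by (auto simp: projections_def)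

lemma homogeneity:
  assumes "normal_faithful_state M \<omega>" "normal_faithful_state M \<psi>"
  obtains u where "u \<in> M" "u\<star> \<cdot> u = id_blinfun" "u \<cdot> u\<star> = id_blinfun"
    "\<And>x. x \<in> M \<Longrightarrow> \<omega> (u\<star> \<cdot> (x \<cdot> u)) = \<psi> x"
  using homogeneous assms unfolding strictly_homogeneous_state_space_def unitaries_def
  by (auto simp: comp_assoc) blast

text \<open>
  If every element of \<open>M\<close> were scalar, \<open>\<phi>\<close> would be an isomorphism onto \<open>\<complex>\<close>.
\<close>

lemma proper_projection: obtains s where "s \<in> projections M" "s \<noteq> 0" "s \<noteq> id_blinfun"
proof -
  have "\<exists>x\<in>M. x \<notin> range scalar_op"
  proof (rule ccontr)
    assume "\<not> ?thesis"
    then have M: "M = range scalar_op" using scalar_mem by blast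
    have "bij_betw \<phi> M UNIV"
      unfolding bij_betw_def M by (auto simp: inj_on_def phi_scalar_op image_image)
    moreover have "\<phi> (x \<cdot> y) = \<phi> x * \<phi> y" if "x \<in> M" "y \<in> M" for x y
      using that unfolding M by (auto simp: scalar_op_compose phi_scalar_op)
    ultimately have "isomorphic_to_complex M"
      unfolding isomorphic_to_complex_def using phi_add phi_scalar phi_adj by (intro exI[of _ \<phi>]) auto
    then show False using not_complex by simp
  qed
  then show thesis using nontrivial_projection that by metis
qed

text \<open>
  The state that gives \<open>s\<close> the weight \<open>t\<close> and is a multiple of \<open>\<phi>\<close> on the corners of \<open>s\<close> and
  \<open>1 - s\<close> has \<open>s\<close> in its centralizer. By homogeneity it is conjugate to any given \<open>\<omega>\<close>, and so a
  unitary conjugate of \<open>s\<close> lies in the centralizer of \<open>\<omega>\<close> with weight \<open>t\<close>.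
\<close>

lemma conjugate_in_centralizer:
  assumes \<omega>: "normal_faithful_state M \<omega>" and s: "s \<in> projections M" "s \<noteq> 0" "s \<noteq> id_blinfun"
    and t: "0 < t" "t < 1"
  obtains u where "u \<in> M" "u\<star> \<cdot> u = id_blinfun" "u \<cdot> u\<star> = id_blinfun"
    "u\<star> \<cdot> (s \<cdot> u) \<in> projections M" "\<omega> (u\<star> \<cdot> (s \<cdot> u)) = complex_of_real t"
    "\<And>y. y \<in> M \<Longrightarrow> \<omega> ((u\<star> \<cdot> (s \<cdot> u)) \<cdot> y) = \<omega> (y \<cdot> (u\<star> \<cdot> (s \<cdot> u)))"
proof -
  note s' = projD[OF s(1)]
  define c where "c = id_blinfun - s"
  have cP: "c \<in> projections M" unfolding c_def by (rule proj_compl[OF s(1)])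
  note c' = projD[OF cP]
  have c0: "c \<noteq> 0" using s(3) by (simp add: c_def)
  have sc: "s \<cdot> c = 0" "c \<cdot> s = 0" by (simp_all add: c_def comp_distribs s')
  have pos: "0 < Re (\<phi> s)" "0 < Re (\<phi> c)" using phi_proj_pos s cP c0 by auto
  define \<psi> where "\<psi> x = of_real (t / Re (\<phi> s)) * \<phi> (s\<star> \<cdot> (x \<cdot> s)) +
    of_real ((1 - t) / Re (\<phi> c)) * \<phi> (c\<star> \<cdot> (x \<cdot> c))" for x
  have weight: "complex_of_real (t / Re (\<phi> s)) * \<phi> s = of_real t"
    "complex_of_real ((1 - t) / Re (\<phi> c)) * \<phi> c = of_real (1 - t)"
    using pos phi_proj(1)[OF s(1)] phi_proj(1)[OF cP]
    by (metis (no_types) less_irrefl nonzero_eq_divide_eq of_real_mult)+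
  have "normal_faithful_state M \<psi>"
    unfolding \<psi>_def
  proof (rule normal_faithful_state_sandwich[OF von_neumann nfs s'(1) c'(1)])
    show "0 < t / Re (\<phi> s)" "0 < (1 - t) / Re (\<phi> c)" using pos t by simp_all
    show "of_real (t / Re (\<phi> s)) * \<phi> (s\<star> \<cdot> s) + of_real ((1 - t) / Re (\<phi> c)) * \<phi> (c\<star> \<cdot> c) = 1"
      by (simp only: s' c' weight) simp
    show "x = 0" if "x \<cdot> s = 0" "x \<cdot> c = 0" for x
      using that by (simp add: c_def comp_distribs)
  qed
  from homogeneity[OF \<omega> this] obtain u where u: "u \<in> M" "u\<star> \<cdot> u = id_blinfun" "u \<cdot> u\<star> = id_blinfun"
    and conj: "\<And>x. x \<in> M \<Longrightarrow> \<omega> (u\<star> \<cdot> (x \<cdot> u)) = \<psi> x" by metis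
  have uu: "u\<star> \<cdot> (u \<cdot> z) = z" "u \<cdot> (u\<star> \<cdot> z) = z" for z :: "'a \<Rightarrow>\<^sub>L 'a"
    using comp_reduce[OF u(2), of z] comp_reduce[OF u(3), of z] by simp_all
  show thesis
  proof (rule that[OF u])
    show "u\<star> \<cdot> (s \<cdot> u) \<in> projections M"
      by (rule projI) (simp_all add: mem_intros adj_simps u(1) s' comp_assoc uu)
    show "\<omega> (u\<star> \<cdot> (s \<cdot> u)) = complex_of_real t"
      unfolding conj[OF s'(1)] \<psi>_def by (simp only: s' c' sc comp_zero phi_zero weight) simp
    fix y assume y: "y \<in> M"
    let ?y = "u \<cdot> (y \<cdot> u\<star>)"
    have yM: "?y \<in> M" by (intro mem_intros u y)
    have "\<omega> ((u\<star> \<cdot> (s \<cdot> u)) \<cdot> y) = \<omega> (u\<star> \<cdot> ((s \<cdot> ?y) \<cdot> u))" by (simp add: comp_assoc u(2))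
    also have "\<dots> = \<psi> (s \<cdot> ?y)" by (rule conj) (intro mem_intros s' yM)
    also have "\<dots> = \<psi> (?y \<cdot> s)" 
      unfolding \<psi>_def c'(2) s'(2) comp_assoc by (simp add: s' sc comp_reduce[OF sc(2)])
    also have "\<dots> = \<omega> (u\<star> \<cdot> ((?y \<cdot> s) \<cdot> u))" by (rule conj[symmetric]) (intro mem_intros s' yM)
    also have "\<dots> = \<omega> (y \<cdot> (u\<star> \<cdot> (s \<cdot> u)))" by (simp add: comp_assoc uu)
    finally show "\<omega> ((u\<star> \<cdot> (s \<cdot> u)) \<cdot> y) = \<omega> (y \<cdot> (u\<star> \<cdot> (s \<cdot> u)))" .
  qed
qed

text \<open>
  The centralizer contains conjugates of \<open>e\<close> of traces \<open>1 - 2\<^sup>-\<^sup>n\<^sup>-\<^sup>1\<close>, whose infima increase to \<open>1\<close>. So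
  \<open>1\<close> is a limit of projections equivalent to subprojections of \<open>e\<close>, and \<open>M\<close> is of type III.
\<close>

lemma equivalent_to_one:
  assumes e: "e \<in> projections M" "e \<noteq> 0"
  obtains v where "v \<in> M" "v\<star> \<cdot> v = id_blinfun" "v \<cdot> v\<star> = e"
proof (cases "e = id_blinfun")
  case True
  then show thesis using that[of id_blinfun] by (simp add: id_mem)
next
  case False
  have "\<exists>u. u \<in> M \<and> u\<star> \<cdot> u = id_blinfun \<and> u \<cdot> u\<star> = id_blinfun \<and> u\<star> \<cdot> (e \<cdot> u) \<in> projections N \<and>
      \<phi> (u\<star> \<cdot> (e \<cdot> u)) = complex_of_real (1 - (1/2)^Suc n)" for n :: nat
  proof -
    have "(1/2::real)^Suc n < 1" by (rule power_Suc_less_one) auto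
    then obtain u where u: "u \<in> M" "u\<star> \<cdot> u = id_blinfun" "u \<cdot> u\<star> = id_blinfun"
      "u\<star> \<cdot> (e \<cdot> u) \<in> projections M" "\<phi> (u\<star> \<cdot> (e \<cdot> u)) = complex_of_real (1 - (1/2)^Suc n)"
      "\<And>y. y \<in> M \<Longrightarrow> \<phi> ((u\<star> \<cdot> (e \<cdot> u)) \<cdot> y) = \<phi> (y \<cdot> (u\<star> \<cdot> (e \<cdot> u)))"
      using conjugate_in_centralizer[OF nfs e False, of "1 - (1/2)^Suc n"] by auto
    then have "u\<star> \<cdot> (e \<cdot> u) \<in> projections N" by (simp add: projections_def centralizer_def)
    then show ?thesis using u by blast
  qed
  then obtain u where u: "\<And>n. u n \<in> M" "\<And>n. (u n)\<star> \<cdot> u n = id_blinfun" "\<And>n. u n \<cdot> (u n)\<star> = id_blinfun"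
    "\<And>n. (u n)\<star> \<cdot> (e \<cdot> u n) \<in> projections N"
    "\<And>n. \<phi> ((u n)\<star> \<cdot> (e \<cdot> u n)) = complex_of_real (1 - (1/2)^Suc n)" by metis
  obtain g where g: "\<And>n. g n \<in> projections N" "\<And>n. g (Suc n) \<cdot> g n = g n"
    "\<And>n. ((u n)\<star> \<cdot> (e \<cdot> u n)) \<cdot> g n = g n" "\<And>\<xi>. (\<lambda>n. g n \<xi>) \<longlonglongrightarrow> \<xi>"
    using N.increasing_infima[of "\<lambda>n. (u n)\<star> \<cdot> (e \<cdot> u n)", OF u(4)] unfolding u(5) by auto
  have uu: "(u n)\<star> \<cdot> (u n \<cdot> z) = z" "u n \<cdot> ((u n)\<star> \<cdot> z) = z" for n and z :: "'a \<Rightarrow>\<^sub>L 'a"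
    using comp_reduce[OF u(2), of n z] comp_reduce[OF u(3), of n z] by simp_all
  note gM = projections_N[OF g(1)]
  note g' = projD[OF gM]
  have x1: "u n \<cdot> g n \<in> M" for n by (intro mem_intros u g')
  have x2: "(u n \<cdot> g n)\<star> \<cdot> (u n \<cdot> g n) = g n" for n
    by (simp add: adj_simps u(1) g' comp_assoc uu)
  have x3: "e \<cdot> (u n \<cdot> g n) = u n \<cdot> g n" for n
    using arg_cong[OF g(3), of "\<lambda>z. u n \<cdot> z" n] by (simp only: comp_assoc uu)
  obtain w where "w \<in> M" "w\<star> \<cdot> w = id_blinfun" "e \<cdot> w = w"
    using one_le_limit[of e g "\<lambda>n. u n \<cdot> g n", OF e(1) gM g(2,4) x1 x2 x3] by metis
  then show thesis using isometry_onto[OF e(1)] that by metis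
qed

text \<open>
  Since \<open>p M p\<close> is isomorphic to \<open>M\<close>, the state transported from the corner of \<open>p\<close> is again a normal
  faithful state on \<open>M\<close>.
\<close>

lemma corner_state:
  assumes p: "p \<in> projections M" "p \<noteq> 0" and w: "w \<in> M" "w\<star> \<cdot> w = id_blinfun" "w \<cdot> w\<star> = p"
  shows "normal_faithful_state M (\<lambda>x. of_real (1 / Re (\<phi> p)) * \<phi> (w \<cdot> (x \<cdot> w\<star>)))"
proof -
  have pos: "0 < Re (\<phi> p)" by (rule phi_proj_pos[OF p])
  have "normal_faithful_state M (\<lambda>x. of_real (1 / Re (\<phi> p)) * \<phi> (w\<star>\<star> \<cdot> (x \<cdot> w\<star>)) +
      of_real 1 * \<phi> (0\<star> \<cdot> (x \<cdot> 0)))"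
  proof (rule normal_faithful_state_sandwich[OF von_neumann nfs adj_mem[OF w(1)] zero_mem])
    show "of_real (1 / Re (\<phi> p)) * \<phi> (w\<star>\<star> \<cdot> w\<star>) + of_real 1 * \<phi> (0\<star> \<cdot> 0) = 1"
      unfolding cadjoint_cadjoint[OF ops[OF w(1)]] w(3)
      using pos by (subst phi_proj(1)[OF p(1)]) (simp add: phi_zero flip: of_real_mult)
    show "x = 0" if "x \<cdot> w\<star> = 0" for x
      using that w(2) by (metis comp_assoc comp_id(1) comp_zero(2))
  qed (use pos in simp_all)
  then show ?thesis by (simp add: cadjoint_cadjoint[OF ops[OF w(1)]] phi_zero)
qed

text \<open>
  Both corner states, of \<open>p\<close> and of \<open>q\<close>, live on \<open>M\<close>. A unitary \<open>u\<close> that conjugates one into the other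
  yields \<open>v = b u a\<^sup>*\<close>, where \<open>a\<close> and \<open>b\<close> are isometries onto \<open>p\<close> and \<open>q\<close>. By construction \<open>v\<close> carries
  the restriction of \<open>\<phi>\<close> to \<open>p M p\<close> into its restriction to \<open>q M q\<close> without a scalar factor, because the traces
  agree, and this places \<open>v\<close> in the centralizer.
\<close>

lemma equal_trace_equivalent:
  assumes p: "p \<in> projections N" and q: "q \<in> projections N" and nz: "p \<noteq> 0" "q \<noteq> 0"
    and eq: "\<phi> p = \<phi> q"
  obtains v where "v \<in> N" "v\<star> \<cdot> v = p" "v \<cdot> v\<star> = q"
proof -
  note pM = projections_N[OF p] and qM = projections_N[OF q]
  note q' = projD[OF qM]
  have pN: "p \<in> N" and qN: "q \<in> N" using p q by (auto simp: projections_def)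
  obtain a where a: "a \<in> M" "a\<star> \<cdot> a = id_blinfun" "a \<cdot> a\<star> = p"
    using equivalent_to_one[OF pM nz(1)] by metis
  obtain b where b: "b \<in> M" "b\<star> \<cdot> b = id_blinfun" "b \<cdot> b\<star> = q"
    using equivalent_to_one[OF qM nz(2)] by metis
  have pos: "0 < Re (\<phi> p)" by (rule phi_proj_pos[OF pM nz(1)])
  obtain u where u: "u \<in> M" "u\<star> \<cdot> u = id_blinfun" "u \<cdot> u\<star> = id_blinfun"
    and conj: "\<And>x. x \<in> M \<Longrightarrow> of_real (1 / Re (\<phi> p)) * \<phi> (a \<cdot> ((u\<star> \<cdot> (x \<cdot> u)) \<cdot> a\<star>)) =
      of_real (1 / Re (\<phi> q)) * \<phi> (b \<cdot> (x \<cdot> b\<star>))"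
    using homogeneity[OF corner_state[OF pM nz(1) a] corner_state[OF qM nz(2) b]] by metis
  have conj': "\<phi> (a \<cdot> ((u\<star> \<cdot> (x \<cdot> u)) \<cdot> a\<star>)) = \<phi> (b \<cdot> (x \<cdot> b\<star>))" if "x \<in> M" for x
    using conj[OF that] pos by (simp add: eq)
  define v where "v = b \<cdot> (u \<cdot> a\<star>)"
  have vM: "v \<in> M" unfolding v_def by (intro mem_intros a b u)
  have v_adj: "v\<star> = a \<cdot> (u\<star> \<cdot> b\<star>)" using a b u by (simp add: v_def adj_simps mem_intros comp_assoc)
  have red: "a\<star> \<cdot> (a \<cdot> z) = z" "b\<star> \<cdot> (b \<cdot> z) = z" "u\<star> \<cdot> (u \<cdot> z) = z" "u \<cdot> (u\<star> \<cdot> z) = z"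
    for z :: "'a \<Rightarrow>\<^sub>L 'a"
    using comp_reduce[OF a(2), of z] comp_reduce[OF b(2), of z] comp_reduce[OF u(2), of z]
      comp_reduce[OF u(3), of z] by simp_all
  have vv: "v\<star> \<cdot> v = p" by (simp add: v_adj) (simp add: v_def comp_assoc red a(3))
  have vv': "v \<cdot> v\<star> = q" by (simp add: v_adj) (simp add: v_def comp_assoc red b(3))
  have v_conj: "\<phi> (v\<star> \<cdot> (y \<cdot> v)) = \<phi> (q \<cdot> y)" if y: "y \<in> M" for y
  proof -
    have "\<phi> (v\<star> \<cdot> (y \<cdot> v)) = \<phi> (a \<cdot> ((u\<star> \<cdot> ((b\<star> \<cdot> (y \<cdot> b)) \<cdot> u)) \<cdot> a\<star>))"
      by (simp add: v_adj) (simp add: v_def comp_assoc)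
    also have "\<dots> = \<phi> (b \<cdot> ((b\<star> \<cdot> (y \<cdot> b)) \<cdot> b\<star>))" by (rule conj') (intro mem_intros b y)
    also have "\<dots> = \<phi> (q \<cdot> (y \<cdot> q))" by (simp add: comp_assoc flip: b(3))
    also have "\<dots> = \<phi> ((y \<cdot> q) \<cdot> q)" by (rule N_trace[OF qN]) (intro mem_intros y q')
    also have "\<dots> = \<phi> (q \<cdot> y)" using N_trace[OF qN y] by (simp add: comp_assoc q')
    finally show ?thesis .
  qed
  have vP: "v \<in> pisoms M" by (rule pisomI_proj[OF vM vv pM])
  have vp: "v \<cdot> p = v" using pisomD(2)[OF vP] by (simp only: vv)
  have qv: "q \<cdot> v = v" using pisomD(2)[OF vP] by (simp only: vv'[symmetric] comp_assoc)
  have "v \<in> N"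
    unfolding centralizer_def
  proof (intro CollectI conjI ballI vM)
    fix y assume y: "y \<in> M"
    have "\<phi> (v \<cdot> y) = \<phi> (q \<cdot> (v \<cdot> y))" by (simp add: comp_reduce[OF qv])
    also have "\<dots> = \<phi> (v\<star> \<cdot> ((v \<cdot> y) \<cdot> v))" by (rule v_conj[symmetric]) (intro mem_intros vM y)
    also have "\<dots> = \<phi> (p \<cdot> (y \<cdot> v))" by (simp add: comp_assoc comp_reduce[OF vv])
    also have "\<dots> = \<phi> ((y \<cdot> v) \<cdot> p)" by (rule N_trace[OF pN]) (intro mem_intros vM y)
    finally show "\<phi> (v \<cdot> y) = \<phi> (y \<cdot> v)" by (simp add: comp_assoc vp)
  qed
  then show thesis using that vv vv' by blast
qed

text \<open>
  In the centralizer of the corner state of \<open>p\<close> there is a projection of weight \<open>t\<close>; transport it back.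
\<close>

lemma subprojection_of_trace:
  assumes p: "p \<in> projections N" "p \<noteq> 0" and t: "0 < t" "t < 1"
  obtains e where "e \<in> projections N" "p \<cdot> e = e" "\<phi> e = of_real (t * Re (\<phi> p))"
proof -
  note pM = projections_N[OF p(1)]
  have pN: "p \<in> N" using p by (auto simp: projections_def)
  obtain w where w: "w \<in> M" "w\<star> \<cdot> w = id_blinfun" "w \<cdot> w\<star> = p"
    using equivalent_to_one[OF pM p(2)] by metis
  let ?\<omega> = "\<lambda>x. of_real (1 / Re (\<phi> p)) * \<phi> (w \<cdot> (x \<cdot> w\<star>))"
  have pos: "0 < Re (\<phi> p)" by (rule phi_proj_pos[OF pM p(2)])
  obtain s where s: "s \<in> projections M" "s \<noteq> 0" "s \<noteq> id_blinfun" by (rule proper_projection)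
  obtain f where f: "f \<in> projections M" "?\<omega> f = complex_of_real t"
    and comm: "\<And>y. y \<in> M \<Longrightarrow> ?\<omega> (f \<cdot> y) = ?\<omega> (y \<cdot> f)"
    using conjugate_in_centralizer[OF corner_state[OF pM p(2) w] s t] by metis
  note f' = projD[OF f(1)]
  have comm': "\<phi> (w \<cdot> ((f \<cdot> y) \<cdot> w\<star>)) = \<phi> (w \<cdot> ((y \<cdot> f) \<cdot> w\<star>))" if "y \<in> M" for y
    using comm[OF that] pos by simp
  have ww: "w\<star> \<cdot> (w \<cdot> z) = z" for z :: "'a \<Rightarrow>\<^sub>L 'a" using comp_reduce[OF w(2), of z] by simp
  have pw: "p \<cdot> (w \<cdot> z) = w \<cdot> z" for z :: "'a \<Rightarrow>\<^sub>L 'a" by (simp add: comp_assoc ww flip: w(3))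
  let ?e = "w \<cdot> (f \<cdot> w\<star>)"
  have wp: "w\<star> \<cdot> p = w\<star>" by (simp add: ww flip: w(3))
  have eM: "?e \<in> projections M"
    by (rule projI) (simp_all add: mem_intros adj_simps w(1) f' comp_assoc ww)
  have "?e \<in> N"
    unfolding centralizer_def
  proof (intro CollectI conjI ballI projD(1)[OF eM])
    fix y assume y: "y \<in> M"
    let ?y = "w\<star> \<cdot> (y \<cdot> w)"
    have yM: "?y \<in> M" by (intro mem_intros w y)
    have "\<phi> (?e \<cdot> y) = \<phi> (p \<cdot> (?e \<cdot> y))" by (simp add: comp_assoc pw)
    also have "\<dots> = \<phi> ((?e \<cdot> y) \<cdot> p)" by (rule N_trace[OF pN]) (intro mem_intros projD(1)[OF eM] y)
    also have "\<dots> = \<phi> (w \<cdot> ((f \<cdot> ?y) \<cdot> w\<star>))" by (simp add: comp_assoc flip: w(3))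
    also have "\<dots> = \<phi> (w \<cdot> ((?y \<cdot> f) \<cdot> w\<star>))" by (rule comm'[OF yM])
    also have "\<dots> = \<phi> (p \<cdot> (y \<cdot> ?e))" by (simp add: comp_assoc flip: w(3))
    also have "\<dots> = \<phi> ((y \<cdot> ?e) \<cdot> p)" by (rule N_trace[OF pN]) (intro mem_intros projD(1)[OF eM] y)
    also have "\<dots> = \<phi> (y \<cdot> ?e)" by (simp add: comp_assoc wp)
    finally show "\<phi> (?e \<cdot> y) = \<phi> (y \<cdot> ?e)" .
  qed
  then have eN: "?e \<in> projections N" using eM by (simp add: projections_def)
  have "\<phi> ?e = of_real (t * Re (\<phi> p))"
    using f(2) pos by (simp add: field_simps)
  then show thesis using that[OF eN] pw by blast
qed

text \<open>
  A nontrivial central projection \<open>z\<close> would have subprojections of \<open>z\<close> and \<open>1 - z\<close> of the same trace,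
  which are equivalent although \<open>z\<close> separates them.
\<close>

lemma no_central_projection:
  assumes z: "z \<in> projections N" "\<And>x. x \<in> N \<Longrightarrow> z \<cdot> x = x \<cdot> z" "z \<noteq> 0"
  shows "z = id_blinfun"
proof (rule ccontr)
  assume "z \<noteq> id_blinfun"
  define c where "c = id_blinfun - z"
  have c: "c \<in> projections N" "c \<noteq> 0"
    using N.proj_compl[OF z(1)] \<open>z \<noteq> id_blinfun\<close> by (auto simp: c_def)
  have pos: "0 < Re (\<phi> z)" "0 < Re (\<phi> c)" using N.phi_proj_pos z c by auto
  have le: "Re (\<phi> z) \<le> 1" "Re (\<phi> c) \<le> 1" using N.phi_proj_le_one z c by auto
  obtain e where e: "e \<in> projections N" "z \<cdot> e = e" "\<phi> e = of_real (Re (\<phi> c) / 2 * Re (\<phi> z))"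
    using subprojection_of_trace[OF z(1,3), of "Re (\<phi> c) / 2"] pos le by auto
  obtain f where f: "f \<in> projections N" "c \<cdot> f = f" "\<phi> f = of_real (Re (\<phi> z) / 2 * Re (\<phi> c))"
    using subprojection_of_trace[OF c, of "Re (\<phi> z) / 2"] pos le by auto
  have "Re (\<phi> c) / 2 * Re (\<phi> z) = Re (\<phi> z) / 2 * Re (\<phi> c)" by simp
  then have eq: "\<phi> e = \<phi> f" using e(3) f(3) by metis
  have nz: "e \<noteq> 0" "f \<noteq> 0" using e(3) f(3) pos phi_zero by auto
  obtain v where v: "v \<in> N" "v\<star> \<cdot> v = e" "v \<cdot> v\<star> = f"
    using equal_trace_equivalent[OF e(1) f(1) nz eq] by metis
  have vP: "v \<in> pisoms N" by (rule N.pisomI_proj[OF v(1,2) e(1)])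
  have ve: "v \<cdot> e = v" using N.pisomD(2)[OF vP] by (simp only: v(2))
  have fv: "f \<cdot> v = v" using N.pisomD(2)[OF vP] by (simp only: v(3)[symmetric] comp_assoc)
  have "v \<cdot> z = v" using ve N.proj_le_swap(1)[OF e(1) z(1) e(2)] by (metis comp_assoc)
  moreover have "z \<cdot> v = 0"
  proof -
    have "c \<cdot> v = v" using fv f(2) by (metis comp_assoc)
    then show ?thesis by (simp add: c_def comp_distribs)
  qed
  ultimately have "v = 0" using z(2)[OF v(1)] by simp
  then show False using v(2) nz(1) by simp
qed

lemma center_N: "vn_center N = range scalar_op"
proof -
  interpret Z: state_algebra "vn_center N" \<phi>
    by (rule state_algebra_subalgebra[OF N.state_algebra_axioms strong_algebra_center[OF N.strong_algebra_axioms]])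
      (auto simp: vn_center_def)
  have "x \<in> range scalar_op" if x: "x \<in> vn_center N" for x
  proof (rule ccontr)
    assume "x \<notin> range scalar_op"
    then obtain z where z: "z \<in> projections (vn_center N)" "z \<noteq> 0" "z \<noteq> id_blinfun"
      using Z.nontrivial_projection[OF x] by metis
    have "z \<in> projections N" "\<And>x. x \<in> N \<Longrightarrow> z \<cdot> x = x \<cdot> z"
      using z(1) by (auto simp: projections_def vn_center_def commutant_def)
    then show False using no_central_projection z by blast
  qed
  then show ?thesis using Z.scalar_mem by blast
qed

text \<open>
  An abelian \<open>e \<noteq> 0\<close> would split into two halves of equal trace, and the partial isometry \<open>v\<close> between
  them does not commute with the first half.
\<close>

lemma abelian_projection_N:
  assumes "abelian_projection N e" shows "e = 0"
proof (rule ccontr)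
  assume "e \<noteq> 0"
  have e: "e \<in> projections N" and abelian: "\<And>x y. x \<in> N \<Longrightarrow> y \<in> N \<Longrightarrow>
      (e \<cdot> x \<cdot> e) \<cdot> (e \<cdot> y \<cdot> e) = (e \<cdot> y \<cdot> e) \<cdot> (e \<cdot> x \<cdot> e)"
    using assms by (auto simp: abelian_projection_def)
  note e' = N.projD[OF e]
  have pos: "0 < Re (\<phi> e)" by (rule N.phi_proj_pos[OF e \<open>e \<noteq> 0\<close>])
  obtain p where p: "p \<in> projections N" "e \<cdot> p = p" "\<phi> p = of_real (1/2 * Re (\<phi> e))"
    using subprojection_of_trace[OF e \<open>e \<noteq> 0\<close>, of "1/2"] by auto
  note p' = N.projD[OF p(1)]
  define q where "q = e - p"
  have q: "q \<in> projections N" unfolding q_def by (rule N.proj_diff[OF p(1) e p(2)])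
  have eq: "\<phi> p = \<phi> q"
    unfolding q_def N.phi_diff[OF e'(1) p'(1)] p(3) by (subst N.phi_proj(1)[OF e]) (simp add: field_simps flip: of_real_mult of_real_diff)
  have p0: "p \<noteq> 0" using p(3) pos phi_zero by auto
  then have q0: "q \<noteq> 0" using eq p(3) pos phi_zero by auto
  obtain v where v: "v \<in> N" "v\<star> \<cdot> v = p" "v \<cdot> v\<star> = q"
    using equal_trace_equivalent[OF p(1) q p0 q0 eq] by metis
  have vP: "v \<in> pisoms N" by (rule N.pisomI_proj[OF v(1,2) p(1)])
  have vp: "v \<cdot> p = v" using N.pisomD(2)[OF vP] by (simp only: v(2))
  have qv: "q \<cdot> v = v" using N.pisomD(2)[OF vP] by (simp only: v(3)[symmetric] comp_assoc)
  have pe: "p \<cdot> e = p" by (rule N.proj_le_swap(1)[OF p(1) e p(2)])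
  have eq': "e \<cdot> q = q" by (simp add: q_def comp_distribs e' p(2))
  have ve: "v \<cdot> e = v" using vp pe by (metis comp_assoc)
  have ev: "e \<cdot> v = v" using qv eq' by (metis comp_assoc)
  have "p \<cdot> q = 0" by (simp add: q_def comp_distribs p' pe)
  then have pv: "p \<cdot> v = 0" using qv by (metis comp_assoc comp_zero(2))
  have "v = 0" using abelian[OF v(1) p'(1)] by (simp add: ev ve p(2) pe vp pv)
  then show False using v(2) p0 by simp
qed

text \<open>A faithful trace forbids an isometry onto a proper subspace.\<close>

lemma finite_projection_N: "finite_projection N id_blinfun"
  unfolding finite_projection_def
proof (intro conjI ballI impI N.proj_id)
  fix p assume p: "p \<in> projections N" and le: "proj_le p id_blinfun \<and> proj_equiv N id_blinfun p"
  then obtain v where v: "v \<in> N" "v\<star> \<cdot> v = id_blinfun" "v \<cdot> v\<star> = p" by (auto simp: proj_equiv_def)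
  have "\<phi> p = 1" using N.trace[OF v(1) N.adj_mem[OF v(1)]] by (simp add: v phi_id)
  then have "Re (\<phi> (id_blinfun - p)) = 0" using N.projD[OF p] by (simp add: N.phi_diff N.id_mem phi_id)
  then show "p = id_blinfun" using N.phi_proj(3)[OF N.proj_compl[OF p]] by simp
qed

lemma factor_N: "factor N"
  unfolding factor_def
  using von_neumann_algebra_centralizer[OF von_neumann nfs] center_N factor
  by (auto simp: factor_def)

lemma type_II1_N: "type_II1 N"
  unfolding type_II1_def type_II_def
proof (intro conjI allI impI ballI finite_projection_N abelian_projection_N)
  show "von_neumann_algebra N" by (rule von_neumann_algebra_centralizer[OF von_neumann nfs])
  fix z assume z: "z \<in> projections N \<inter> vn_center N" "z \<noteq> 0"
  then have "z = id_blinfun"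
    by (intro no_central_projection) (auto simp: vn_center_def commutant_def)
  then show "\<exists>e. finite_projection N e \<and> e \<noteq> 0 \<and> proj_le e z"
    using finite_projection_N z(2) by (intro exI[of _ id_blinfun]) (simp add: proj_le_def)
qed

end

theorem proposition4p24:
  fixes M :: "('a::complex_hilbert_space \<Rightarrow>\<^sub>L 'a) set"
    and \<phi> :: "('a \<Rightarrow>\<^sub>L 'a) \<Rightarrow> complex"
  assumes "factor M"
    and "sigma_finite_vn M"
    and "\<not> isomorphic_to_complex M"
    and "strictly_homogeneous_state_space M"
    and "normal_faithful_state M \<phi>"
  shows "factor (centralizer M \<phi>) \<and> type_II1 (centralizer M \<phi>)"
proof -
  interpret homogeneous_factor M \<phi> using assms by unfold_locales
  show ?thesis using factor_N type_II1_N by blast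
qed

end
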